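(* Let $0<a<b<\infty$ and let $M\ge 1$ be an integer. Let $W(t)$ be a bounded nondecreasing function with at least $M+1$ points of increase for $a\le t\le b$, and let $f(z)=\int_a^b e^{-zt}\,dW(t)$, $z\in\mathbb{C}$. Let $\varphi_{a/b}\in\mathcal{F}_{a/b}$ satisfy $\rho_{\mathrm A}[\varphi_{a/b}]>1$. Let $u_\nu,c_\nu$ ($\nu=1,\dots,M$) be the nodes and weights of the $M$-point Gaussian quadrature for $dW(b\varphi_{a/b}(u))$ on $[-1,1]$. Then $$0<\max_{0\le x<\infty}\left|f(x)-\sum_{\nu=1}^M c_\nu e^{-b\varphi_{a/b}(u_\nu)x}\right|<\frac{16}{\pi}\,\hat\rho[\varphi_{a/b}]^{-2M}f(0).$$ Moreover, this upper bound is the best possible maximum absolute error bound obtainable from the family of pointwise bounds $\left|f(x)-\sum_{\nu=1}^M c_\nu e^{-b\varphi_{a/b}(u_\nu)x}\right|<\frac{16}{\pi}\rho^{-2M}e^{-bx\inf_{u\in\mathbb{E}_\rho}\operatorname{Re}\varphi_{a/b}(u)}f(0)$ ($\rho\in I_{\varphi_{a/b}}$, $0<x<\infty$), i.e. $$\sup_{0<x<\infty}\ \inf_{\rho\in I_{\varphi_{a/b}}}\rho^{-2M}e^{-bx\inf_{u\in\mathbb{E}_\rho}\operatorname{Re}\varphi_{a/b}(u)}=\hat\rho[\varphi_{a/b}]^{-2M}.$$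
   Context: Integrals $\int\cdot\,dW$ are Riemann–Stieltjes integrals. A point of increase of a nondecreasing function $W$ on $[a,b]$ is a point no neighbourhood of which (relative to $[a,b]$) has $W$ constant on it. For $1<\rho<\infty$ the open Bernstein ellipse is $\mathbb{E}_\rho=\{z\in\mathbb{C}:\frac{(\operatorname{Re}z)^2}{((\rho+\rho^{-1})/2)^2}+\frac{(\operatorname{Im}z)^2}{((\rho-\rho^{-1})/2)^2}<1\}$, with boundary $\mathrm{bd}(\mathbb{E}_\rho)$; $\mathbb{E}_\infty=\mathbb{C}$. For $0<r<1$, $\mathcal{F}_r$ is the set of real functions $\varphi_r$ on $[-1,1]$ that are continuous and strictly increasing with $\varphi_r(-1)=r$, $\varphi_r(1)=1$. For $F:[-1,1]\to\mathbb{R}$, $\rho_{\mathrm A}[F]\in[1,\infty]$ is: $1$ if $F$ is not analytic at some point of $[-1,1]$; $\rho\in(1,\infty)$ if $F$ extends analytically to $\mathbb{E}_\rho$ and the extension is not analytic at some point of $\mathrm{bd}(\mathbb{E}_\rho)$; $\infty$ if $F$ extends to an entire function. When $\rho_{\mathrm A}[\varphi_r]>1$, $\varphi_r$ also denotes its analytic continuation to $\mathbb{E}_{\rho_{\mathrm A}[\varphi_r]}$. For $\varphi_r\in\mathcal{F}_r$ with $\rho_{\mathrm A}[\varphi_r]>1$ put $m=\inf_{u\in\mathbb{E}_{\rho_{\mathrm A}[\varphi_r]}}\operatorname{Re}\varphi_r(u)\in[-\infty,\infty)$. Then $I_{\varphi_r}=(1,\rho_{\mathrm A}[\varphi_r])$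 if $m=-\infty$ and $I_{\varphi_r}=(1,\rho_{\mathrm A}[\varphi_r]]$ if $m>-\infty$ (in the latter case $\rho_{\mathrm A}[\varphi_r]<\infty$). If $m<0$, $\rho_0[\varphi_r]$ denotes the unique number in $(1,\rho_{\mathrm A}[\varphi_r])$ with $\inf_{u\in\mathbb{E}_{\rho_0[\varphi_r]}}\operatorname{Re}\varphi_r(u)=0$. Define $\hat\rho[\varphi_r]=\rho_{\mathrm A}[\varphi_r]$ if $m\ge0$ and $\hat\rho[\varphi_r]=\rho_0[\varphi_r]$ if $m<0$. The nodes and weights of the $M$-point Gaussian quadrature for $dW(b\varphi_{a/b}(u))$ on $[-1,1]$ are the numbers $-1<u_1<\dots<u_M<1$, $c_\nu>0$, with $\int_{-1}^1p(u)\,dW(b\varphi_{a/b}(u))=\sum_{\nu=1}^Mc_\nu p(u_\nu)$ for all real polynomials $p$ of degree at most $2M-1$. *)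

theory Defs
  imports "HOL-Analysis.Analysis" "HOL-Computational_Algebra.Polynomial"
begin

text \<open>Riemann--Stieltjes integral of \<open>g\<close> with respect to \<open>W\<close> on \<open>[a,b]\<close>, as the limit of the
  Riemann--Stieltjes sums when the mesh tends to \<open>0\<close>. Unlike for the gauge integral, the
  radius \<open>\<delta>\<close> does not depend on the tag.\<close>

definition has_RS_integral ::
    "(real \<Rightarrow> 'a::real_normed_vector) \<Rightarrow> (real \<Rightarrow> real) \<Rightarrow> real \<Rightarrow> real \<Rightarrow> 'a \<Rightarrow> bool" where
  "has_RS_integral g W a b I \<longleftrightarrow>
     (\<forall>\<epsilon>>0. \<exists>\<delta>>0. \<forall>p. p tagged_division_of {a..b} \<and> (\<lambda>t. ball t \<delta>) fine p \<longrightarrow>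
        norm ((\<Sum>(t, K)\<in>p. (W (Sup K) - W (Inf K)) *\<^sub>R g t) - I) < \<epsilon>)"

definition points_of_increase :: "(real \<Rightarrow> real) \<Rightarrow> real \<Rightarrow> real \<Rightarrow> real set" where
  "points_of_increase W a b =
     {t \<in> {a..b}. \<forall>U. open U \<and> t \<in> U \<longrightarrow> \<not> W constant_on (U \<inter> {a..b})}"

definition gauss_quadrature ::
    "nat \<Rightarrow> (real \<Rightarrow> real) \<Rightarrow> (nat \<Rightarrow> real) \<Rightarrow> (nat \<Rightarrow> real) \<Rightarrow> bool" where
  "gauss_quadrature M V u c \<longleftrightarrow>
     strict_mono_on {1..M} u \<and>
     (\<forall>\<nu>\<in>{1..M}. -1 < u \<nu> \<and> u \<nu> < 1 \<and> c \<nu> > 0) \<and>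
     (\<forall>p :: real poly. degree p \<le> 2 * M - 1 \<longrightarrow>
        has_RS_integral (poly p) V (-1) 1 (\<Sum>\<nu>=1..M. c \<nu> * poly p (u \<nu>)))"

text \<open>The parameter is meant to lie in \<open>(1,\<infinity>]\<close>.\<close>

definition bernstein_ellipse :: "ereal \<Rightarrow> complex set" where
  "bernstein_ellipse \<rho> =
     (if \<rho> = \<infinity> then UNIV
      else let r = real_of_ereal \<rho> in
        {z. (Re z)\<^sup>2 / ((r + inverse r) / 2)\<^sup>2 + (Im z)\<^sup>2 / ((r - inverse r) / 2)\<^sup>2 < 1})"

definition F_class :: "real \<Rightarrow> (real \<Rightarrow> real) set" where
  "F_class r = {\<phi>. continuous_on {-1..1} \<phi> \<and> strict_mono_on {-1..1} \<phi> \<and> \<phi> (-1) = r \<and> \<phi> 1 = 1}"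

definition analytic_extension :: "(real \<Rightarrow> real) \<Rightarrow> complex set \<Rightarrow> (complex \<Rightarrow> complex) \<Rightarrow> bool" where
  "analytic_extension F S g \<longleftrightarrow>
     g holomorphic_on S \<and> (\<forall>x\<in>{-1..1}. g (of_real x) = of_real (F x))"

text \<open>A function given on \<open>S\<close> only is analytic at \<open>w\<close> (a point of \<open>S\<close> or of its boundary) if near
  \<open>w\<close> it is the restriction to \<open>S\<close> of a function holomorphic in a full complex neighbourhood
  of \<open>w\<close>.\<close>

definition analytic_at_point :: "complex set \<Rightarrow> (complex \<Rightarrow> complex) \<Rightarrow> complex \<Rightarrow> bool" where
  "analytic_at_point S g w \<longleftrightarrow>
     (\<exists>e>0. \<exists>h. h holomorphic_on ball w e \<and> (\<forall>z \<in> ball w e \<inter> S. h z = g z))"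

definition rho_A :: "(real \<Rightarrow> real) \<Rightarrow> ereal" where
  "rho_A F = (THE \<rho>.
      (\<rho> = 1 \<and> (\<exists>x\<in>{-1..1}.
          \<not> analytic_at_point (complex_of_real ` {-1..1}) (\<lambda>z. of_real (F (Re z))) (of_real x)))
    \<or> (1 < \<rho> \<and> \<rho> < \<infinity> \<and> (\<exists>g. analytic_extension F (bernstein_ellipse \<rho>) g \<and>
          (\<exists>w\<in>frontier (bernstein_ellipse \<rho>). \<not> analytic_at_point (bernstein_ellipse \<rho>) g w)))
    \<or> (\<rho> = \<infinity> \<and> (\<exists>g. analytic_extension F UNIV g)))"

text \<open>For \<open>rho_A F > 1\<close> the continuation is determined on \<open>bernstein_ellipse (rho_A F)\<close> only; it is
  never used elsewhere.\<close>

definition continuation :: "(real \<Rightarrow> real) \<Rightarrow> complex \<Rightarrow> complex" where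
  "continuation F = (SOME g. analytic_extension F (bernstein_ellipse (rho_A F)) g)"

definition inf_Re :: "(real \<Rightarrow> real) \<Rightarrow> ereal \<Rightarrow> ereal" where
  "inf_Re \<phi> \<rho> = (INF u\<in>bernstein_ellipse \<rho>. ereal (Re (continuation \<phi> u)))"

text \<open>In the second case \<open>rho_A \<phi> < \<infinity>\<close> when \<open>\<phi>\<close> is nonconstant (Liouville), so that real
  parameters suffice.\<close>

definition I_set :: "(real \<Rightarrow> real) \<Rightarrow> real set" where
  "I_set \<phi> = (if inf_Re \<phi> (rho_A \<phi>) = -\<infinity> then {\<rho>. 1 < \<rho> \<and> ereal \<rho> < rho_A \<phi>}
              else {\<rho>. 1 < \<rho> \<and> ereal \<rho> \<le> rho_A \<phi>})"

definition rho_0 :: "(real \<Rightarrow> real) \<Rightarrow> real" where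
  "rho_0 \<phi> = (THE \<rho>. 1 < \<rho> \<and> ereal \<rho> < rho_A \<phi> \<and> inf_Re \<phi> \<rho> = 0)"

definition rho_hat :: "(real \<Rightarrow> real) \<Rightarrow> real" where
  "rho_hat \<phi> = (if inf_Re \<phi> (rho_A \<phi>) \<ge> 0 then real_of_ereal (rho_A \<phi>) else rho_0 \<phi>)"

end

theory Submission
  imports Defs "HOL-Complex_Analysis.Complex_Analysis"
begin

text \<open>
  Quadrature is exact in degree below \<open>n = 2 M\<close>, so the error at \<open>x\<close> is at most \<open>2 f(0)\<close> times the
  distance of \<open>y \<mapsto> exp (- b x \<phi> y)\<close> to the polynomials of degree below \<open>n\<close> on \<open>[-1,1]\<close>. Let \<open>g\<close> be
  holomorphic on the ellipse with parameter \<open>\<rho>\<close>, real on \<open>[-1,1]\<close> and bounded by \<open>K\<close>, and put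
  \<open>q = \<rho>\<^sup>-\<^sup>n\<close>. With \<open>z = cosh \<sigma>\<close> and \<open>x = cos \<theta>\<close>, Cauchy's formula has the kernel
  \<open>sinh \<sigma> / (cosh \<sigma> - cos \<theta>) = 1 + \<Sum> y / (1 - y)\<close>, the sum being over \<open>y = exp (\<plusminus> \<i> \<theta> - \<sigma>)\<close>.
  Adding \<open>q\<^sup>2\<close> times the kernel at the conjugate point turns the tail \<open>y\<^sup>n / (1 - y)\<close> into \<open>y\<^sup>n\<close> times the
  Poisson kernel, modulo cosines of order below \<open>n\<close>; shifting the contour to the segment shows
  that this costs at most \<open>K q\<^sup>2\<close>. Hence the distance is at most \<open>K (2 q + q\<^sup>2)\<close>, which is smaller than
  \<open>(8 / \<pi>) K q\<close> for \<open>q \<le> 1 / 2\<close>; for \<open>q > 1 / 2\<close> the trivial bound \<open>K\<close> is.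

  The error does not vanish identically because the square of a polynomial in \<open>e\<^sup>-\<^sup>t\<close> with \<open>M\<close> roots
  has positive integral. For the optimality, the infimum of \<open>Re \<phi>\<close> over the ellipse with parameter
  \<open>exp s\<close> is a concave function of \<open>s\<close> by the three lines theorem; if it has a zero, a supporting line
  there gives a point at which the supremum is attained, otherwise \<open>x\<close> tends to \<open>0\<close>.
\<close>

section \<open>Bernstein ellipses as images of strips\<close>

text \<open>The usual estimate for the truncated Chebyshev series carries a factor 1 / (\<rho> - 1),
  because the mean of |1 / (1 - y)| is unbounded as the ellipse shrinks to the segment; no constant
  uniform in \<rho> comes from it. The Poisson kernel is nonnegative with mean 1. It can be produced
  because y times its conjugate is constant on a vertical line, so the surplus terms of the
  reflected series are multiples of the same cosines. The price is small because \<open>g\<close> is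
  real on the segment: there only the real part of the kernel enters, and that part is nonnegative.

  The constant 16 / pi is twice 8 / pi and leaves slack, since 2 q + q^2 <= (5 / 2) q and 5 / 2 < 8
  / pi. The slack makes the inequality strict and lets the contour stay inside the open ellipse,
  which matters at \<rho> = \<open>rho_A\<close>, where \<open>g\<close> may have no boundary
  values.

  A separate obstacle is that \<open>rho_A\<close> is a definite description: nothing can be said
  about the continuation before its solution is known to exist and to be unique.\<close>

lemma cosh_Complex: "cosh (Complex s t) = Complex (cosh s * cos t) (sinh s * sin t)"
  by (simp add: complex_eq_iff cosh_field_def sinh_field_def Re_exp Im_exp field_simps)

lemma bernstein_ellipse_ereal:
  "bernstein_ellipse (ereal r) =
    {z. (Re z)\<^sup>2 / ((r + inverse r) / 2)\<^sup>2 + (Im z)\<^sup>2 / ((r - inverse r) / 2)\<^sup>2 < 1}"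
  by (simp add: bernstein_ellipse_def)

text \<open>For \<rho> = exp l the semi-axes are cosh l and sinh l. At cosh (s + \<i> t) the
  quadratic form is the average, with weights cos^2 t and sin^2 t, of two ratios that are below 1
  for |s| < l.\<close>

lemma cosh_in_bernstein_ellipse:
  assumes "ereal (exp \<bar>s\<bar>) < \<rho>"
  shows "cosh (Complex s t) \<in> bernstein_ellipse \<rho>"
proof (cases \<rho>)
  case (real r)
  have r: "exp \<bar>s\<bar> < r" using assms real by simp
  have r1: "r > 1" using r one_le_exp_iff[of "\<bar>s\<bar>"] by linarith
  define l where "l = ln r"
  have l: "r = exp l" "\<bar>s\<bar> < l" "l > 0"
    using r r1 unfolding l_def by (auto simp: ln_gt_zero exp_less_cancel_iff[of _ "ln r", symmetric])
  have A: "(r + inverse r) / 2 = cosh l" "(r - inverse r) / 2 = sinh l"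
    by (simp_all add: l cosh_field_def sinh_field_def exp_minus)
  have c: "(cosh s)\<^sup>2 < (cosh l)\<^sup>2"
    using l cosh_real_strict_mono[of "\<bar>s\<bar>" l] by (intro power_strict_mono) auto
  have sl: "(sinh s)\<^sup>2 < (sinh l)\<^sup>2"
    using c by (simp add: cosh_square_eq)
  have "(cosh s * cos t)\<^sup>2 / (cosh l)\<^sup>2 + (sinh s * sin t)\<^sup>2 / (sinh l)\<^sup>2
      = (cos t)\<^sup>2 * ((cosh s)\<^sup>2 / (cosh l)\<^sup>2) + (sin t)\<^sup>2 * ((sinh s)\<^sup>2 / (sinh l)\<^sup>2)"
    by (simp add: power_mult_distrib mult.commute)
  also have "\<dots> < (cos t)\<^sup>2 + (sin t)\<^sup>2"
  proof -
    have 1: "(cosh s)\<^sup>2 / (cosh l)\<^sup>2 < 1" using c by simp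
    have 2: "(sinh s)\<^sup>2 / (sinh l)\<^sup>2 < 1" using sl l by simp
    have le: "(cos t)\<^sup>2 * ((cosh s)\<^sup>2 / (cosh l)\<^sup>2) \<le> (cos t)\<^sup>2"
         "(sin t)\<^sup>2 * ((sinh s)\<^sup>2 / (sinh l)\<^sup>2) \<le> (sin t)\<^sup>2"
      using 1 2 by (metis less_imp_le mult_left_le zero_le_power2)+
    \<comment> \<open>One of the weights may vanish, so strictness has to come from one that does
      not.\<close>
    show ?thesis
    proof (cases "cos t = 0")
      case True
      then have "sin t \<noteq> 0" using sin_cos_squared_add[of t] by auto
      then have "(sin t)\<^sup>2 * ((sinh s)\<^sup>2 / (sinh l)\<^sup>2) < (sin t)\<^sup>2"
        using mult_strict_left_mono[OF 2, of "(sin t)\<^sup>2"] by simp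
      then show ?thesis using le by linarith
    next
      case False
      then have "(cos t)\<^sup>2 * ((cosh s)\<^sup>2 / (cosh l)\<^sup>2) < (cos t)\<^sup>2"
        using mult_strict_left_mono[OF 1, of "(cos t)\<^sup>2"] by simp
      then show ?thesis using le by linarith
    qed
  qed
  finally show ?thesis
    unfolding real bernstein_ellipse_ereal A cosh_Complex by simp
qed (use assms in \<open>auto simp: bernstein_ellipse_def\<close>)

text \<open>\<open>Arccos\<close> inverts cos, hence cosh after a rotation by \<i>; evenness of cosh
  then makes the real part nonnegative. The bound on t restricts to one period, as
  \<open>three_lines_periodic\<close> requires.\<close>

lemma complex_eq_cosh:
  obtains s t where "0 \<le> s" "\<bar>t\<bar> \<le> pi" "z = cosh (Complex s t)"
proof -
  define \<sigma> where "\<sigma> = - \<i> * Arccos z"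
  have z: "cosh \<sigma> = z" by (simp add: \<sigma>_def cosh_conv_cos)
  have im: "\<bar>Im \<sigma>\<bar> \<le> pi" using Re_Arccos_bound[of z] by (simp add: \<sigma>_def)
  show ?thesis
  proof (cases "Re \<sigma> \<ge> 0")
    case True
    then show ?thesis using that[of "Re \<sigma>" "Im \<sigma>"] z im by simp
  next
    case False
    have "Complex (- Re \<sigma>) (- Im \<sigma>) = - \<sigma>" by (simp add: complex_eq_iff)
    then show ?thesis using that[of "- Re \<sigma>" "- Im \<sigma>"] z im False by simp
  qed
qed

lemma in_bernstein_ellipseE:
  assumes "z \<in> bernstein_ellipse \<rho>" "1 < \<rho>"
  obtains s t where "0 \<le> s" "ereal (exp s) < \<rho>" "\<bar>t\<bar> \<le> pi" "z = cosh (Complex s t)"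
proof -
  obtain s t where st: "0 \<le> s" "\<bar>t\<bar> \<le> pi" "z = cosh (Complex s t)"
    using complex_eq_cosh by blast
  have "ereal (exp s) < \<rho>"
  proof (rule ccontr)
    assume n: "\<not> ereal (exp s) < \<rho>"
    then obtain r where r: "\<rho> = ereal r" using assms by (cases \<rho>) auto
    define l where "l = ln r"
    have l: "r = exp l" "l \<le> s" "l > 0"
      using n r assms(2) unfolding l_def by (auto simp: not_less exp_le_cancel_iff[of "ln r", symmetric])
    have A: "(r + inverse r) / 2 = cosh l" "(r - inverse r) / 2 = sinh l"
      by (simp_all add: l cosh_field_def sinh_field_def exp_minus)
    have c: "(cosh l)\<^sup>2 \<le> (cosh s)\<^sup>2"
      using l by (intro power_mono cosh_real_nonneg_le_iff[THEN iffD2]) auto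
    have sl: "(sinh l)\<^sup>2 \<le> (sinh s)\<^sup>2"
      using c by (simp add: cosh_square_eq)
    have "1 = (cos t)\<^sup>2 + (sin t)\<^sup>2" by simp
    also have "\<dots> \<le> (cos t)\<^sup>2 * ((cosh s)\<^sup>2 / (cosh l)\<^sup>2) + (sin t)\<^sup>2 * ((sinh s)\<^sup>2 / (sinh l)\<^sup>2)"
    proof -
      have "1 \<le> (cosh s)\<^sup>2 / (cosh l)\<^sup>2" "1 \<le> (sinh s)\<^sup>2 / (sinh l)\<^sup>2"
        using c sl l by (simp_all add: le_divide_eq_1)
      then show ?thesis
        by (intro add_mono) (auto simp: mult_le_cancel_left1 simp del: times_divide_eq_right)
    qed
    also have "\<dots> = (cosh s * cos t)\<^sup>2 / (cosh l)\<^sup>2 + (sinh s * sin t)\<^sup>2 / (sinh l)\<^sup>2"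
      by (simp add: power_mult_distrib mult.commute)
    finally show False
      using assms(1) unfolding r bernstein_ellipse_ereal A st cosh_Complex by simp
  qed
  then show ?thesis using st that by blast
qed

lemma in_bernstein_ellipse_erealE:
  assumes "z \<in> bernstein_ellipse (ereal r)" "1 < r"
  obtains s t where "0 \<le> s" "exp s < r" "z = cosh (Complex s t)"
  by (rule in_bernstein_ellipseE[OF assms(1)]) (use assms(2) that in \<open>auto simp: one_ereal_def\<close>)

lemma bernstein_ellipse_mono:
  assumes "1 < \<rho>" "\<rho> \<le> \<rho>'"
  shows "bernstein_ellipse \<rho> \<subseteq> bernstein_ellipse \<rho>'"
proof
  fix z assume "z \<in> bernstein_ellipse \<rho>"
  then obtain s t where "0 \<le> s" "ereal (exp s) < \<rho>" "z = cosh (Complex s t)"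
    using assms(1) by (rule in_bernstein_ellipseE)
  then show "z \<in> bernstein_ellipse \<rho>'"
    using cosh_in_bernstein_ellipse[of s \<rho>' t] assms(2) by (simp add: less_le_trans)
qed

lemma bernstein_ellipse_exhaust:
  assumes "z \<in> bernstein_ellipse \<rho>" "1 < \<rho>"
  obtains r where "1 < r" "ereal r < \<rho>" "z \<in> bernstein_ellipse (ereal r)"
proof -
  obtain s t where st: "0 \<le> s" "ereal (exp s) < \<rho>" "z = cosh (Complex s t)"
    using assms by (rule in_bernstein_ellipseE)
  obtain r where r: "ereal (exp s) < ereal r" "ereal r < \<rho>"
    using ereal_dense2[OF st(2)] by blast
  show ?thesis
  proof (rule that[of r])
    show "1 < r" using r(1) one_le_exp_iff[of s] st(1) by (simp del: one_le_exp_iff)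
  qed (use r st cosh_in_bernstein_ellipse[of s "ereal r" t] in auto)
qed

lemma continuous_on_quadratic_form: "continuous_on S (\<lambda>z. (Re z)\<^sup>2 / A + (Im z)\<^sup>2 / B)"
  unfolding divide_inverse by (intro continuous_on_add continuous_on_mult continuous_on_const continuous_on_power continuous_on_Re continuous_on_Im continuous_on_id)

lemma open_bernstein_ellipse: "open (bernstein_ellipse \<rho>)"
proof (cases "\<rho> = \<infinity>")
  case False
  then show ?thesis
    unfolding bernstein_ellipse_def Let_def if_not_P[OF False]
    by (intro open_Collect_less continuous_on_quadratic_form continuous_on_const)
qed (simp add: bernstein_ellipse_def)

lemma convex_bernstein_ellipse: "convex (bernstein_ellipse \<rho>)"
proof (cases "\<rho> = \<infinity>")
  case False
  define r where "r = real_of_ereal \<rho>"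
  define L where "L = (\<lambda>z. Complex (Re z / ((r + inverse r) / 2)) (Im z / ((r - inverse r) / 2)))"
  have "linear L"
    by (rule linearI) (auto simp: L_def complex_eq_iff add_divide_distrib)
  moreover have "bernstein_ellipse \<rho> = L -` ball 0 1"
  proof (rule set_eqI)
    fix z
    have "z \<in> L -` ball 0 1 \<longleftrightarrow> (Re (L z))\<^sup>2 + (Im (L z))\<^sup>2 < 1"
      by (simp add: cmod_def)
    also have "\<dots> \<longleftrightarrow> z \<in> bernstein_ellipse \<rho>"
      using False by (simp only: bernstein_ellipse_def L_def r_def Let_def power_divide if_False
          mem_Collect_eq complex.sel)
    finally show "z \<in> bernstein_ellipse \<rho> \<longleftrightarrow> z \<in> L -` ball 0 1" by simp
  qed
  ultimately show ?thesis
    by (simp add: convex_linear_vimage)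
qed (simp add: bernstein_ellipse_def)

lemma of_real_in_bernstein_ellipse:
  assumes "x \<in> {-1..1}" "1 < \<rho>"
  shows "complex_of_real x \<in> bernstein_ellipse \<rho>"
proof -
  have "complex_of_real x = cosh (Complex 0 (arccos x))"
    using assms by (simp add: cosh_Complex complex_eq_iff)
  then show ?thesis
    using cosh_in_bernstein_ellipse[of 0 \<rho> "arccos x"] assms by (simp add: one_ereal_def)
qed

lemma bounded_bernstein_ellipse: "bounded (bernstein_ellipse (ereal r))" if "1 < r"
proof -
  have "cmod z \<le> r" if z: "z \<in> bernstein_ellipse (ereal r)" for z
  proof -
    obtain s t where st: "0 \<le> s" "exp s < r" "z = cosh (Complex s t)"
      using in_bernstein_ellipse_erealE[OF z \<open>1 < r\<close>] by blast
    have "cmod (exp (Complex s t)) = exp s" "cmod (exp (- Complex s t)) = exp (- s)"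
      by simp_all
    moreover have "exp (- s) \<le> exp s" using st by simp
    ultimately have "cmod (exp (Complex s t) + exp (- Complex s t)) \<le> 2 * exp s"
      using norm_triangle_ineq[of "exp (Complex s t)" "exp (- Complex s t)"] by linarith
    then have "cmod z \<le> exp s"
      unfolding st cosh_field_def norm_divide by simp
    then show ?thesis using st by linarith
  qed
  then show ?thesis by (auto simp: bounded_iff)
qed

lemma closure_bernstein_ellipse_subset:
  assumes "1 < r" "ereal r < \<rho>"
  shows "closure (bernstein_ellipse (ereal r)) \<subseteq> bernstein_ellipse \<rho>"
proof (cases \<rho>)
  case (real r')
  have r': "r < r'" using assms real by simp
  define Q where "Q = (\<lambda>r z. (Re z)\<^sup>2 / ((r + inverse r) / 2)\<^sup>2 + (Im z)\<^sup>2 / ((r - inverse r) / 2)\<^sup>2 :: real)"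
  have "closure (bernstein_ellipse (ereal r)) \<subseteq> {z. Q r z \<le> 1}"
  proof (rule closure_minimal)
    show "closed {z. Q r z \<le> 1}"
      unfolding Q_def by (intro closed_Collect_le continuous_on_quadratic_form continuous_on_const)
  qed (auto simp: bernstein_ellipse_ereal Q_def)
  also have "\<dots> \<subseteq> bernstein_ellipse \<rho>"
  proof
    fix z assume "z \<in> {z. Q r z \<le> 1}"
    then have z: "Q r z \<le> 1" by simp
    have inv: "inverse r' < inverse r" "inverse r < 1" "inverse r' > 0"
      using r' assms by (auto simp: field_simps)
    have mono: "0 < (r + inverse r) / 2" "(r + inverse r) / 2 < (r' + inverse r') / 2"
      "0 < (r - inverse r) / 2" "(r - inverse r) / 2 < (r' - inverse r') / 2"
    proof -
      \<comment> \<open>The drop in 1 / r is smaller than the gain in r because r r' > 1.\<close>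
      have "inverse r - inverse r' = (r' - r) * (inverse r * inverse r')"
        using assms r' by (simp add: field_simps)
      also have "\<dots> < (r' - r) * 1"
      proof (rule mult_strict_left_mono)
        show "inverse r * inverse r' < 1"
          using mult_strict_mono'[of "inverse r" 1 "inverse r'" 1] inv assms(1) by simp
      qed (use r' in simp)
      finally show "(r + inverse r) / 2 < (r' + inverse r') / 2" by simp
    next
      show "0 < (r + inverse r) / 2"
        using assms(1) by (intro divide_pos_pos add_pos_pos) auto
      show "(r - inverse r) / 2 < (r' - inverse r') / 2"
        by (intro divide_strict_right_mono diff_strict_mono inv(1) r') simp
    qed (use inv assms r' in auto)
    have lt: "x\<^sup>2 / B\<^sup>2 < x\<^sup>2 / A\<^sup>2" if "x \<noteq> 0" "0 < A" "A < B" for x A B :: real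
      using that by (intro divide_strict_left_mono power_strict_mono) auto
    \<comment> \<open>Both semi-axes grow strictly, so the form decreases strictly except at the
      origin, where it is 0.\<close>
    have "Q r' z < 1"
    proof (cases "z = 0")
      case False
      then have "Re z \<noteq> 0 \<or> Im z \<noteq> 0" by (simp add: complex_eq_iff)
      then have "Q r' z < Q r z"
        unfolding Q_def
        using lt[of "Re z" "(r + inverse r) / 2" "(r' + inverse r') / 2"]
          lt[of "Im z" "(r - inverse r) / 2" "(r' - inverse r') / 2"] mono
        by (cases "Re z = 0"; cases "Im z = 0") (auto intro: add_strict_mono)
      then show ?thesis using z by simp
    qed (simp add: Q_def)
    then show "z \<in> bernstein_ellipse \<rho>" by (simp add: real bernstein_ellipse_ereal Q_def)
  qed
  finally show ?thesis .
qed (use assms in \<open>auto simp: bernstein_ellipse_def\<close>)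

lemma compact_closure_bernstein_ellipse:
  "1 < r \<Longrightarrow> compact (closure (bernstein_ellipse (ereal r)))"
  by (simp add: bounded_bernstein_ellipse)

text \<open>At fixed t the displacement is bounded by the increments of cosh and of sinh, which add
  up to that of exp. Distances are thereby measured in the ellipse parameter exp s itself, uniformly
  in t.\<close>

lemma dist_cosh_Complex_le:
  assumes "0 \<le> s'" "s' \<le> s"
  shows "dist (cosh (Complex s' t)) (cosh (Complex s t)) \<le> exp s - exp s'"
proof -
  have c: "cosh s' \<le> cosh s" "sinh s' \<le> sinh s"
    using assms by (auto simp: cosh_real_nonneg_le_iff)
  have "dist (cosh (Complex s' t)) (cosh (Complex s t))
      \<le> \<bar>(cosh s - cosh s') * cos t\<bar> + \<bar>(sinh s - sinh s') * sin t\<bar>"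
    unfolding dist_norm cosh_Complex
    using cmod_le[of "Complex (cosh s' * cos t) (sinh s' * sin t) - Complex (cosh s * cos t) (sinh s * sin t)"]
    by (simp add: algebra_simps abs_minus_commute)
  also have "\<dots> \<le> (cosh s - cosh s') + (sinh s - sinh s')"
    using c by (intro add_mono) (auto simp: abs_mult mult_left_le)
  also have "\<dots> = exp s - exp s'"
    by (simp add: cosh_plus_sinh[symmetric])
  finally show ?thesis .
qed

lemma bernstein_ellipse_subset_nbhd:
  assumes "1 < r" "open U" "closure (bernstein_ellipse (ereal r)) \<subseteq> U"
  obtains r' where "r < r'" "bernstein_ellipse (ereal r') \<subseteq> U"
proof -
  obtain e where e: "e > 0" "(\<Union>x\<in>closure (bernstein_ellipse (ereal r)). ball x e) \<subseteq> U"
    using compact_subset_open_imp_ball_epsilon_subset[OF compact_closure_bernstein_ellipse] assms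
    by metis
  define d where "d = min (e / 2) ((r - 1) / 2)"
  have d: "0 < d" "d < e" "r - d > 1"
    using e(1) assms(1) by (auto simp: d_def min_def field_simps)
  show ?thesis
  proof (rule that[of "r + d / 2"])
    show "bernstein_ellipse (ereal (r + d / 2)) \<subseteq> U"
    proof
      fix z assume z: "z \<in> bernstein_ellipse (ereal (r + d / 2))"
      obtain s t where st: "0 \<le> s" "exp s < r + d / 2" "z = cosh (Complex s t)"
        using in_bernstein_ellipse_erealE[OF z] assms(1) d(1) by auto
      show "z \<in> U"
      proof (cases "exp s < r")
        case True
        then have "z \<in> bernstein_ellipse (ereal r)"
          using cosh_in_bernstein_ellipse[of s "ereal r" t] st by simp
        then show ?thesis using assms(3) closure_subset by blast
      next
        case False
        \<comment> \<open>A point of parameter at least r is compared with the one of parameter r -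
          d / 2 at the same t: the latter lies strictly inside the open ellipse, and the
          displacement is below d, hence below e.\<close>
        define s' where "s' = ln (r - d / 2)"
        have s': "0 \<le> s'" "exp s' = r - d / 2" "s' \<le> s"
        proof -
          show "0 \<le> s'" "exp s' = r - d / 2" using d by (auto simp: s'_def)
          then show "s' \<le> s" using False d(1) exp_le_cancel_iff[of s' s] by linarith
        qed
        have "cosh (Complex s' t) \<in> bernstein_ellipse (ereal r)"
          using s' d cosh_in_bernstein_ellipse[of s' "ereal r" t] by simp
        moreover have "dist (cosh (Complex s' t)) z < e"
          using dist_cosh_Complex_le[of s' s t] s' st d by simp
        ultimately show ?thesis
          using e(2) closure_subset by fastforce
      qed
    qed
  qed (use d in auto)
qed

text \<open>The limiting parameter 1, where the ellipse degenerates to the segment; the comparison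
  point is cosh (\<i> t) = cos t.\<close>

lemma bernstein_ellipse_subset_nbhd_segment:
  assumes "open U" "complex_of_real ` {-1..1} \<subseteq> U"
  obtains r' where "1 < r'" "bernstein_ellipse (ereal r') \<subseteq> U"
proof -
  have "compact (complex_of_real ` {-1..1})"
    by (intro compact_continuous_image continuous_intros) auto
  then obtain e where e: "e > 0" "(\<Union>x\<in>complex_of_real ` {-1..1}. ball x e) \<subseteq> U"
    using compact_subset_open_imp_ball_epsilon_subset assms by metis
  show ?thesis
  proof (rule that[of "1 + e"])
    show "bernstein_ellipse (ereal (1 + e)) \<subseteq> U"
    proof
      fix z assume z: "z \<in> bernstein_ellipse (ereal (1 + e))"
      obtain s t where st: "0 \<le> s" "exp s < 1 + e" "z = cosh (Complex s t)"
        using in_bernstein_ellipse_erealE[OF z] e(1) by auto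
      have "dist (cosh (Complex 0 t)) z < e"
        using dist_cosh_Complex_le[of 0 s t] st by simp
      moreover have "cosh (Complex 0 t) = complex_of_real (cos t)"
        by (simp add: cosh_Complex complex_eq_iff)
      ultimately show "z \<in> U" using e(2) by force
    qed
  qed (use e in auto)
qed

section \<open>Analytic continuation from a convex set\<close>

text \<open>The midpoint of two centres of overlapping discs lies in the closure of the convex set, so the
  local extensions have a common domain meeting \<open>S\<close> and the identity theorem glues them.\<close>

lemma analytic_continuation_nbhd:
  assumes "convex S" "compact (closure S)" "\<And>x. S \<noteq> {x}"
    and loc: "\<And>w. w \<in> closure S \<Longrightarrow> analytic_at_point S g w"
  obtains U G where "open U" "closure S \<subseteq> U" "G holomorphic_on U" "\<And>z. z \<in> S \<Longrightarrow> G z = g z"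
proof -
  let ?K = "closure S"
  from loc obtain e h where eh: "\<And>w. w \<in> ?K \<Longrightarrow> e w > 0"
    "\<And>w. w \<in> ?K \<Longrightarrow> h w holomorphic_on ball w (e w)"
    "\<And>w z. w \<in> ?K \<Longrightarrow> z \<in> ball w (e w) \<inter> S \<Longrightarrow> h w z = g z"
    unfolding analytic_at_point_def by metis
  \<comment> \<open>A Lebesgue number gives all discs one radius; this is what places the midpoint
    of two centres in both discs.\<close>
  obtain \<delta> where \<delta>: "\<delta> > 0" "\<And>x. x \<in> ?K \<Longrightarrow> \<exists>B \<in> (\<lambda>w. ball w (e w)) ` ?K. ball x \<delta> \<subseteq> B"
    by (rule Heine_Borel_lemma[of ?K "(\<lambda>w. ball w (e w)) ` ?K"]) (use assms(2) eh(1) in auto)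
  then obtain c where c: "\<And>x. x \<in> ?K \<Longrightarrow> c x \<in> ?K" "\<And>x. x \<in> ?K \<Longrightarrow> ball x \<delta> \<subseteq> ball (c x) (e (c x))"
    by (auto simp: image_iff) metis
  define H where "H x = h (c x)" for x
  have H: "H x holomorphic_on ball x \<delta>" "z \<in> ball x \<delta> \<Longrightarrow> z \<in> S \<Longrightarrow> H x z = g z"
    if "x \<in> ?K" for x z
    using eh c[OF that] by (auto simp: H_def intro: holomorphic_on_subset)
  have consistent: "H x p = H y p"
    if xy: "x \<in> ?K" "y \<in> ?K" and p: "p \<in> ball x \<delta>" "p \<in> ball y \<delta>" for x y p
  proof -
    let ?I = "ball x \<delta> \<inter> ball y \<delta>"
    let ?m = "midpoint x y"
    have "?m \<in> ?K"
      using convexD[OF convex_closure[OF assms(1)] xy, of "1/2" "1/2"]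
      by (simp add: midpoint_def scaleR_right_distrib)
    moreover have "dist x y < 2 * \<delta>"
      using p dist_triangle[of x y p] by (simp add: dist_commute)
    then have m: "?m \<in> ?I" by (simp add: dist_midpoint)
    ultimately obtain s where s: "s \<in> S" "s \<in> ?I"
      by (metis open_Int open_ball open_Int_closure_eq_empty disjoint_iff)
    \<comment> \<open>A convex set with more than one point has no isolated points, so agreement on
      \<open>S\<close> near s suffices for the identity theorem.\<close>
    have "s islimpt S"
      using assms(1,3) s by (intro connected_imp_perfect convex_connected) auto
    then have lim: "s islimpt (S \<inter> ?I)"
      using s by (intro islimpt_Int_eventually eventually_at_in_open') auto
    have "H x p - H y p = 0"
    proof (rule analytic_continuation[of "\<lambda>z. H x z - H y z" ?I "S \<inter> ?I" s])
      show "(\<lambda>z. H x z - H y z) holomorphic_on ?I"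
        by (intro holomorphic_intros) (use H xy in \<open>auto intro: holomorphic_on_subset\<close>)
      show "connected ?I" by (intro convex_connected convex_Int) auto
    qed (use lim s H xy p in auto)
    then show ?thesis by simp
  qed
  define U where "U = (\<Union>x\<in>?K. ball x \<delta>)"
  define G where "G z = H (SOME x. x \<in> ?K \<and> z \<in> ball x \<delta>) z" for z
  have G: "G z = H x z" if "x \<in> ?K" "z \<in> ball x \<delta>" for x z
  proof -
    have "(SOME x. x \<in> ?K \<and> z \<in> ball x \<delta>) \<in> ?K \<and> z \<in> ball (SOME x. x \<in> ?K \<and> z \<in> ball x \<delta>) \<delta>"
      by (rule someI[of _ x]) (use that in auto)
    then show ?thesis unfolding G_def using consistent that by blast
  qed
  show ?thesis
  proof (rule that[of U G])
    show "?K \<subseteq> U" using \<delta>(1) by (auto simp: U_def)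
    show "G holomorphic_on U"
      unfolding U_def
    proof (rule holomorphic_on_UN_open)
      fix x assume x: "x \<in> ?K"
      show "G holomorphic_on ball x \<delta>"
        using H(1)[OF x] G[OF x] by (auto intro: holomorphic_transform)
    qed auto
    show "G z = g z" if "z \<in> S" for z
      using that \<delta>(1) G[of z z] H(2)[of z z] closure_subset[of S] by auto
  qed (auto simp: U_def)
qed

section \<open>Uniqueness of extensions and the value of \<open>rho_A\<close>\<close>

lemma of_real_0_islimpt_segment: "0 islimpt complex_of_real ` {-1..1}"
proof (rule connected_imp_perfect)
  show "connected (complex_of_real ` {-1..1})"
    by (intro connected_continuous_image continuous_intros) auto
  have "complex_of_real 0 \<in> complex_of_real ` {-1..1}" "complex_of_real 1 \<in> complex_of_real ` {-1..1}"
    by (rule imageI, simp)+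
  then show "complex_of_real ` {-1..1} \<noteq> {x}" for x
    by (metis of_real_eq_iff singletonD zero_neq_one)
qed (auto simp: image_iff intro!: bexI[of _ 0])

lemma analytic_extension_unique:
  assumes "1 < \<rho>" "\<rho> \<le> \<rho>'"
    and "analytic_extension F (bernstein_ellipse \<rho>) g" "analytic_extension F (bernstein_ellipse \<rho>') g'"
    and z: "z \<in> bernstein_ellipse \<rho>"
  shows "g z = g' z"
proof -
  let ?E = "bernstein_ellipse \<rho>"
  have "g z - g' z = 0"
  proof (rule analytic_continuation[of "\<lambda>z. g z - g' z" ?E "complex_of_real ` {-1..1}" 0])
    show "(\<lambda>z. g z - g' z) holomorphic_on ?E"
      using assms bernstein_ellipse_mono[of \<rho> \<rho>'] unfolding analytic_extension_def
      by (intro holomorphic_intros) (auto intro: holomorphic_on_subset)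
    show "connected ?E" using convex_bernstein_ellipse by (rule convex_connected)
    show "complex_of_real ` {-1..1} \<subseteq> ?E" "0 \<in> ?E"
      using of_real_in_bernstein_ellipse[OF _ assms(1)] of_real_in_bernstein_ellipse[of 0 \<rho>] assms(1)
      by auto
  qed (use assms z of_real_0_islimpt_segment open_bernstein_ellipse in
        \<open>auto simp: analytic_extension_def\<close>)
  then show ?thesis by simp
qed

text \<open>The ellipses are nested, so the extensions agree pairwise, and every point of the
  ellipse of the supremum already lies in one of smaller parameter. Hence the largest parameter is
  attained.\<close>

lemma analytic_extension_Sup:
  assumes "A \<noteq> {}" "\<And>\<rho>. \<rho> \<in> A \<Longrightarrow> 1 < \<rho> \<and> (\<exists>g. analytic_extension F (bernstein_ellipse \<rho>) g)"
  shows "\<exists>g. analytic_extension F (bernstein_ellipse (Sup A)) g"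
proof -
  from assms(2) obtain g where g: "\<And>\<rho>. \<rho> \<in> A \<Longrightarrow> analytic_extension F (bernstein_ellipse \<rho>) (g \<rho>)"
    by metis
  have gt1: "1 < \<rho>" if "\<rho> \<in> A" for \<rho> using assms(2) that by auto
  have S1: "1 < Sup A"
    using assms(1) gt1 by (meson ex_in_conv less_Sup_iff)
  have un: "bernstein_ellipse (Sup A) = (\<Union>\<rho>\<in>A. bernstein_ellipse \<rho>)"
  proof (intro equalityI subsetI)
    fix z assume "z \<in> bernstein_ellipse (Sup A)"
    then obtain r where r: "1 < r" "ereal r < Sup A" "z \<in> bernstein_ellipse (ereal r)"
      using S1 by (rule bernstein_ellipse_exhaust)
    then obtain \<rho> where "\<rho> \<in> A" "ereal r < \<rho>" unfolding less_Sup_iff by blast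
    then show "z \<in> (\<Union>\<rho>\<in>A. bernstein_ellipse \<rho>)"
      using bernstein_ellipse_mono[of "ereal r" \<rho>] r(1,3) by (force simp: one_ereal_def)
  next
    fix z assume "z \<in> (\<Union>\<rho>\<in>A. bernstein_ellipse \<rho>)"
    then show "z \<in> bernstein_ellipse (Sup A)"
      using bernstein_ellipse_mono[OF gt1 Sup_upper] by blast
  qed
  have consistent: "g \<rho> z = g \<rho>' z"
    if "\<rho> \<in> A" "\<rho>' \<in> A" "z \<in> bernstein_ellipse \<rho>" "z \<in> bernstein_ellipse \<rho>'" for \<rho> \<rho>' z
    using analytic_extension_unique[OF gt1 _ g g] that by (metis linear)
  define G where "G z = g (SOME \<rho>. \<rho> \<in> A \<and> z \<in> bernstein_ellipse \<rho>) z" for z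
  have G: "G z = g \<rho> z" if "\<rho> \<in> A" "z \<in> bernstein_ellipse \<rho>" for z \<rho>
  proof -
    let ?\<rho> = "SOME \<rho>. \<rho> \<in> A \<and> z \<in> bernstein_ellipse \<rho>"
    have "?\<rho> \<in> A \<and> z \<in> bernstein_ellipse ?\<rho>"
      by (rule someI[of _ \<rho>]) (use that in auto)
    then show ?thesis unfolding G_def using consistent that by blast
  qed
  have "analytic_extension F (bernstein_ellipse (Sup A)) G"
    unfolding analytic_extension_def
  proof
    show "G holomorphic_on bernstein_ellipse (Sup A)"
      unfolding un
    proof (rule holomorphic_on_UN_open)
      fix \<rho> assume r: "\<rho> \<in> A"
      have "g \<rho> holomorphic_on bernstein_ellipse \<rho>"
        using g[OF r] by (simp add: analytic_extension_def)
      then show "G holomorphic_on bernstein_ellipse \<rho>"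
        using G[OF r] by (auto intro: holomorphic_transform)
    qed (rule open_bernstein_ellipse)
    obtain \<rho> where r: "\<rho> \<in> A" using assms(1) by blast
    show "\<forall>x\<in>{-1..1}. G (complex_of_real x) = complex_of_real (F x)"
      using G[OF r of_real_in_bernstein_ellipse[OF _ gt1[OF r]]] g[OF r]
      by (auto simp: analytic_extension_def)
  qed
  then show ?thesis by blast
qed

text \<open>The body of the description in \<open>rho_A\<close>, named so that existence and
  uniqueness of its solution can be stated.\<close>

definition is_rho_A :: "(real \<Rightarrow> real) \<Rightarrow> ereal \<Rightarrow> bool" where
  "is_rho_A F \<rho> \<longleftrightarrow>
     (\<rho> = 1 \<and> (\<exists>x\<in>{-1..1}.
          \<not> analytic_at_point (complex_of_real ` {-1..1}) (\<lambda>z. of_real (F (Re z))) (of_real x)))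
    \<or> (1 < \<rho> \<and> \<rho> < \<infinity> \<and> (\<exists>g. analytic_extension F (bernstein_ellipse \<rho>) g \<and>
          (\<exists>w\<in>frontier (bernstein_ellipse \<rho>). \<not> analytic_at_point (bernstein_ellipse \<rho>) g w)))
    \<or> (\<rho> = \<infinity> \<and> (\<exists>g. analytic_extension F UNIV g))"

lemma bernstein_ellipse_infinity: "bernstein_ellipse \<infinity> = UNIV"
  by (simp add: bernstein_ellipse_def)

lemma is_rho_A_cases:
  assumes "is_rho_A F \<rho>"
  shows "\<rho> = 1 \<or> 1 < \<rho> \<and> (\<exists>g. analytic_extension F (bernstein_ellipse \<rho>) g)"
proof (cases "\<rho> = \<infinity>")
  case True
  then show ?thesis using assms unfolding is_rho_A_def by (auto simp: bernstein_ellipse_infinity)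
next
  case False
  then show ?thesis using assms unfolding is_rho_A_def by blast
qed

text \<open>The point at which analyticity fails for the smaller value lies in the open ellipse of
  the larger one, where the larger extension is holomorphic and continues the smaller. Used in both
  directions this gives uniqueness.\<close>

lemma is_rho_A_less:
  assumes "is_rho_A F \<rho>" "is_rho_A F \<rho>'"
  shows "\<not> \<rho> < \<rho>'"
proof
  assume less: "\<rho> < \<rho>'"
  have "\<rho> \<ge> 1" using is_rho_A_cases[OF assms(1)] by auto
  then obtain g' where r': "1 < \<rho>'" and g': "analytic_extension F (bernstein_ellipse \<rho>') g'"
    using is_rho_A_cases[OF assms(2)] less by auto
  consider (one) x where "\<rho> = 1" "x \<in> {-1..1}"
      "\<not> analytic_at_point (complex_of_real ` {-1..1}) (\<lambda>z. of_real (F (Re z))) (of_real x)"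
    | (fin) r g w where "\<rho> = ereal r" "1 < r" "analytic_extension F (bernstein_ellipse \<rho>) g"
      "w \<in> frontier (bernstein_ellipse \<rho>)" "\<not> analytic_at_point (bernstein_ellipse \<rho>) g w"
  proof -
    have "\<rho> \<noteq> \<infinity>" using less by auto
    then show ?thesis using assms(1) that unfolding is_rho_A_def by (cases \<rho>) auto
  qed
  then show False
  proof cases
    case one
    obtain e where e: "e > 0" "ball (complex_of_real x) e \<subseteq> bernstein_ellipse \<rho>'"
      using open_bernstein_ellipse of_real_in_bernstein_ellipse[OF one(2) r'] open_contains_ball by blast
    have "g' holomorphic_on ball (complex_of_real x) e"
      using g' e by (auto simp: analytic_extension_def intro: holomorphic_on_subset)
    moreover have "\<forall>z\<in>ball (complex_of_real x) e \<inter> complex_of_real ` {-1..1}. g' z = of_real (F (Re z))"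
      using g' by (auto simp: analytic_extension_def)
    ultimately show False
      using one(3) e(1) unfolding analytic_at_point_def by blast
  next
    case fin
    have "w \<in> bernstein_ellipse \<rho>'"
      using fin(4) closure_bernstein_ellipse_subset[OF fin(2), of \<rho>'] less fin(1)
      by (auto simp: frontier_def)
    then obtain e where e: "e > 0" "ball w e \<subseteq> bernstein_ellipse \<rho>'"
      using open_bernstein_ellipse open_contains_ball by blast
    have "g' holomorphic_on ball w e"
      using g' e by (auto simp: analytic_extension_def intro: holomorphic_on_subset)
    moreover have "\<forall>z\<in>ball w e \<inter> bernstein_ellipse \<rho>. g' z = g z"
      using analytic_extension_unique[OF _ less_imp_le[OF less] fin(3) g'] fin(1,2) 
      by (auto simp: one_ereal_def)
    ultimately show False
      using fin(5) e(1) unfolding analytic_at_point_def by blast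
  qed
qed

text \<open>The solution is the supremum of the parameters that admit an extension, or 1 if there
  are none. Were no point of the frontier (or of the segment) singular, the local extensions would
  glue to one on a neighbourhood of a compact set, and this contains a larger ellipse.\<close>

lemma ex_is_rho_A: "\<exists>\<rho>. is_rho_A F \<rho>"
proof -
  define A where "A = {\<rho>. 1 < \<rho> \<and> (\<exists>g. analytic_extension F (bernstein_ellipse \<rho>) g)}"
  show ?thesis
  proof (cases "A = {}")
    case True
    let ?S = "complex_of_real ` {-1..1}"
    have "\<exists>x\<in>{-1..1}. \<not> analytic_at_point ?S (\<lambda>z. of_real (F (Re z))) (of_real x)"
    proof (rule ccontr)
      assume n: "\<not> ?thesis"
      have S: "compact ?S" by (intro compact_continuous_image continuous_intros) auto
      then have cl: "closure ?S = ?S" by (simp add: compact_imp_closed)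
      obtain U G where UG: "open U" "?S \<subseteq> U" "G holomorphic_on U"
        "\<And>z. z \<in> ?S \<Longrightarrow> G z = of_real (F (Re z))"
      proof (rule analytic_continuation_nbhd[of ?S "\<lambda>z. of_real (F (Re z))"])
        show "convex ?S"
          by (rule convex_linear_image) (auto intro: bounded_linear.linear bounded_linear_of_real)
        show "?S \<noteq> {x}" for x
          using of_real_0_islimpt_segment islimpt_finite[of ?S 0] by (metis finite.emptyI finite_insert)
      qed (use S cl n in auto)
      obtain r where r: "1 < r" "bernstein_ellipse (ereal r) \<subseteq> U"
        using bernstein_ellipse_subset_nbhd_segment UG by blast
      then have "analytic_extension F (bernstein_ellipse (ereal r)) G"
        using UG unfolding analytic_extension_def by (auto intro: holomorphic_on_subset)
      then have "ereal r \<in> A" using r by (auto simp: A_def one_ereal_def)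
      then show False using True by simp
    qed
    then show ?thesis by (auto simp: is_rho_A_def)
  next
    case False
    obtain g where g: "analytic_extension F (bernstein_ellipse (Sup A)) g"
      using analytic_extension_Sup[OF False] A_def by blast
    obtain \<rho> where r: "\<rho> \<in> A" using False by blast
    have "1 < \<rho>" "\<rho> \<le> Sup A" using r by (auto simp: A_def Sup_upper)
    then have S1: "1 < Sup A" by order
    show ?thesis
    proof (cases "Sup A = \<infinity>")
      case True
      then show ?thesis using g by (auto simp: is_rho_A_def bernstein_ellipse_infinity)
    next
      case False
      then obtain s where s: "Sup A = ereal s" "1 < s"
        using S1 by (cases "Sup A") auto
      let ?E = "bernstein_ellipse (ereal s)"
      have "\<exists>w\<in>frontier ?E. \<not> analytic_at_point ?E g w"
      proof (rule ccontr)
        assume n: "\<not> ?thesis"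
        have an: "analytic_at_point ?E g w" if "w \<in> closure ?E" for w
        proof (cases "w \<in> ?E")
          case True
          then obtain e where e: "e > 0" "ball w e \<subseteq> ?E"
            using open_bernstein_ellipse open_contains_ball by blast
          then show ?thesis
            using g s unfolding analytic_at_point_def analytic_extension_def
            by (auto intro!: exI[of _ e] exI[of _ g] intro: holomorphic_on_subset)
        next
          case False
          then show ?thesis
            using that n open_bernstein_ellipse by (auto simp: frontier_def interior_open)
        qed
        obtain U G where UG: "open U" "closure ?E \<subseteq> U" "G holomorphic_on U"
          "\<And>z. z \<in> ?E \<Longrightarrow> G z = g z"
        proof (rule analytic_continuation_nbhd[of ?E g])
          show "?E \<noteq> {x}" for x
            using open_bernstein_ellipse[of "ereal s"] not_open_singleton[of x] by auto
        qed (use an convex_bernstein_ellipse compact_closure_bernstein_ellipse s in auto)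
        obtain r where r: "s < r" "bernstein_ellipse (ereal r) \<subseteq> U"
          using bernstein_ellipse_subset_nbhd s UG by metis
        have "analytic_extension F (bernstein_ellipse (ereal r)) G"
          using UG r g s of_real_in_bernstein_ellipse[of _ "ereal s"]
          unfolding analytic_extension_def by (auto intro: holomorphic_on_subset simp: one_ereal_def)
        then have "ereal r \<in> A" using r s by (auto simp: A_def one_ereal_def)
        then have "ereal r \<le> Sup A" by (rule Sup_upper)
        then show False using r s by simp
      qed
      then show ?thesis
        unfolding is_rho_A_def using g S1 s(1)
        by (intro exI[of _ "Sup A"] disjI2 disjI1 conjI exI[of _ g]) simp_all
    qed
  qed
qed

lemma is_rho_A_rho_A: "is_rho_A F (rho_A F)"
proof -
  have "\<exists>!\<rho>. is_rho_A F \<rho>"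
    using ex_is_rho_A[of F] is_rho_A_less by (metis linorder_cases)
  then have "is_rho_A F (THE \<rho>. is_rho_A F \<rho>)" by (rule theI')
  then show ?thesis by (simp add: rho_A_def is_rho_A_def)
qed

lemma analytic_extension_continuation:
  assumes "1 < rho_A F"
  shows "analytic_extension F (bernstein_ellipse (rho_A F)) (continuation F)"
proof -
  have "\<exists>g. analytic_extension F (bernstein_ellipse (rho_A F)) g"
    using is_rho_A_cases[OF is_rho_A_rho_A[of F]] assms by auto
  then show ?thesis unfolding continuation_def by (rule someI_ex)
qed

section \<open>Kernels on confocal ellipses\<close>

lemma has_integral_vertical_segment:
  assumes "\<And>z. z \<in> S \<Longrightarrow> (F has_field_derivative \<Phi> z) (at z)" "\<And>t. Complex s t \<in> S" "a \<le> b"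
  shows "((\<lambda>t. \<Phi> (Complex s t)) has_integral (F (Complex s b) - F (Complex s a)) / \<i>) {a..b}"
proof -
  have "((\<lambda>t. F (Complex s t) / \<i>) has_vector_derivative \<Phi> (Complex s t)) (at t within {a..b})" for t
  proof -
    have "((\<lambda>t. Complex s t) has_vector_derivative \<i>) (at t)"
      unfolding Complex_eq by (auto intro!: derivative_eq_intros)
    from field_vector_diff_chain_at[OF this assms(1)[OF assms(2)]]
    have "((\<lambda>t. F (Complex s t)) has_vector_derivative \<i> * \<Phi> (Complex s t)) (at t)"
      by (simp add: o_def)
    from has_vector_derivative_divide[OF this, of \<i>]
    have "((\<lambda>t. F (Complex s t) / \<i>) has_vector_derivative \<Phi> (Complex s t)) (at t)"
      by simp
    then show ?thesis by (rule has_vector_derivative_at_within)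
  qed
  from fundamental_theorem_of_calculus[OF assms(3) this]
  show ?thesis by (simp add: algebra_simps)
qed

text \<open>A primitive F exists on the convex strip. By periodicity its increment over a period has
  derivative 0, so it is a constant c, and every one of these integrals is c / \<i>.\<close>

lemma vertical_mean_indep:
  assumes hol: "\<Phi> holomorphic_on {\<sigma>. \<alpha> < Re \<sigma> \<and> Re \<sigma> < \<beta>}"
    and per: "\<And>\<sigma>. \<Phi> (\<sigma> + 2 * pi * \<i>) = \<Phi> \<sigma>"
    and s: "\<alpha> < s" "s < \<beta>" "\<alpha> < s'" "s' < \<beta>"
  shows "integral {-pi..pi} (\<lambda>t. \<Phi> (Complex s t)) = integral {-pi..pi} (\<lambda>t. \<Phi> (Complex s' t))"
proof -
  let ?S = "{\<sigma>. \<alpha> < Re \<sigma> \<and> Re \<sigma> < \<beta>}"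
  have S: "?S = {\<sigma>. \<alpha> < Re \<sigma>} \<inter> {\<sigma>. Re \<sigma> < \<beta>}" by auto
  have op: "open ?S" unfolding S by (intro open_Int open_halfspace_Re_gt open_halfspace_Re_lt)
  have cv: "convex ?S" unfolding S by (intro convex_Int convex_halfspace_Re_gt convex_halfspace_Re_lt)
  obtain F where "\<And>x. x \<in> ?S \<Longrightarrow> (F has_field_derivative \<Phi> x) (at x within ?S)"
    using holomorphic_convex_primitive'[OF cv op hol] by blast
  then have F: "\<And>x. x \<in> ?S \<Longrightarrow> (F has_field_derivative \<Phi> x) (at x)"
    using at_within_open[OF _ op] by metis
  have "\<exists>c. \<forall>x\<in>?S. F (x + 2 * pi * \<i>) - F x = c"
  proof (rule has_field_derivative_zero_constant[OF cv])
    fix x assume x: "x \<in> ?S"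
    then have "x + 2 * pi * \<i> \<in> ?S" by simp
    from F[OF this] have "((\<lambda>x. F (x + 2 * pi * \<i>)) has_field_derivative \<Phi> x) (at x)"
      by (simp only: DERIV_shift per)
    from DERIV_diff[OF this F[OF x]]
    show "((\<lambda>x. F (x + 2 * pi * \<i>) - F x) has_field_derivative 0) (at x within ?S)"
      by (auto intro: has_field_derivative_at_within)
  qed
  then obtain c where c: "\<And>x. x \<in> ?S \<Longrightarrow> F (x + 2 * pi * \<i>) - F x = c" by blast
  have "integral {-pi..pi} (\<lambda>t. \<Phi> (Complex r t)) = c / \<i>" if "\<alpha> < r" "r < \<beta>" for r
  proof -
    have "((\<lambda>t. \<Phi> (Complex r t)) has_integral (F (Complex r pi) - F (Complex r (- pi))) / \<i>) {-pi..pi}"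
      by (rule has_integral_vertical_segment[of ?S]) (use F that in auto)
    moreover have "Complex r pi = Complex r (- pi) + 2 * pi * \<i>" by (simp add: complex_eq_iff)
    ultimately show ?thesis
      using c[of "Complex r (- pi)"] that by (simp add: integral_unique)
  qed
  then show ?thesis using s by simp
qed

text \<open>For |y| < 1 this is the sum of y^k over k >= 1.\<close>

definition geo :: "complex \<Rightarrow> complex" where
  "geo y = y / (1 - y)"

text \<open>For |y| < 1 this is the Poisson kernel (1 - |y|^2) / |1 - y|^2 of the unit disc.\<close>

definition poisson :: "complex \<Rightarrow> real" where
  "poisson y = 1 + 2 * Re (geo y)"

text \<open>For Re \<sigma> > 0 this is 1 plus twice the sum of exp (-k \<sigma>) cos (k \<theta>)
  over k >= 1, a generating function of the Chebyshev polynomials.\<close>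

definition cheb_kernel :: "real \<Rightarrow> complex \<Rightarrow> complex" where
  "cheb_kernel \<theta> \<sigma> = 1 + geo (exp (\<i> * \<theta> - \<sigma>)) + geo (exp (- (\<i> * \<theta>) - \<sigma>))"

lemma norm_less_1_imp_neq: "cmod y < 1 \<Longrightarrow> y \<noteq> 1"
  by auto

text \<open>The form in which the kernel comes out of \<open>geo_reflection\<close> when v is the
  conjugate of y.\<close>

lemma poisson_complex:
  assumes "cmod y < 1"
  shows "complex_of_real (poisson y) = 1 / (1 - y) + geo (cnj y)"
proof -
  have "1 / (1 - y) = 1 + geo y"
    using norm_less_1_imp_neq[OF assms] by (simp add: geo_def field_simps)
  moreover have "geo (cnj y) = cnj (geo y)" by (simp add: geo_def)
  ultimately show ?thesis by (simp add: poisson_def complex_add_cnj add.assoc)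
qed

lemma poisson_nonneg:
  assumes "cmod y < 1"
  shows "0 \<le> poisson y"
proof -
  have ne: "(cmod (1 - y))\<^sup>2 \<noteq> 0" using norm_less_1_imp_neq[OF assms] by simp
  have "Re (geo y) = (Re y - (cmod y)\<^sup>2) / (cmod (1 - y))\<^sup>2"
    unfolding geo_def Re_divide cmod_power2 by (simp add: algebra_simps power2_eq_square)
  moreover have "(cmod (1 - y))\<^sup>2 = 1 - 2 * Re y + (cmod y)\<^sup>2"
    unfolding cmod_power2 by (simp add: algebra_simps power2_eq_square)
  moreover have "poisson y = ((cmod (1 - y))\<^sup>2 + 2 * ((cmod (1 - y))\<^sup>2 * Re (geo y))) / (cmod (1 - y))\<^sup>2"
    using ne unfolding poisson_def by (simp add: add_divide_distrib)
  ultimately have "poisson y = (1 - (cmod y)\<^sup>2) / (cmod (1 - y))\<^sup>2"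
    using ne by simp
  moreover have "(cmod y)\<^sup>2 \<le> 1" using assms by (simp add: power_le_one)
  ultimately show ?thesis by simp
qed

lemma norm_exp_less_1: "0 < Re \<sigma> \<Longrightarrow> cmod (exp (\<i> * of_real \<theta> - \<sigma>)) < 1"
  by simp

text \<open>The series has no constant term. Its primitive is the principal logarithm of 1 - y,
  which stays off the cut because Re y < 1 and takes equal values at the two ends by
  periodicity.\<close>

lemma geo_mean:
  assumes "0 < s"
  shows "((\<lambda>t. geo (exp (\<i> * of_real \<theta> - Complex s t))) has_integral 0) {-pi..pi}"
proof -
  define F where "F \<sigma> = Ln (1 - exp (\<i> * of_real \<theta> - \<sigma>))" for \<sigma>
  have "((\<lambda>t. geo (exp (\<i> * of_real \<theta> - Complex s t))) has_integral
      (F (Complex s pi) - F (Complex s (- pi))) / \<i>) {-pi..pi}"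
  proof (rule has_integral_vertical_segment[of "{\<sigma>. 0 < Re \<sigma>}"])
    fix \<sigma> assume "\<sigma> \<in> {\<sigma>. 0 < Re \<sigma>}"
    then have n: "cmod (exp (\<i> * of_real \<theta> - \<sigma>)) < 1" by simp
    then have "Re (exp (\<i> * of_real \<theta> - \<sigma>)) < 1"
      using complex_Re_le_cmod[of "exp (\<i> * of_real \<theta> - \<sigma>)"] by linarith
    then have "1 - exp (\<i> * of_real \<theta> - \<sigma>) \<notin> \<real>\<^sub>\<le>\<^sub>0"
      by (auto simp: complex_nonpos_Reals_iff)
    then show "(F has_field_derivative geo (exp (\<i> * of_real \<theta> - \<sigma>))) (at \<sigma>)"
      unfolding F_def geo_def by (auto intro!: derivative_eq_intros simp: field_simps)
  qed (use assms in auto)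
  moreover have "exp (\<i> * of_real \<theta> - Complex s pi) = exp (\<i> * of_real \<theta> - Complex s (- pi))"
  proof -
    have "\<i> * of_real \<theta> - Complex s (- pi) = \<i> * of_real \<theta> - Complex s pi + 2 * of_real pi * \<i>"
      by (simp add: complex_eq_iff)
    then show ?thesis by (simp only: exp_add exp_two_pi_i mult_1_right)
  qed
  ultimately show ?thesis by (simp add: F_def)
qed

lemma poisson_mean:
  assumes "0 < s"
  shows "((\<lambda>t. poisson (exp (\<i> * of_real \<theta> - Complex s t))) has_integral 2 * pi) {-pi..pi}"
proof -
  have "((\<lambda>t. Re (geo (exp (\<i> * of_real \<theta> - Complex s t)))) has_integral Re 0) {-pi..pi}"
    using has_integral_linear[OF geo_mean[OF assms] bounded_linear_Re] by (simp add: o_def)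
  moreover have "((\<lambda>t. 1) has_integral 2 * pi) {-pi..pi}"
    using has_integral_const_real[of "1::real" "-pi" pi] by simp
  ultimately have "((\<lambda>t. 1 + 2 * Re (geo (exp (\<i> * of_real \<theta> - Complex s t)))) has_integral
      2 * pi + 2 * Re 0) {-pi..pi}"
    by (intro has_integral_add has_integral_mult_right)
  then show ?thesis by (simp add: poisson_def)
qed

lemma cheb_kernel_mean:
  assumes "0 < s"
  shows "((\<lambda>t. cheb_kernel \<theta> (Complex s t)) has_integral 2 * of_real pi) {-pi..pi}"
proof -
  have "((\<lambda>t. 1 :: complex) has_integral 2 * of_real pi) {-pi..pi}"
    using has_integral_const_real[of "1::complex" "-pi" pi] by (simp add: scaleR_conv_of_real)
  then have "((\<lambda>t. 1 + geo (exp (\<i> * of_real \<theta> - Complex s t)) + geo (exp (\<i> * of_real (- \<theta>) - Complex s t)))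
      has_integral 2 * of_real pi + 0 + 0) {-pi..pi}"
    by (intro has_integral_add geo_mean assms)
  then show ?thesis by (simp add: cheb_kernel_def)
qed

lemma Re_cheb_kernel:
  "Re (cheb_kernel \<theta> \<sigma>) = (poisson (exp (\<i> * of_real \<theta> - \<sigma>)) + poisson (exp (\<i> * of_real (- \<theta>) - \<sigma>))) / 2"
  by (simp add: cheb_kernel_def poisson_def)

lemma cosine_split_algebra:
  fixes E Z :: complex
  assumes "E \<noteq> 0" "Z \<noteq> 0"
  shows "(E + 1 / E) / 2 - (Z + 1 / Z) / 2 = (E - Z) * (E * Z - 1) / (2 * E * Z)"
proof -
  have "(E - Z) * (E * Z - 1) = E * Z * (E + 1 / E) - E * Z * (Z + 1 / Z)"
    using assms by (simp add: algebra_simps)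
  then show ?thesis using assms by (simp add: diff_divide_distrib)
qed

lemma kernel_algebra:
  fixes E Z :: complex
  assumes "E \<noteq> 0" "Z \<noteq> 0" "E - Z \<noteq> 0" "E * Z - 1 \<noteq> 0"
  shows "1 + Z / (E - Z) + 1 / (E * Z - 1) = ((E - 1 / E) / 2) / ((E - Z) * (E * Z - 1) / (2 * E * Z))"
proof -
  define p q where "p = E - Z" and "q = E * Z - 1"
  have "1 + Z / p + 1 / q = (p * q + Z * q + p) / (p * q)"
    using assms by (simp add: add_divide_distrib p_def q_def)
  also have "p * q + Z * q + p = E * Z * (E - 1 / E)"
    using assms by (simp add: p_def q_def algebra_simps)
  also have "\<dots> / (p * q) = ((E - 1 / E) / 2) / (p * q / (2 * E * Z))"
    using assms by simp
  finally show ?thesis by (simp add: p_def q_def)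
qed

text \<open>With E = exp \<sigma> and Z = exp (\<i> \<theta>), cosh \<sigma> - cos \<theta> splits
  into factors that do not vanish since |E| > 1 = |Z|. The quotient is the Cauchy kernel dz / (z -
  x) in the variable \<sigma>: for z = cosh \<sigma> the differential contributes sinh
  \<sigma>.\<close>

lemma cheb_kernel_eq:
  assumes "0 < Re \<sigma>"
  shows "cosh \<sigma> \<noteq> of_real (cos \<theta>)" "cheb_kernel \<theta> \<sigma> = sinh \<sigma> / (cosh \<sigma> - of_real (cos \<theta>))"
proof -
  define E where "E = exp \<sigma>"
  define Z where "Z = exp (\<i> * of_real \<theta>)"
  have nz: "E \<noteq> 0" "Z \<noteq> 0" by (simp_all add: E_def Z_def)
  have c: "cmod E > 1" "cmod Z = 1" using assms by (simp_all add: E_def Z_def)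
  have ne: "E \<noteq> Z" "E * Z \<noteq> 1"
  proof -
    show "E \<noteq> Z"
    proof
      assume "E = Z"
      with c show False by simp
    qed
    show "E * Z \<noteq> 1"
    proof
      assume "E * Z = 1"
      then have "cmod E * cmod Z = 1" by (metis norm_mult norm_one)
      with c show False by simp
    qed
  qed
  have ch: "cosh \<sigma> = (E + 1 / E) / 2" "sinh \<sigma> = (E - 1 / E) / 2"
    by (simp_all add: E_def cosh_field_def sinh_field_def exp_minus inverse_eq_divide)
  have cs: "complex_of_real (cos \<theta>) = (Z + 1 / Z) / 2"
    unfolding cos_of_real[symmetric] cos_exp_eq Z_def by (simp add: exp_minus inverse_eq_divide)
  have fac: "cosh \<sigma> - of_real (cos \<theta>) = (E - Z) * (E * Z - 1) / (2 * E * Z)"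
    unfolding ch cs using nz by (simp add: cosine_split_algebra)
  then show "cosh \<sigma> \<noteq> of_real (cos \<theta>)" using ne nz by auto
  have "exp (\<i> * of_real \<theta> - \<sigma>) = Z / E" "exp (- (\<i> * of_real \<theta>) - \<sigma>) = 1 / (E * Z)"
    by (simp_all add: E_def Z_def exp_diff exp_minus inverse_eq_divide)
  then have "cheb_kernel \<theta> \<sigma> = 1 + Z / (E - Z) + 1 / (E * Z - 1)"
    using nz ne unfolding cheb_kernel_def geo_def by (simp add: diff_divide_eq_iff mult.commute)
  also have "\<dots> = ((E - 1 / E) / 2) / ((E - Z) * (E * Z - 1) / (2 * E * Z))"
    by (rule kernel_algebra) (use nz ne in auto)
  finally show "cheb_kernel \<theta> \<sigma> = sinh \<sigma> / (cosh \<sigma> - of_real (cos \<theta>))"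
    by (simp only: fac ch(2))
qed

section \<open>Splitting the kernel modulo polynomials of degree below n\<close>

lemma geo_power_sum:
  fixes y :: complex
  assumes "y \<noteq> 1" "1 \<le> n"
  shows "(\<Sum>k=1..<n. y ^ k) = (y - y ^ n) / (1 - y)"
proof -
  have "(1 - y) * (\<Sum>k=1..<n. y ^ k) = y - y ^ n"
    using assms(2)
  proof (induction n rule: dec_induct)
    case (step n)
    have "(1 - y) * (\<Sum>k=1..<Suc n. y ^ k) = (1 - y) * (\<Sum>k=1..<n. y ^ k) + (1 - y) * y ^ n"
      using step(1) by (simp add: distrib_left)
    then show ?case unfolding step(3) by (simp add: algebra_simps)
  qed simp
  then show ?thesis using assms(1) by (simp add: eq_divide_eq mult.commute)
qed

text \<open>Cut the first series after k = n - 1, leaving y^n / (1 - y); in the second, v^n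
  \<open>geo v\<close> is \<open>geo v\<close> minus its first n terms. A subtracted y^n v^(n - k)
  equals (y v)^(n - k) y^k, and the one with k = 0 is the final (y v)^n. When v is the conjugate of
  y, y v = |y|^2, so each y^k with k < n is merely multiplied by a number independent of its
  argument.\<close>

lemma geo_reflection:
  fixes y v :: complex
  assumes "y \<noteq> 1" "v \<noteq> 1" "1 \<le> n"
  shows "geo y + (y * v) ^ n * geo v =
    y ^ n * (1 / (1 - y) + geo v) + (\<Sum>k=1..<n. (1 - (y * v) ^ (n - k)) * y ^ k) - (y * v) ^ n"
proof -
  have "(\<Sum>k=1..<n. (y * v) ^ (n - k) * y ^ k) = (\<Sum>k=1..<n. y ^ n * v ^ (n - k))"
  proof (rule sum.cong[OF refl])
    fix k assume "k \<in> {1..<n}"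
    then have "y ^ n = y ^ (n - k) * y ^ k" by (simp flip: power_add)
    then show "(y * v) ^ (n - k) * y ^ k = y ^ n * v ^ (n - k)"
      by (simp add: power_mult_distrib)
  qed
  also have "\<dots> = y ^ n * (\<Sum>k=1..<n. v ^ k)"
    unfolding sum_distrib_left[symmetric]
    by (rule arg_cong[of _ _ "(*) (y ^ n)"], rule sum.reindex_bij_witness[of _ "\<lambda>k. n - k" "\<lambda>k. n - k"]) auto
  finally have "(\<Sum>k=1..<n. (1 - (y * v) ^ (n - k)) * y ^ k)
      = (y - y ^ n) / (1 - y) - y ^ n * ((v - v ^ n) / (1 - v))"
    using geo_power_sum[OF assms(1,3)] geo_power_sum[OF assms(2,3)]
    by (simp add: left_diff_distrib sum_subtractf)
  moreover have "1 - y \<noteq> 0" "1 - v \<noteq> 0" using assms by auto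
  ultimately show ?thesis
    by (simp add: geo_def power_mult_distrib divide_simps) (simp add: algebra_simps)
qed

text \<open>The Chebyshev polynomials of the first kind, from their three-term recurrence.\<close>

lemma cosine_multiple_poly: "\<exists>p :: real poly. degree p \<le> k \<and> (\<forall>\<theta>. poly p (cos \<theta>) = cos (real k * \<theta>))"
proof (induction k rule: less_induct)
  case (less k)
  show ?case
  proof (cases "k < 2")
    case True
    then consider "k = 0" | "k = 1" by linarith
    then show ?thesis
    proof cases
      case 1
      then show ?thesis by (intro exI[of _ 1]) simp
    next
      case 2
      then show ?thesis by (intro exI[of _ "[:0, 1:]"]) simp
    qed
  next
    case False
    then obtain j where k: "k = Suc (Suc j)"
      by (metis add_2_eq_Suc le_Suc_ex not_less)
    obtain p q :: "real poly" where p: "degree p \<le> Suc j" "\<And>\<theta>. poly p (cos \<theta>) = cos (real (Suc j) * \<theta>)"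
      and q: "degree q \<le> j" "\<And>\<theta>. poly q (cos \<theta>) = cos (real j * \<theta>)"
      using less.IH[of "Suc j"] less.IH[of j] k by auto
    let ?r = "[:0, 2:] * p - q"
    have "degree ?r \<le> k"
      using p(1) q(1) degree_mult_le[of "[:0, 2:]" p] k
      by (intro degree_diff_le) auto
    moreover have "poly ?r (cos \<theta>) = cos (real k * \<theta>)" for \<theta>
    proof -
      have "cos (real (Suc j) * \<theta> + \<theta>) + cos (real (Suc j) * \<theta> - \<theta>) = 2 * cos \<theta> * cos (real (Suc j) * \<theta>)"
        by (simp add: cos_add cos_diff)
      moreover have "real (Suc j) * \<theta> + \<theta> = real k * \<theta>" "real (Suc j) * \<theta> - \<theta> = real j * \<theta>"
        by (simp_all add: k algebra_simps)
      ultimately show ?thesis by (simp add: p(2) q(2))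
    qed
    ultimately show ?thesis by blast
  qed
qed

lemma holomorphic_on_geo_exp:
  assumes "h holomorphic_on S" "\<And>\<sigma>. \<sigma> \<in> S \<Longrightarrow> 0 < Re (h \<sigma>)"
  shows "(\<lambda>\<sigma>. geo (exp (\<i> * of_real \<theta> - h \<sigma>))) holomorphic_on S"
proof -
  have "1 - exp (\<i> * of_real \<theta> - h \<sigma>) \<noteq> 0" if "\<sigma> \<in> S" for \<sigma>
    using norm_less_1_imp_neq[OF norm_exp_less_1[OF assms(2)[OF that]]] by (metis eq_iff_diff_eq_0)
  then show ?thesis unfolding geo_def by (intro holomorphic_intros assms(1)) auto
qed

text \<open>The inner map is there for the reflection of \<sigma> to 2 h - \<sigma> in
  \<open>reflected_kernel_mean\<close>.\<close>

lemma holomorphic_on_cheb_kernel: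
  assumes "h holomorphic_on S" "\<And>\<sigma>. \<sigma> \<in> S \<Longrightarrow> 0 < Re (h \<sigma>)"
  shows "(\<lambda>\<sigma>. cheb_kernel \<theta> (h \<sigma>)) holomorphic_on S"
  using holomorphic_on_geo_exp[OF assms, of \<theta>] holomorphic_on_geo_exp[OF assms, of "- \<theta>"]
  unfolding cheb_kernel_def by (auto intro!: holomorphic_intros)

lemma exp_plus_minus_period:
  "exp (w + of_real (2 * pi) * \<i>) = exp w" "exp (w - of_real (2 * pi) * \<i>) = exp w"
  using exp_two_pi_i by (simp_all add: exp_add exp_diff)

lemma cheb_kernel_periodic: "cheb_kernel \<theta> (\<sigma> - 2 * pi * \<i>) = cheb_kernel \<theta> \<sigma>"
proof -
  have "w - (\<sigma> - 2 * pi * \<i>) = (w - \<sigma>) + 2 * pi * \<i>" for w by simp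
  then show ?thesis unfolding cheb_kernel_def by (simp only: exp_plus_minus_period)
qed

lemma cosh_sinh_periodic:
  "cosh (\<sigma> + 2 * pi * \<i>) = (cosh \<sigma> :: complex)" "sinh (\<sigma> + 2 * pi * \<i>) = (sinh \<sigma> :: complex)"
proof -
  have "- (\<sigma> + 2 * pi * \<i>) = - \<sigma> - 2 * pi * \<i>" by simp
  then show "cosh (\<sigma> + 2 * pi * \<i>) = cosh \<sigma>" "sinh (\<sigma> + 2 * pi * \<i>) = sinh \<sigma>"
    unfolding cosh_field_def sinh_field_def by (simp_all only: exp_plus_minus_period)
qed

lemma holomorphic_on_cosh_sinh:
  "(cosh :: complex \<Rightarrow> complex) holomorphic_on S" "(sinh :: complex \<Rightarrow> complex) holomorphic_on S"
  unfolding cosh_field_def[abs_def] sinh_field_def[abs_def] by (auto intro!: holomorphic_intros)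

lemma continuous_on_vertical:
  assumes "f holomorphic_on S" "\<And>t. Complex s t \<in> S"
  shows "continuous_on A (\<lambda>t. f (Complex s t))"
proof -
  have "continuous_on A (\<lambda>t. Complex s t)" unfolding Complex_eq by (intro continuous_intros)
  then show ?thesis
    using holomorphic_on_imp_continuous_on[OF assms(1)] assms(2)
    by (auto intro: continuous_on_compose2)
qed

lemma has_integral_norm_bound:
  fixes f :: "real \<Rightarrow> 'a::euclidean_space"
  assumes "(f has_integral I) S" "(k has_integral J) S" "\<And>t. t \<in> S \<Longrightarrow> norm (f t) \<le> k t"
  shows "norm I \<le> J"
  using integral_norm_bound_integral[of f S k] assms
  by (metis has_integral_integrable integral_unique)

text \<open>Nothing is assumed about \<open>g\<close> on the boundary of the ellipse, so the integrals run over the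
  boundary of the smaller one with parameter \<open>exp h\<close>.\<close>

locale ellipse_function =
  fixes \<rho> :: ereal and g :: "complex \<Rightarrow> complex" and K h :: real
  assumes hol: "g holomorphic_on bernstein_ellipse \<rho>"
    and bound: "\<And>z. z \<in> bernstein_ellipse \<rho> \<Longrightarrow> cmod (g z) \<le> K"
    and real_on_segment: "\<And>x. x \<in> {-1..1} \<Longrightarrow> Im (g (of_real x)) = 0"
    and h_pos: "0 < h" and h_less: "ereal (exp h) < \<rho>"
begin

text \<open>The line Re \<sigma> = h must be interior to the strip where the pulled-back function is
  holomorphic; a parameter strictly between exp h and \<rho> provides the margin.\<close>

lemma ex_strip: "\<exists>H>h. \<forall>\<sigma>. -H < Re \<sigma> \<and> Re \<sigma> < H \<longrightarrow> cosh \<sigma> \<in> bernstein_ellipse \<rho>"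
proof -
  obtain r where r: "ereal (exp h) < ereal r" "ereal r < \<rho>"
    using ereal_dense2[OF h_less] by blast
  have r0: "0 < r" using r(1) exp_gt_zero[of h] by (simp del: exp_gt_zero)
  show ?thesis
  proof (intro exI[of _ "ln r"] conjI allI impI)
    show "h < ln r" using r(1) r0 by (simp add: exp_less_cancel_iff[of h, symmetric])
    fix \<sigma> :: complex assume "- ln r < Re \<sigma> \<and> Re \<sigma> < ln r"
    then have "exp \<bar>Re \<sigma>\<bar> < exp (ln r)" by (simp only: exp_less_cancel_iff) auto
    then have "exp \<bar>Re \<sigma>\<bar> < r" using r0 by simp
    then have "ereal (exp \<bar>Re \<sigma>\<bar>) < \<rho>" using r(2) by (meson less_ereal.simps(1) less_trans)
    then show "cosh \<sigma> \<in> bernstein_ellipse \<rho>"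
      using cosh_in_bernstein_ellipse[of "Re \<sigma>" \<rho> "Im \<sigma>"] by simp
  qed
qed

definition H :: real where "H = (SOME H. H > h \<and> (\<forall>\<sigma>. -H < Re \<sigma> \<and> Re \<sigma> < H \<longrightarrow> cosh \<sigma> \<in> bernstein_ellipse \<rho>))"

lemma H: "h < H" "0 < H" "\<And>\<sigma>. -H < Re \<sigma> \<Longrightarrow> Re \<sigma> < H \<Longrightarrow> cosh \<sigma> \<in> bernstein_ellipse \<rho>"
proof -
  have "H > h \<and> (\<forall>\<sigma>. -H < Re \<sigma> \<and> Re \<sigma> < H \<longrightarrow> cosh \<sigma> \<in> bernstein_ellipse \<rho>)"
    using someI_ex[OF ex_strip] unfolding H_def .
  then show "h < H" "0 < H" "\<And>\<sigma>. -H < Re \<sigma> \<Longrightarrow> Re \<sigma> < H \<Longrightarrow> cosh \<sigma> \<in> bernstein_ellipse \<rho>"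
    using h_pos by auto
qed

lemma \<rho>_gt_1: "1 < \<rho>"
proof -
  have "1 < ereal (exp h)" using h_pos by (simp add: one_ereal_def)
  then show ?thesis using h_less by (rule less_trans)
qed

definition G :: "complex \<Rightarrow> complex" where "G \<sigma> = g (cosh \<sigma>)"

lemma holomorphic_G: "G holomorphic_on {\<sigma>. -H < Re \<sigma> \<and> Re \<sigma> < H}"
proof -
  have "(g \<circ> cosh) holomorphic_on {\<sigma>. -H < Re \<sigma> \<and> Re \<sigma> < H}"
    by (rule holomorphic_on_compose_gen[OF _ hol]) (use H in \<open>auto intro!: holomorphic_on_cosh_sinh\<close>)
  then show ?thesis by (simp add: G_def[abs_def] o_def)
qed

lemma norm_G: "-H < s \<Longrightarrow> s < H \<Longrightarrow> cmod (G (Complex s t)) \<le> K"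
  unfolding G_def by (rule bound) (use H in auto)

lemma G_periodic: "G (\<sigma> + 2 * pi * \<i>) = G \<sigma>"
  by (simp only: G_def cosh_sinh_periodic)

lemma G_continuous: "continuous_on A (\<lambda>t. G (Complex h t))"
  by (rule continuous_on_vertical[OF holomorphic_G]) (use H h_pos in auto)

text \<open>The difference quotient of \<open>g\<close> at x is holomorphic once its singularity is
  removed. Pulled back by cosh and multiplied by sinh, it can be moved to Re \<sigma> = 0, where the
  curve is the segment run through twice: the integrand is odd in t and integrates to 0. What
  remains is g x times the integral of the kernel.\<close>

lemma cauchy_ellipse:
  "((\<lambda>t. G (Complex h t) * cheb_kernel \<theta> (Complex h t)) has_integral 2 * pi * g (of_real (cos \<theta>))) {-pi..pi}"
proof -
  define x where "x = complex_of_real (cos \<theta>)"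
  define D where "D z = (if z = x then deriv g x else (g z - g x) / (z - x))" for z
  define \<Phi> where "\<Phi> \<sigma> = D (cosh \<sigma>) * sinh \<sigma>" for \<sigma> :: complex
  have xin: "x \<in> bernstein_ellipse \<rho>"
    unfolding x_def by (rule of_real_in_bernstein_ellipse[OF _ \<rho>_gt_1]) simp
  have "D holomorphic_on bernstein_ellipse \<rho>"
    unfolding D_def by (rule pole_lemma[OF hol]) (simp add: interior_open open_bernstein_ellipse xin)
  then have "(D \<circ> cosh) holomorphic_on {\<sigma>. -H < Re \<sigma> \<and> Re \<sigma> < H}"
    by (rule holomorphic_on_compose_gen[rotated]) (use H in \<open>auto intro!: holomorphic_on_cosh_sinh\<close>)
  then have \<Phi>hol: "\<Phi> holomorphic_on {\<sigma>. -H < Re \<sigma> \<and> Re \<sigma> < H}"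
    unfolding \<Phi>_def o_def by (intro holomorphic_on_mult holomorphic_on_cosh_sinh)
  have per: "\<Phi> (\<sigma> + 2 * pi * \<i>) = \<Phi> \<sigma>" for \<sigma>
    by (simp only: \<Phi>_def cosh_sinh_periodic)
  have odd: "\<Phi> (Complex 0 (- t)) = - \<Phi> (Complex 0 t)" for t
  proof -
    have "Complex 0 (- t) = - Complex 0 t" by (simp add: complex_eq_iff)
    then show ?thesis by (simp add: \<Phi>_def)
  qed
  let ?I = "integral {-pi..pi} (\<lambda>t. \<Phi> (Complex 0 t))"
  have int0: "(\<lambda>t. \<Phi> (Complex s t)) integrable_on {-pi..pi}" if "-H < s" "s < H" for s
    by (intro integrable_continuous_interval continuous_on_vertical[OF \<Phi>hol]) (use that in auto)
  have "((\<lambda>t. \<Phi> (Complex 0 (- t))) has_integral ?I) {-pi..- (- pi)}"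
    using has_integral_reflect_lemma_real[OF integrable_integral[OF int0[of 0]]] H(2) by simp
  then have "((\<lambda>t. - \<Phi> (Complex 0 t)) has_integral ?I) {-pi..pi}"
    by (simp only: odd minus_minus)
  moreover have "((\<lambda>t. - \<Phi> (Complex 0 t)) has_integral - ?I) {-pi..pi}"
    by (intro has_integral_neg integrable_integral int0) (use H in auto)
  ultimately have "?I = - ?I" by (rule has_integral_unique)
  then have I0: "?I = 0" by simp
  have "integral {-pi..pi} (\<lambda>t. \<Phi> (Complex h t)) = ?I"
    by (rule vertical_mean_indep[OF \<Phi>hol per]) (use H h_pos in auto)
  then have "((\<lambda>t. \<Phi> (Complex h t)) has_integral 0) {-pi..pi}"
    using integrable_integral[OF int0[of h]] I0 H h_pos by simp
  from has_integral_add[OF has_integral_mult_right[OF cheb_kernel_mean[OF h_pos, of \<theta>], of "g x"] this]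
  have "((\<lambda>t. g x * cheb_kernel \<theta> (Complex h t) + \<Phi> (Complex h t)) has_integral g x * (2 * pi)) {-pi..pi}"
    by simp
  moreover have "g x * cheb_kernel \<theta> (Complex h t) + \<Phi> (Complex h t)
      = G (Complex h t) * cheb_kernel \<theta> (Complex h t)" for t
  proof -
    have "cosh (Complex h t) \<noteq> x"
      using cheb_kernel_eq(1)[of "Complex h t" \<theta>] h_pos by (simp add: x_def)
    moreover have "cheb_kernel \<theta> (Complex h t) = sinh (Complex h t) / (cosh (Complex h t) - x)"
      using cheb_kernel_eq(2)[of "Complex h t" \<theta>] h_pos by (simp add: x_def)
    ultimately show ?thesis
      by (simp add: \<Phi>_def D_def G_def divide_inverse algebra_simps)
  qed
  ultimately show ?thesis by (simp add: x_def mult_ac)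
qed

text \<open>On Re \<sigma> = h the conjugate of \<sigma> is 2 h - \<sigma>, so the reflected kernel
  is holomorphic in \<sigma> and the contour may be moved to Re \<sigma> = 0. There \<open>G\<close>
  is real, so the real part of the integral involves only the real part of the kernel at level 2 h,
  which is nonnegative with integral 2 pi. The modulus of the kernel has no such uniform bound,
  hence the restriction to \<open>Re s\<close>.\<close>

lemma reflected_kernel_mean:
  obtains s where "((\<lambda>t. G (Complex h t) * cheb_kernel \<theta> (Complex h (- t))) has_integral s) {-pi..pi}"
    "\<bar>Re s\<bar> \<le> 2 * pi * K"
proof -
  define \<Phi> where "\<Phi> \<sigma> = G \<sigma> * cheb_kernel \<theta> (2 * h - \<sigma>)" for \<sigma> :: complex
  \<comment> \<open>The reflected kernel requires Re (2 h - \<sigma>) > 0.\<close>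
  define H' where "H' = min H (2 * h)"
  have H': "h < H'" "0 < H'" using H h_pos by (auto simp: H'_def)
  have \<Phi>hol: "\<Phi> holomorphic_on {\<sigma>. -H < Re \<sigma> \<and> Re \<sigma> < H'}"
    unfolding \<Phi>_def
    by (intro holomorphic_on_mult holomorphic_on_subset[OF holomorphic_G] holomorphic_on_cheb_kernel)
       (auto simp: H'_def intro!: holomorphic_intros)
  have per: "\<Phi> (\<sigma> + 2 * pi * \<i>) = \<Phi> \<sigma>" for \<sigma>
    using cheb_kernel_periodic[of \<theta> "2 * h - \<sigma>"] by (simp only: \<Phi>_def G_periodic diff_diff_eq[symmetric])
  have int: "(\<lambda>t. \<Phi> (Complex s t)) integrable_on {-pi..pi}" if "-H < s" "s < H'" for s
    by (intro integrable_continuous_interval continuous_on_vertical[OF \<Phi>hol]) (use that in auto)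
  let ?I = "integral {-pi..pi} (\<lambda>t. \<Phi> (Complex 0 t))"
  have I: "(\<lambda>t. \<Phi> (Complex h t)) integrable_on {-pi..pi}" "integral {-pi..pi} (\<lambda>t. \<Phi> (Complex h t)) = ?I"
    by (rule int, use H H' h_pos in simp, use H' in simp)
       (rule vertical_mean_indep[OF \<Phi>hol per]; use H H' h_pos in simp)
  then have 1: "((\<lambda>t. \<Phi> (Complex h t)) has_integral ?I) {-pi..pi}"
    by (metis integrable_integral)
  have "\<Phi> (Complex h t) = G (Complex h t) * cheb_kernel \<theta> (Complex h (- t))" for t
  proof -
    have "2 * of_real h - Complex h t = Complex h (- t)" by (simp add: complex_eq_iff)
    then show ?thesis by (simp add: \<Phi>_def)
  qed
  with 1 have 2: "((\<lambda>t. G (Complex h t) * cheb_kernel \<theta> (Complex h (- t))) has_integral ?I) {-pi..pi}"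
    by simp
  have 3: "((\<lambda>t. Re (\<Phi> (Complex 0 t))) has_integral Re ?I) {-pi..pi}"
    using has_integral_linear[OF integrable_integral[OF int[of 0]] bounded_linear_Re] H H'
    by (simp add: o_def)
  have mean: "((\<lambda>t. K * ((poisson (exp (\<i> * of_real \<theta> - Complex (2 * h) t))
      + poisson (exp (\<i> * of_real (- \<theta>) - Complex (2 * h) t))) / 2)) has_integral K * ((2 * pi + 2 * pi) / 2)) {-pi..pi}"
    using h_pos by (intro has_integral_mult_right has_integral_divide has_integral_add poisson_mean) auto
  have mean': "((\<lambda>t. K * Re (cheb_kernel \<theta> (Complex (2 * h) t))) has_integral K * (2 * pi)) {-pi..pi}"
    using mean by (simp add: Re_cheb_kernel)
  have "((\<lambda>t. K * Re (cheb_kernel \<theta> (Complex (2 * h) (- t)))) has_integral K * (2 * pi)) {-pi..pi}"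
    using has_integral_reflect_lemma_real[OF mean'] by simp
  note 4 = this
  have "norm (Re ?I) \<le> K * (2 * pi)"
  proof (rule has_integral_norm_bound[OF 3 4])
    fix t
    have c: "cosh (Complex 0 t) = of_real (cos t)" by (simp add: cosh_Complex complex_eq_iff)
    have "Im (G (Complex 0 t)) = 0"
      unfolding G_def c by (rule real_on_segment) simp
    then have "Re (\<Phi> (Complex 0 t)) = Re (G (Complex 0 t)) * Re (cheb_kernel \<theta> (Complex (2 * h) (- t)))"
      unfolding \<Phi>_def by (simp add: complex_diff[symmetric] complex_of_real_def) 
        (simp add: Complex_eq algebra_simps)
    moreover have "\<bar>Re (G (Complex 0 t))\<bar> \<le> K"
      using norm_G[of 0 t] H abs_Re_le_cmod[of "G (Complex 0 t)"] by simp
    moreover have "0 \<le> Re (cheb_kernel \<theta> (Complex (2 * h) (- t)))"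
      unfolding Re_cheb_kernel using h_pos
      by (intro divide_nonneg_nonneg add_nonneg_nonneg poisson_nonneg norm_exp_less_1) auto
    ultimately show "norm (Re (\<Phi> (Complex 0 t))) \<le> K * Re (cheb_kernel \<theta> (Complex (2 * h) (- t)))"
      by (simp add: abs_mult mult_right_mono)
  qed
  then show ?thesis using 2 that by (simp add: mult_ac)
qed

text \<open>Up to cosines of order below \<open>n\<close>, the Cauchy kernel becomes \<open>y\<^sup>n\<close> times a positive Poisson kernel
  once \<open>q\<^sup>2\<close> times its reflection is added.\<close>

lemma kernel_decomposition:
  fixes \<theta> t :: real
  assumes "1 \<le> n"
  defines "y \<equiv> \<lambda>\<theta>. exp (\<i> * of_real \<theta> - Complex h t)" and "q \<equiv> exp (- real n * h)"
  shows "cheb_kernel \<theta> (Complex h t) + of_real (q\<^sup>2) * cheb_kernel \<theta> (Complex h (- t)) =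
    (y \<theta> ^ n * poisson (y \<theta>) + y (- \<theta>) ^ n * poisson (y (- \<theta>)))
    + (\<Sum>k<n. (if k = 0 then 1 else 2) * (1 - of_real (exp (- 2 * h)) ^ (n - k)) *
        exp (- of_nat k * Complex h t) * of_real (cos (real k * \<theta>)))"
proof -
  let ?r = "complex_of_real (exp (- 2 * h))"
  define b where "b k = 1 - ?r ^ (n - k)" for k
  have q: "of_real (q\<^sup>2) = ?r ^ n"
    unfolding q_def power2_eq_square by (simp add: exp_of_nat_mult[symmetric] exp_add[symmetric] flip: of_real_power)
  have lt: "cmod (y \<theta>) < 1" for \<theta>
    unfolding y_def using h_pos by (intro norm_exp_less_1) simp
  have ycnj: "y \<theta> * cnj (y \<theta>) = ?r" for \<theta>
  proof -
    have "cmod (y \<theta>) = exp (- h)" by (simp add: y_def)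
    then show ?thesis
      by (simp add: complex_norm_square[symmetric] power2_eq_square exp_add[symmetric] flip: of_real_mult)
  qed
  have cnjy: "exp (\<i> * of_real (- \<theta>) - Complex h (- t)) = cnj (y \<theta>)" for \<theta>
    unfolding y_def exp_cnj by (rule arg_cong[of _ _ exp]) (simp add: complex_eq_iff)
  have refl: "geo (y \<theta>) + ?r ^ n * geo (cnj (y \<theta>)) =
      y \<theta> ^ n * poisson (y \<theta>) + (\<Sum>k=1..<n. b k * y \<theta> ^ k) - ?r ^ n" for \<theta>
  proof -
    have "y \<theta> \<noteq> 1" "cnj (y \<theta>) \<noteq> 1"
      using norm_less_1_imp_neq[OF lt] by (auto simp: complex_cnj_cancel_iff[of _ 1, simplified])
    from geo_reflection[OF this assms(1)] show ?thesis
      by (simp add: ycnj poisson_complex[OF lt] b_def)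
  qed
  have pow: "y \<theta> ^ k + y (- \<theta>) ^ k = 2 * (exp (- of_nat k * Complex h t) * of_real (cos (real k * \<theta>)))" for k
  proof -
    have "y \<theta> ^ k = exp (- of_nat k * Complex h t) * exp (\<i> * of_real (real k * \<theta>))" for \<theta>
      unfolding y_def by (simp add: exp_of_nat_mult[symmetric] exp_add[symmetric] algebra_simps)
    then show ?thesis
      by (simp add: cos_of_real[symmetric] cos_exp_eq algebra_simps del: cos_of_real)
  qed
  have "cheb_kernel \<theta> (Complex h t) + of_real (q\<^sup>2) * cheb_kernel \<theta> (Complex h (- t))
     = 1 + ?r ^ n + (geo (y \<theta>) + ?r ^ n * geo (cnj (y \<theta>))) + (geo (y (- \<theta>)) + ?r ^ n * geo (cnj (y (- \<theta>))))"
    using cnjy[of \<theta>] cnjy[of "- \<theta>"] unfolding q cheb_kernel_def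
    by (simp add: y_def algebra_simps)
  \<comment> \<open>Each of the two reflections subtracts r^n from the constant 1 + r^n, where r =
    exp (-2 h); the rest 1 - r^n is the term k = 0, of weight 1.\<close>
  also have "\<dots> = (y \<theta> ^ n * poisson (y \<theta>) + y (- \<theta>) ^ n * poisson (y (- \<theta>)))
      + (1 - ?r ^ n + (\<Sum>k=1..<n. b k * (y \<theta> ^ k + y (- \<theta>) ^ k)))"
    unfolding refl by (simp add: distrib_left sum.distrib)
  also have "1 - ?r ^ n + (\<Sum>k=1..<n. b k * (y \<theta> ^ k + y (- \<theta>) ^ k)) =
      (\<Sum>k<n. (if k = 0 then 1 else 2) * b k * exp (- of_nat k * Complex h t) * of_real (cos (real k * \<theta>)))"
  proof -
    have "(\<Sum>k<n. (if k = 0 then 1 else 2) * b k * exp (- of_nat k * Complex h t) * of_real (cos (real k * \<theta>)))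
      = b 0 + (\<Sum>k=Suc 0..<n. (if k = 0 then 1 else 2) * b k * exp (- of_nat k * Complex h t) * of_real (cos (real k * \<theta>)))"
      unfolding lessThan_atLeast0 using assms(1) by (subst sum.atLeast_Suc_lessThan) auto
    also have "(\<Sum>k=Suc 0..<n. (if k = 0 then 1 else 2) * b k * exp (- of_nat k * Complex h t) * of_real (cos (real k * \<theta>)))
      = (\<Sum>k=1..<n. b k * (y \<theta> ^ k + y (- \<theta>) ^ k))"
      unfolding pow by (rule sum.cong) (auto simp: mult_ac)
    finally show ?thesis by (simp add: b_def)
  qed
  finally show ?thesis by (simp only: b_def)
qed

text \<open>Integrate \<open>kernel_decomposition\<close> against \<open>G\<close>. The two Poisson
  terms, each q times a kernel of integral 2 pi, contribute at most 4 pi K q, and the reflected term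
  at most 2 pi K q^2; Cauchy's factor 2 pi divides out.\<close>

lemma near_best_polynomial:
  assumes n: "1 \<le> n"
  shows "\<exists>p :: real poly. degree p \<le> n - 1 \<and> (\<forall>x\<in>{-1..1}.
    \<bar>Re (g (of_real x)) - poly p x\<bar> \<le> K * (2 * exp (- real n * h) + (exp (- real n * h))\<^sup>2))"
proof -
  define q where "q = exp (- real n * h)"
  define B where "B k = integral {-pi..pi} (\<lambda>t. G (Complex h t) *
      ((if k = 0 then 1 else 2) * (1 - of_real (exp (- 2 * h)) ^ (n - k)) * exp (- of_nat k * Complex h t)))" for k
  from cosine_multiple_poly obtain T :: "nat \<Rightarrow> real poly"
    where T: "\<And>k. degree (T k) \<le> k" "\<And>k \<theta>. poly (T k) (cos \<theta>) = cos (real k * \<theta>)"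
    by metis
  \<comment> \<open>Only real parts of the final identity are compared, so the coefficients keep
    their real parts; 2 pi is the factor in \<open>cauchy_ellipse\<close>.\<close>
  define p where "p = (\<Sum>k<n. smult (Re (B k) / (2 * pi)) (T k))"
  have "degree p \<le> n - 1"
    unfolding p_def
  proof (rule degree_sum_le)
    fix k assume "k \<in> {..<n}"
    then have "k \<le> n - 1" by auto
    then show "degree (smult (Re (B k) / (2 * pi)) (T k)) \<le> n - 1"
      using degree_smult_le[of "Re (B k) / (2 * pi)" "T k"] T(1)[of k] by linarith
  qed simp
  moreover have "\<bar>Re (g (of_real x)) - poly p x\<bar> \<le> K * (2 * q + q\<^sup>2)" if x: "x \<in> {-1..1}" for x
  proof -
    define \<theta> where "\<theta> = arccos x"
    have x\<theta>: "x = cos \<theta>" using x by (simp add: \<theta>_def)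
    define y where "y \<theta> t = exp (\<i> * of_real \<theta> - Complex h t)" for \<theta> t
    obtain s where s: "((\<lambda>t. G (Complex h t) * cheb_kernel \<theta> (Complex h (- t))) has_integral s) {-pi..pi}"
      "\<bar>Re s\<bar> \<le> 2 * pi * K"
      by (rule reflected_kernel_mean)
    let ?L = "\<lambda>t. \<Sum>k<n. G (Complex h t) * ((if k = 0 then 1 else 2) *
        (1 - of_real (exp (- 2 * h)) ^ (n - k)) * exp (- of_nat k * Complex h t)) * of_real (cos (real k * \<theta>))"
    have lint: "(?L has_integral (\<Sum>k<n. B k * of_real (cos (real k * \<theta>)))) {-pi..pi}"
      unfolding B_def
      by (intro has_integral_sum has_integral_mult_left integrable_integral integrable_continuous_interval
          continuous_on_mult G_continuous continuous_on_const continuous_on_exp)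
         (auto simp: Complex_eq intro!: continuous_intros)
    let ?P = "\<lambda>t. y \<theta> t ^ n * poisson (y \<theta> t) + y (- \<theta>) t ^ n * poisson (y (- \<theta>) t)"
    let ?I = "2 * pi * g (of_real x) + of_real (q\<^sup>2) * s - (\<Sum>k<n. B k * of_real (cos (real k * \<theta>)))"
    have "((\<lambda>t. G (Complex h t) * cheb_kernel \<theta> (Complex h t)
        + of_real (q\<^sup>2) * (G (Complex h t) * cheb_kernel \<theta> (Complex h (- t))) - ?L t) has_integral ?I) {-pi..pi}"
      using cauchy_ellipse[of \<theta>] unfolding x\<theta>
      by (intro has_integral_diff[OF has_integral_add[OF _ has_integral_mult_right[OF s(1)]] lint])
    moreover have "G (Complex h t) * cheb_kernel \<theta> (Complex h t)
        + of_real (q\<^sup>2) * (G (Complex h t) * cheb_kernel \<theta> (Complex h (- t))) - ?L t = G (Complex h t) * ?P t" for t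
    proof -
      have "G (Complex h t) * cheb_kernel \<theta> (Complex h t)
          + of_real (q\<^sup>2) * (G (Complex h t) * cheb_kernel \<theta> (Complex h (- t)))
        = G (Complex h t) * (cheb_kernel \<theta> (Complex h t) + of_real (q\<^sup>2) * cheb_kernel \<theta> (Complex h (- t)))"
        by (simp add: algebra_simps)
      also have "\<dots> = G (Complex h t) * ?P t + ?L t"
        using kernel_decomposition[OF n, of \<theta> t] unfolding q_def y_def
        by (simp only: distrib_left sum_distrib_left mult.assoc)
      finally show ?thesis by simp
    qed
    ultimately have int: "((\<lambda>t. G (Complex h t) * ?P t) has_integral ?I) {-pi..pi}" by simp
    have "((\<lambda>t. K * (q * (poisson (y \<theta> t) + poisson (y (- \<theta>) t)))) has_integral K * (q * (2 * pi + 2 * pi))) {-pi..pi}"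
      unfolding y_def by (intro has_integral_mult_right has_integral_add poisson_mean h_pos)
    then have "norm ?I \<le> K * (q * (2 * pi + 2 * pi))"
    proof (rule has_integral_norm_bound[OF int])
      fix t
      have y1: "cmod (y \<theta> t) < 1" for \<theta> unfolding y_def using h_pos by (intro norm_exp_less_1) simp
      have yn: "cmod (y \<theta> t ^ n) = q" for \<theta>
        by (simp add: y_def q_def norm_power exp_of_nat_mult[symmetric])
      have "cmod (?P t) \<le> q * poisson (y \<theta> t) + q * poisson (y (- \<theta>) t)"
        by (rule norm_triangle_le) (simp add: norm_mult yn poisson_nonneg[OF y1])
      moreover have "cmod (G (Complex h t)) \<le> K" by (rule norm_G) (use H h_pos in auto)
      ultimately show "cmod (G (Complex h t) * ?P t) \<le> K * (q * (poisson (y \<theta> t) + poisson (y (- \<theta>) t)))"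
        unfolding norm_mult distrib_left[symmetric] by (intro mult_mono) (auto intro: order_trans[OF norm_ge_zero])
    qed
    then have "\<bar>Re ?I\<bar> \<le> K * (q * (2 * pi + 2 * pi))"
      using abs_Re_le_cmod order_trans by blast
    moreover have "Re ?I = 2 * pi * Re (g (of_real x)) + q\<^sup>2 * Re s - (\<Sum>k<n. Re (B k) * cos (real k * \<theta>))"
      by (simp flip: of_real_power)
    moreover have "2 * pi * poly p x = (\<Sum>k<n. Re (B k) * cos (real k * \<theta>))"
      unfolding p_def x\<theta> by (simp add: poly_sum T(2) sum_distrib_left)
    ultimately have "\<bar>2 * pi * (Re (g (of_real x)) - poly p x) + q\<^sup>2 * Re s\<bar> \<le> K * (q * (2 * pi + 2 * pi))"
      by (simp add: algebra_simps)
    moreover have "\<bar>q\<^sup>2 * Re s\<bar> \<le> q\<^sup>2 * (2 * pi * K)"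
      using s(2) by (simp add: abs_mult mult_left_mono)
    ultimately have "\<bar>2 * pi * (Re (g (of_real x)) - poly p x)\<bar> \<le> 2 * pi * (K * (2 * q + q\<^sup>2))"
      by (simp add: algebra_simps abs_le_iff)
    then show ?thesis by (simp add: abs_mult)
  qed
  ultimately show ?thesis unfolding q_def by blast
qed

end

text \<open>The bound of \<open>near_best_polynomial\<close> is continuous in h, so the strict
  inequality for \<open>E\<close> at h = ln r persists at some smaller h, where the contour lies
  inside the ellipse.\<close>

lemma ellipse_polynomial_approximation:
  assumes r: "1 < r" and hol: "g holomorphic_on bernstein_ellipse (ereal r)"
    and bound: "\<And>z. z \<in> bernstein_ellipse (ereal r) \<Longrightarrow> cmod (g z) \<le> K"
    and real: "\<And>x. x \<in> {-1..1} \<Longrightarrow> Im (g (of_real x)) = 0"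
    and n: "1 \<le> n" and E: "K * (2 * inverse r ^ n + (inverse r ^ n)\<^sup>2) < E"
  shows "\<exists>p :: real poly. degree p \<le> n - 1 \<and> (\<forall>x\<in>{-1..1}. \<bar>Re (g (of_real x)) - poly p x\<bar> \<le> E)"
proof -
  let ?k = "\<lambda>h. K * (2 * exp (- real n * h) + (exp (- real n * h))\<^sup>2)"
  have q: "exp (- real n * ln r) = inverse r ^ n"
    using r by (simp add: exp_minus exp_of_nat_mult power_inverse)
  have "(?k \<longlongrightarrow> ?k (ln r)) (at_left (ln r))"
    by (intro tendsto_intros)
  then have "\<forall>\<^sub>F h in at_left (ln r). ?k h < E"
    using E by (intro order_tendstoD(2)[of _ "?k (ln r)"]) (simp_all only: q)
  moreover have "\<forall>\<^sub>F h in at_left (ln r). h \<in> {0<..<ln r}"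
    using r by (intro eventually_at_left_real) simp
  ultimately have "\<forall>\<^sub>F h in at_left (ln r). ?k h < E \<and> h \<in> {0<..<ln r}"
    by (rule eventually_conj)
  then obtain h where h: "?k h < E" "0 < h" "h < ln r"
    using eventually_happens'[OF trivial_limit_at_left_real] by fastforce
  have "exp h < exp (ln r)" using h by (simp only: exp_less_cancel_iff)
  then interpret ellipse_function "ereal r" g K h
    using hol bound real h r by unfold_locales auto
  show ?thesis
    using near_best_polynomial[OF n] h(1) by (meson less_imp_le order_trans)
qed

section \<open>Riemann--Stieltjes sums and quadrature\<close>

text \<open>All integrals are given as limits over arbitrary tagged divisions, so left-tagged partitions
  suffice; a partition of \<open>[-1,1]\<close> and its image under \<open>b \<phi>\<close> give sums with equal weights, which
  replaces a change of variables.\<close>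

definition RS_sum :: "(real \<Rightarrow> real) \<Rightarrow> (nat \<Rightarrow> real) \<Rightarrow> nat \<Rightarrow> (real \<Rightarrow> 'a::real_vector) \<Rightarrow> 'a" where
  "RS_sum W x N g = (\<Sum>i<N. (W (x (Suc i)) - W (x i)) *\<^sub>R g (x i))"

lemma partition_less:
  fixes x :: "nat \<Rightarrow> real"
  assumes "\<And>i. i < N \<Longrightarrow> x i < x (Suc i)" "i < j" "j \<le> N"
  shows "x i < x j"
  using assms(2,3)
proof (induction j)
  case (Suc j)
  then show ?case using assms(1)[of j] by (cases "i = j") force+
qed simp

lemma partition_tagged_division:
  fixes x :: "nat \<Rightarrow> real"
  assumes inc: "\<And>i. i < N \<Longrightarrow> x i < x (Suc i)" and N: "0 < N"
  shows "(\<lambda>i. (x i, {x i..x (Suc i)})) ` {..<N} tagged_division_of {x 0..x N}"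
proof (rule tagged_division_ofI)
  have le: "x i \<le> x j" if "i \<le> j" "j \<le> N" for i j
    using partition_less[of N x i j] inc that by (cases "i = j") auto
  show "finite ((\<lambda>i. (x i, {x i..x (Suc i)})) ` {..<N})" by simp
  fix t k assume "(t, k) \<in> (\<lambda>i. (x i, {x i..x (Suc i)})) ` {..<N}"
  then obtain i where i: "i < N" "t = x i" "k = {x i..x (Suc i)}" by auto
  show "t \<in> k" using inc[OF i(1)] i by simp
  show "k \<subseteq> {x 0..x N}" using le[of 0 i] le[of "Suc i" N] i by auto
  show "\<exists>a b. k = cbox a b" using i by auto
  fix t' k' assume "(t', k') \<in> (\<lambda>i. (x i, {x i..x (Suc i)})) ` {..<N}" and ne: "(t, k) \<noteq> (t', k')"
  then obtain j where j: "j < N" "t' = x j" "k' = {x j..x (Suc j)}" by auto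
  have "i \<noteq> j" using ne i j by auto
  then consider "Suc i \<le> j" | "Suc j \<le> i" by linarith
  then show "interior k \<inter> interior k' = {}"
  proof cases
    case 1
    then show ?thesis using le[of "Suc i" j] i j by auto
  next
    case 2
    then show ?thesis using le[of "Suc j" i] i j by auto
  qed
next
  have le: "x i \<le> x j" if "i \<le> j" "j \<le> N" for i j
    using partition_less[of N x i j] inc that by (cases "i = j") auto
  have "{x 0..x k} \<subseteq> (\<Union>i<k. {x i..x (Suc i)})" if "1 \<le> k" for k
    using that
  proof (induction k rule: dec_induct)
    case (step k)
    then have "{x 0..x (Suc k)} \<subseteq> (\<Union>i<k. {x i..x (Suc i)}) \<union> {x k..x (Suc k)}"
      by (auto simp: not_le)
    then show ?case by (auto simp: lessThan_Suc)
  qed auto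
  from this[of N] have "{x 0..x N} \<subseteq> (\<Union>i<N. {x i..x (Suc i)})" using N by simp
  moreover have "(\<Union>i<N. {x i..x (Suc i)}) \<subseteq> {x 0..x N}"
  proof (rule UN_least)
    fix i assume "i \<in> {..<N}"
    then show "{x i..x (Suc i)} \<subseteq> {x 0..x N}" using le[of 0 i] le[of "Suc i" N] by auto
  qed
  ultimately show "\<Union>{K. \<exists>t. (t, K) \<in> (\<lambda>i. (x i, {x i..x (Suc i)})) ` {..<N}} = {x 0..x N}"
    by (auto simp: image_iff)
qed

text \<open>With left ends as tags, a cell shorter than \<delta> lies in the ball around its tag, so
  a bound on the mesh gives fineness.\<close>

lemma has_RS_integral_partition:
  fixes g :: "real \<Rightarrow> 'a::real_normed_vector"
  assumes "has_RS_integral g W a b I" "0 < e"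
  obtains \<delta> where "0 < \<delta>" "\<And>N x. \<lbrakk>\<And>i. i < N \<Longrightarrow> x i < x (Suc i) \<and> x (Suc i) - x i < \<delta>; 0 < N; x 0 = a; x N = b\<rbrakk>
      \<Longrightarrow> norm (RS_sum W x N g - I) < e"
proof -
  obtain \<delta> where \<delta>: "0 < \<delta>" "\<And>p. p tagged_division_of {a..b} \<Longrightarrow> (\<lambda>t. ball t \<delta>) fine p \<Longrightarrow>
      norm ((\<Sum>(t, K)\<in>p. (W (Sup K) - W (Inf K)) *\<^sub>R g t) - I) < e"
  proof -
    have "\<exists>\<delta>>0. \<forall>p. p tagged_division_of {a..b} \<and> (\<lambda>t. ball t \<delta>) fine p \<longrightarrow>
        norm ((\<Sum>(t, K)\<in>p. (W (Sup K) - W (Inf K)) *\<^sub>R g t) - I) < e"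
      using assms unfolding has_RS_integral_def by blast
    then show ?thesis using that by blast
  qed
  show ?thesis
  proof (rule that[OF \<delta>(1)])
    fix N and x :: "nat \<Rightarrow> real"
    assume x: "\<And>i. i < N \<Longrightarrow> x i < x (Suc i) \<and> x (Suc i) - x i < \<delta>" and N: "0 < N" "x 0 = a" "x N = b"
    let ?h = "\<lambda>i. (x i, {x i..x (Suc i)})"
    have div: "?h ` {..<N} tagged_division_of {a..b}"
      using partition_tagged_division[of N x] x N by auto
    have "(\<lambda>t. ball t \<delta>) fine ?h ` {..<N}"
      using x by (force simp: fine_def dist_real_def)
    from \<delta>(2)[OF div this]
    have "norm ((\<Sum>(t, K)\<in>?h ` {..<N}. (W (Sup K) - W (Inf K)) *\<^sub>R g t) - I) < e" .
    moreover have "inj_on ?h {..<N}"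
    proof (rule inj_onI)
      fix i j assume ij: "i \<in> {..<N}" "j \<in> {..<N}" "?h i = ?h j"
      then show "i = j"
        using partition_less[of N x i j] partition_less[of N x j i] x
        by (cases i j rule: linorder_cases) auto
    qed
    then have "(\<Sum>(t, K)\<in>?h ` {..<N}. (W (Sup K) - W (Inf K)) *\<^sub>R g t) = RS_sum W x N g"
      unfolding RS_sum_def using x by (subst sum.reindex) (auto intro!: sum.cong simp: less_imp_le)
    ultimately show "norm (RS_sum W x N g - I) < e" by simp
  qed
qed

lemma has_RS_integral_tendsto:
  fixes g :: "real \<Rightarrow> 'a::real_normed_vector"
  assumes "has_RS_integral g W a b I"
    and x: "\<And>N i. i < N \<Longrightarrow> x N i < x N (Suc i)" "\<And>N. 0 < N \<Longrightarrow> x N 0 = a" "\<And>N. 0 < N \<Longrightarrow> x N N = b"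
    and mesh: "\<And>\<delta>. 0 < \<delta> \<Longrightarrow> \<forall>\<^sub>F N in sequentially. \<forall>i<N. x N (Suc i) - x N i < \<delta>"
  shows "(\<lambda>N. RS_sum W (x N) N g) \<longlonglongrightarrow> I"
proof (rule tendstoI)
  fix e :: real assume "0 < e"
  from has_RS_integral_partition[OF assms(1) this]
  obtain \<delta> where \<delta>: "0 < \<delta>" "\<And>N x. \<lbrakk>\<And>i. i < N \<Longrightarrow> x i < x (Suc i) \<and> x (Suc i) - x i < \<delta>; 0 < N; x 0 = a; x N = b\<rbrakk>
      \<Longrightarrow> norm (RS_sum W x N g - I) < e" by blast
  have "\<forall>\<^sub>F N in sequentially. 0 < N" by (rule eventually_gt_at_top)
  with mesh[OF \<delta>(1)] show "\<forall>\<^sub>F N in sequentially. dist (RS_sum W (x N) N g) I < e"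
  proof eventually_elim
    case (elim N)
    show ?case unfolding dist_norm by (rule \<delta>(2)) (use x elim in auto)
  qed
qed

lemma exp_decay: "0 < r \<Longrightarrow> ((\<lambda>t :: real. exp (- r * t)) \<longlongrightarrow> 0) at_top"
  by real_asymp

text \<open>This half of the proof concerns integration and quadrature; it meets the analytic half
  in \<open>err_le\<close>, through a polynomial approximation on the segment.\<close>

locale quadrature_setting =
  fixes a b :: real and W \<phi> :: "real \<Rightarrow> real" and f :: "complex \<Rightarrow> complex"
    and M :: nat and u c :: "nat \<Rightarrow> real"
  assumes a_pos: "0 < a" and a_less_b: "a < b" and M: "1 \<le> M"
    and W_mono: "mono_on {a..b} W"
    and increase: "\<exists>S \<subseteq> points_of_increase W a b. finite S \<and> card S = M + 1"
    and f: "\<And>z. has_RS_integral (\<lambda>t. exp (- z * of_real t)) W a b (f z)"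
    and \<phi>: "\<phi> \<in> F_class (a / b)"
    and gauss: "gauss_quadrature M (\<lambda>s. W (b * \<phi> s)) u c"
begin

lemma b_pos: "0 < b" using a_pos a_less_b by simp

lemma \<phi>_props: "continuous_on {-1..1} \<phi>" "strict_mono_on {-1..1} \<phi>" "\<phi> (- 1) = a / b" "\<phi> 1 = 1"
  using \<phi> by (auto simp: F_class_def)

definition s :: "nat \<Rightarrow> nat \<Rightarrow> real" where "s N i = -1 + 2 * (real i / real N)"
definition x :: "nat \<Rightarrow> nat \<Rightarrow> real" where "x N i = b * \<phi> (s N i)"
definition \<Delta> :: "nat \<Rightarrow> nat \<Rightarrow> real" where "\<Delta> N i = W (x N (Suc i)) - W (x N i)"

lemma s_range: "i \<le> N \<Longrightarrow> s N i \<in> {-1..1}"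
  by (cases "N = 0") (auto simp: s_def divide_le_eq)

lemma s_step: "0 < N \<Longrightarrow> s N (Suc i) - s N i = 2 / real N"
  by (simp add: s_def field_simps)

lemma s_less: "i < N \<Longrightarrow> s N i < s N (Suc i)"
  using s_step[of N i] divide_pos_pos[of 2 "real N"] by linarith

lemma s_ends: "0 < N \<Longrightarrow> s N 0 = -1" "0 < N \<Longrightarrow> s N N = 1"
  by (simp_all add: s_def)

lemma s_mesh: "0 < \<delta> \<Longrightarrow> \<forall>\<^sub>F N in sequentially. \<forall>i<N. s N (Suc i) - s N i < \<delta>"
proof -
  assume "0 < \<delta>"
  moreover have "(\<lambda>N. 2 / real N) \<longlonglongrightarrow> 0" by real_asymp
  ultimately have "\<forall>\<^sub>F N in sequentially. 2 / real N < \<delta>" by (intro order_tendstoD(2))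
  then show ?thesis by eventually_elim (auto simp: s_step)
qed

lemma x_less: "i < N \<Longrightarrow> x N i < x N (Suc i)"
  unfolding x_def using b_pos s_less[of i N] s_range[of i N] s_range[of "Suc i" N]
  by (intro mult_strict_left_mono strict_mono_onD[OF \<phi>_props(2)]) auto

lemma x_ends: "0 < N \<Longrightarrow> x N 0 = a" "0 < N \<Longrightarrow> x N N = b"
  using b_pos by (simp_all add: x_def s_ends \<phi>_props)

lemma x_range: "i \<le> N \<Longrightarrow> 0 < N \<Longrightarrow> x N i \<in> {a..b}"
  using partition_less[of N "x N" 0 i] partition_less[of N "x N" i N] x_less[of _ N] x_ends[of N]
  by (cases "i = 0"; cases "i = N") (auto simp: less_imp_le)

lemma x_mesh: "0 < \<delta> \<Longrightarrow> \<forall>\<^sub>F N in sequentially. \<forall>i<N. x N (Suc i) - x N i < \<delta>"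
proof -
  assume \<delta>: "0 < \<delta>"
  have "uniformly_continuous_on {-1..1} \<phi>"
    by (rule compact_uniformly_continuous[OF \<phi>_props(1)]) simp
  then obtain d where d: "0 < d" "\<And>p q. p \<in> {-1..1} \<Longrightarrow> q \<in> {-1..1} \<Longrightarrow> dist q p < d \<Longrightarrow> dist (\<phi> q) (\<phi> p) < \<delta> / b"
    unfolding uniformly_continuous_on_def using \<delta> b_pos by (metis divide_pos_pos)
  from s_mesh[OF d(1)] show ?thesis
  proof eventually_elim
    case (elim N)
    show ?case
    proof (intro allI impI)
      fix i assume i: "i < N"
      then have "dist (\<phi> (s N (Suc i))) (\<phi> (s N i)) < \<delta> / b"
        using elim s_less[of i N] s_range[of i N] s_range[of "Suc i" N] by (intro d) (auto simp: dist_real_def)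
      then have "\<phi> (s N (Suc i)) - \<phi> (s N i) < \<delta> / b" by (simp add: dist_real_def)
      then have "b * (\<phi> (s N (Suc i)) - \<phi> (s N i)) < b * (\<delta> / b)"
        using b_pos by (rule mult_strict_left_mono)
      then show "x N (Suc i) - x N i < \<delta>"
        using b_pos by (simp add: x_def right_diff_distrib)
    qed
  qed
qed

lemma \<Delta>_nonneg: "i < N \<Longrightarrow> 0 \<le> \<Delta> N i"
  unfolding \<Delta>_def using x_range[of i N] x_range[of "Suc i" N] x_less[of i N]
  by (simp add: mono_onD[OF W_mono])

lemma sum_\<Delta>: "0 < N \<Longrightarrow> (\<Sum>i<N. \<Delta> N i) = W b - W a"
  unfolding \<Delta>_def by (subst sum_lessThan_telescope) (simp add: x_ends)

definition V where "V = W b - W a"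

lemma norm_sum_\<Delta>_le:
  fixes h :: "nat \<Rightarrow> 'a::real_normed_vector"
  assumes "\<And>i. i < N \<Longrightarrow> norm (h i) \<le> B" "0 < N"
  shows "norm (\<Sum>i<N. \<Delta> N i *\<^sub>R h i) \<le> B * V"
proof -
  have "norm (\<Sum>i<N. \<Delta> N i *\<^sub>R h i) \<le> (\<Sum>i<N. \<Delta> N i * B)"
    by (rule sum_norm_le) (use assms \<Delta>_nonneg in \<open>auto intro!: mult_left_mono\<close>)
  also have "\<dots> = B * V"
    unfolding sum_distrib_right[symmetric] sum_\<Delta>[OF assms(2)] V_def by (rule mult.commute)
  finally show ?thesis .
qed

text \<open>Stands for the estimate of an integral by a bound of the integrand times the total mass;
  differences of integrals are formed at the level of the sums.\<close>

lemma norm_lim_\<Delta>_le: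
  fixes h :: "nat \<Rightarrow> nat \<Rightarrow> 'a::real_normed_vector"
  assumes "(\<lambda>N. \<Sum>i<N. \<Delta> N i *\<^sub>R h N i) \<longlonglongrightarrow> L" "\<And>N i. i < N \<Longrightarrow> norm (h N i) \<le> B"
  shows "norm L \<le> B * V"
proof (rule tendsto_upperbound[OF tendsto_norm[OF assms(1)]])
  show "\<forall>\<^sub>F N in sequentially. norm (\<Sum>i<N. \<Delta> N i *\<^sub>R h N i) \<le> B * V"
    using eventually_gt_at_top[of 0] by eventually_elim (use norm_sum_\<Delta>_le assms(2) in blast)
qed simp

lemma lim_f: "(\<lambda>N. \<Sum>i<N. \<Delta> N i *\<^sub>R exp (- z * of_real (x N i))) \<longlonglongrightarrow> f z"
  using has_RS_integral_tendsto[OF f x_less x_ends x_mesh] by (simp add: RS_sum_def \<Delta>_def)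

lemma lim_f_real: "(\<lambda>N. \<Sum>i<N. \<Delta> N i *\<^sub>R complex_of_real (exp (- t * x N i))) \<longlonglongrightarrow> f (of_real t)"
  using lim_f[of "of_real t"] by (simp flip: exp_of_real)

lemma lim_quadrature:
  assumes "degree p \<le> 2 * M - 1"
  shows "(\<lambda>N. \<Sum>i<N. \<Delta> N i *\<^sub>R poly p (s N i)) \<longlonglongrightarrow> (\<Sum>\<nu>=1..M. c \<nu> * poly p (u \<nu>))"
proof -
  have "has_RS_integral (poly p) (\<lambda>s. W (b * \<phi> s)) (-1) 1 (\<Sum>\<nu>=1..M. c \<nu> * poly p (u \<nu>))"
    using gauss assms by (simp add: gauss_quadrature_def)
  from has_RS_integral_tendsto[OF this s_less s_ends s_mesh]
  show ?thesis by (simp add: RS_sum_def \<Delta>_def x_def)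
qed

lemma u_range: "\<nu> \<in> {1..M} \<Longrightarrow> u \<nu> \<in> {-1..1}" "\<nu> \<in> {1..M} \<Longrightarrow> 0 < c \<nu>"
  using gauss by (auto simp: gauss_quadrature_def less_imp_le)

lemma lim_V: "(\<lambda>N. \<Sum>i<N. \<Delta> N i) \<longlonglongrightarrow> V"
proof (rule tendsto_eventually)
  show "\<forall>\<^sub>F N in sequentially. (\<Sum>i<N. \<Delta> N i) = V"
    using eventually_gt_at_top[of 0] by eventually_elim (simp add: sum_\<Delta> V_def)
qed

lemma sum_c: "(\<Sum>\<nu>=1..M. c \<nu>) = V"
  using LIMSEQ_unique[OF _ lim_V] lim_quadrature[of 1] by simp

lemma f_0: "f 0 = of_real V"
proof -
  have "(\<lambda>N. complex_of_real (\<Sum>i<N. \<Delta> N i)) \<longlonglongrightarrow> of_real V"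
    by (rule tendsto_of_real[OF lim_V])
  then show ?thesis using lim_f[of 0] by (simp add: scaleR_conv_of_real LIMSEQ_unique)
qed

definition err where
  "err t = cmod (f (of_real t) - of_real (\<Sum>\<nu>=1..M. c \<nu> * exp (- b * \<phi> (u \<nu>) * t)))"

text \<open>The approximation error enters twice: once under the integral and once in the quadrature
  sum, whose weights are positive and add up to \<open>V\<close> by exactness for the constant
  1.\<close>

lemma err_le:
  assumes p: "degree p \<le> 2 * M - 1"
    and E: "\<And>y. y \<in> {-1..1} \<Longrightarrow> \<bar>exp (- b * t * \<phi> y) - poly p y\<bar> \<le> E"
  shows "err t \<le> 2 * E * V"
proof -
  let ?Q = "\<Sum>\<nu>=1..M. c \<nu> * poly p (u \<nu>)"
  have "(\<lambda>N. (\<Sum>i<N. \<Delta> N i *\<^sub>R complex_of_real (exp (- t * x N i))) - of_real (\<Sum>i<N. \<Delta> N i *\<^sub>R poly p (s N i)))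
      \<longlonglongrightarrow> f (of_real t) - of_real ?Q"
    by (intro tendsto_diff lim_f_real tendsto_of_real lim_quadrature p)
  then have "(\<lambda>N. \<Sum>i<N. \<Delta> N i *\<^sub>R complex_of_real (exp (- b * t * \<phi> (s N i)) - poly p (s N i)))
      \<longlonglongrightarrow> f (of_real t) - of_real ?Q"
    by (simp add: x_def scaleR_conv_of_real right_diff_distrib sum_subtractf mult_ac)
  then have 1: "cmod (f (of_real t) - of_real ?Q) \<le> E * V"
    by (rule norm_lim_\<Delta>_le) (use E s_range in \<open>simp only: norm_of_real less_imp_le\<close>)
  have "\<bar>?Q - (\<Sum>\<nu>=1..M. c \<nu> * exp (- b * \<phi> (u \<nu>) * t))\<bar> \<le> (\<Sum>\<nu>=1..M. c \<nu> * E)"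
    unfolding sum_subtractf[symmetric] right_diff_distrib[symmetric]
  proof (rule order_trans[OF sum_abs], rule sum_mono)
    fix \<nu> assume v: "\<nu> \<in> {1..M}"
    have "- b * \<phi> (u \<nu>) * t = - b * t * \<phi> (u \<nu>)" by simp
    then show "\<bar>c \<nu> * (poly p (u \<nu>) - exp (- b * \<phi> (u \<nu>) * t))\<bar> \<le> c \<nu> * E"
      using E[OF u_range(1)[OF v]] u_range(2)[OF v]
      by (simp only: abs_mult abs_of_pos mult_le_cancel_left_pos abs_minus_commute)
  qed
  also have "\<dots> = E * V"
    unfolding sum_distrib_right[symmetric] sum_c by (rule mult.commute)
  finally have 2: "cmod (of_real ?Q - of_real (\<Sum>\<nu>=1..M. c \<nu> * exp (- b * \<phi> (u \<nu>) * t))) \<le> E * V"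
    by (simp only: of_real_diff[symmetric] norm_of_real)
  show ?thesis
    unfolding err_def using norm_triangle_le[OF add_mono[OF 1 2]] by simp
qed

lemma f_decay: "cmod (f (of_real t)) \<le> exp (- t * a) * V" if "0 \<le> t"
proof (rule norm_lim_\<Delta>_le[OF lim_f_real])
  fix N i :: nat assume "i < N"
  then have "t * a \<le> t * x N i" using x_range[of i N] that by (intro mult_left_mono) auto
  then show "cmod (complex_of_real (exp (- t * x N i))) \<le> exp (- t * a)" by simp
qed

text \<open>exp (-p) has Lipschitz constant 1 on p >= 0, and the partition points are at most b. The
  purpose is the continuity of \<open>err\<close>.\<close>

lemma f_Lipschitz: "cmod (f (of_real t) - f (of_real t')) \<le> b * \<bar>t - t'\<bar> * V" if "0 \<le> t" "0 \<le> t'"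
proof (rule norm_lim_\<Delta>_le)
  show "(\<lambda>N. \<Sum>i<N. \<Delta> N i *\<^sub>R complex_of_real (exp (- t * x N i) - exp (- t' * x N i)))
      \<longlonglongrightarrow> f (of_real t) - f (of_real t')"
    using tendsto_diff[OF lim_f_real[of t] lim_f_real[of t']]
    by (simp add: scaleR_conv_of_real right_diff_distrib sum_subtractf)
  fix N i :: nat assume "i < N"
  then have xi: "x N i \<in> {a..b}" using x_range[of i N] by simp
  have lip: "\<bar>exp (- p) - exp (- q)\<bar> \<le> \<bar>p - q\<bar>" if "0 \<le> p" "0 \<le> q" for p q :: real
  proof -
    have *: "exp (- p) - exp (- q) \<le> q - p" if "0 \<le> p" "p \<le> q" for p q :: real
    proof -
      have "1 + (p - q) \<le> exp (p - q)" by (rule exp_ge_add_one_self)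
      then have 1: "1 - exp (p - q) \<le> q - p" by linarith
      have "exp (- p) - exp (- q) = exp (- p) * (1 - exp (p - q))"
        by (simp add: right_diff_distrib exp_add[symmetric])
      also have "\<dots> \<le> 1 * (1 - exp (p - q))"
        using that by (intro mult_right_mono) auto
      also have "\<dots> \<le> q - p" using 1 by simp
      finally show ?thesis .
    qed
    show ?thesis using *[of p q] *[of q p] that by (cases "p \<le> q") auto
  qed
  have "\<bar>exp (- (t * x N i)) - exp (- (t' * x N i))\<bar> \<le> \<bar>t * x N i - t' * x N i\<bar>"
    using that xi a_pos by (intro lip) auto
  also have "\<dots> = x N i * \<bar>t - t'\<bar>"
    using xi a_pos by (simp add: left_diff_distrib[symmetric] abs_mult)
  also have "\<dots> \<le> b * \<bar>t - t'\<bar>" using xi by (intro mult_right_mono) auto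
  finally show "cmod (complex_of_real (exp (- t * x N i) - exp (- t' * x N i))) \<le> b * \<bar>t - t'\<bar>"
    by (simp only: norm_of_real mult_minus_left)
qed

section \<open>Positivity of integrals and of the error\<close>

lemma V_nonneg: "0 \<le> V"
  using W_mono a_less_b by (auto simp: V_def mono_on_def)

text \<open>Clamping to [t1, t2] lets the increment of \<open>W\<close> from t1 to t2 telescope
  along a partition that may contain neither point.\<close>

lemma clamp_increment_le:
  assumes "t1 \<in> {a..b}" "t2 \<in> {a..b}" "t1 \<le> t2" "y \<in> {a..b}" "y' \<in> {a..b}" "y \<le> y'"
  shows "W (max t1 (min t2 y')) - W (max t1 (min t2 y)) \<le> W y' - W y"
proof -
  have W: "W p \<le> W q" if "p \<in> {a..b}" "q \<in> {a..b}" "p \<le> q" for p q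
    using W_mono that by (auto simp: mono_on_def)
  consider "t2 \<le> y" | "y' \<le> t1" | "y < t2" "t1 < y'" by linarith
  then show ?thesis
  proof cases
    case 3
    then have "W (max t1 (min t2 y')) \<le> W y'" "W y \<le> W (max t1 (min t2 y))"
      using assms by (auto intro!: W simp: min_def max_def)
    then show ?thesis by linarith
  next
    case 1
    then have "max t1 (min t2 y') = t2" "max t1 (min t2 y) = t2" using assms by auto
    then show ?thesis using W[of y y'] assms by simp
  next
    case 2
    then have "max t1 (min t2 y') = t1" "max t1 (min t2 y) = t1" using assms by auto
    then show ?thesis using W[of y y'] assms by simp
  qed
qed

text \<open>Near \<tau> the integrand exceeds \<open>P \<tau> / 2\<close> and \<open>W\<close> has a
  positive increment, so all sufficiently fine sums stay above a positive constant.\<close>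

lemma positive_on_increase:
  assumes P: "continuous_on UNIV P" "\<And>t. 0 \<le> P t"
    and \<tau>: "\<tau> \<in> points_of_increase W a b" "0 < P \<tau>"
    and L: "(\<lambda>N. \<Sum>i<N. \<Delta> N i * P (x N i)) \<longlonglongrightarrow> L"
  shows "0 < L"
proof -
  have "isCont P \<tau>" using P(1) by (simp add: continuous_on_eq_continuous_at)
  then have "\<forall>\<^sub>F t in nhds \<tau>. P \<tau> / 2 < P t"
    using order_tendstoD(1)[of P "P \<tau>" "nhds \<tau>" "P \<tau> / 2"] \<tau>(2)
    by (simp add: continuous_at tendsto_at_iff_tendsto_nhds)
  then obtain r where r: "0 < r" "\<And>t. dist t \<tau> < r \<Longrightarrow> P \<tau> / 2 < P t"
    by (auto simp: eventually_nhds_metric)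
  \<comment> \<open>Half the radius is kept for the mesh: a cell meeting (t1, t2) may have its left
    end, the tag, outside that interval.\<close>
  have "\<not> W constant_on (ball \<tau> (r / 2) \<inter> {a..b})"
    using \<tau>(1) r(1) by (auto simp: points_of_increase_def)
  then have "\<exists>p q. p \<in> ball \<tau> (r / 2) \<inter> {a..b} \<and> q \<in> ball \<tau> (r / 2) \<inter> {a..b} \<and> W p \<noteq> W q"
    unfolding constant_on_def by metis
  then obtain p q where pq: "p \<in> ball \<tau> (r / 2) \<inter> {a..b}" "q \<in> ball \<tau> (r / 2) \<inter> {a..b}" "W p \<noteq> W q"
    by blast
  have W: "W p \<le> W q" if "p \<in> {a..b}" "q \<in> {a..b}" "p \<le> q" for p q
    using W_mono that by (auto simp: mono_on_def)
  obtain t1 t2 where t: "t1 \<in> ball \<tau> (r / 2) \<inter> {a..b}" "t2 \<in> ball \<tau> (r / 2) \<inter> {a..b}" "t1 \<le> t2" "W t1 < W t2"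
  proof (cases "p \<le> q")
    case True
    then show ?thesis using that[of p q] W[of p q] pq by auto
  next
    case False
    then show ?thesis using that[of q p] W[of q p] pq by auto
  qed
  let ?cl = "\<lambda>y. W (max t1 (min t2 y))"
  have "P \<tau> / 2 * (W t2 - W t1) \<le> L"
  proof (rule tendsto_lowerbound[OF L])
    have "0 < r / 2" using r by simp
    from x_mesh[OF this] eventually_gt_at_top[of 0]
    show "\<forall>\<^sub>F N in sequentially. P \<tau> / 2 * (W t2 - W t1) \<le> (\<Sum>i<N. \<Delta> N i * P (x N i))"
    proof eventually_elim
      case (elim N)
      have "max t1 (min t2 b) = t2" "max t1 (min t2 a) = t1" using t by auto
      then have "?cl b = W t2" "?cl a = W t1" by simp_all
      then have "P \<tau> / 2 * (W t2 - W t1) = P \<tau> / 2 * (\<Sum>i<N. ?cl (x N (Suc i)) - ?cl (x N i))"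
        using x_ends[of N] elim(2) sum_lessThan_telescope[of "\<lambda>i. ?cl (x N i)" N] by simp
      also have "\<dots> \<le> (\<Sum>i<N. \<Delta> N i * P (x N i))"
        unfolding sum_distrib_left
      proof (rule sum_mono)
        fix i assume "i \<in> {..<N}"
        then have i: "i < N" by simp
        have xi: "x N i \<in> {a..b}" "x N (Suc i) \<in> {a..b}" "x N i < x N (Suc i)" "x N (Suc i) < x N i + r / 2"
        proof -
          show "x N i \<in> {a..b}" "x N (Suc i) \<in> {a..b}" using x_range i by simp_all
          show "x N i < x N (Suc i)" by (rule x_less[OF i])
          have "x N (Suc i) - x N i < r / 2" using elim(1) i by blast
          then show "x N (Suc i) < x N i + r / 2" by linarith
        qed
        show "P \<tau> / 2 * (?cl (x N (Suc i)) - ?cl (x N i)) \<le> \<Delta> N i * P (x N i)"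
        proof (cases "x N i < t2 \<and> t1 < x N (Suc i)")
          case True
          moreover have "\<tau> - r / 2 < t1" "t2 < \<tau> + r / 2"
            using t(1,2) unfolding Int_iff mem_ball dist_real_def by linarith+
          ultimately have "\<tau> - r < x N i" "x N i < \<tau> + r"
            using xi(4) r(1) by linarith+
          then have "dist (x N i) \<tau> < r"
            by (simp add: dist_real_def abs_less_iff)
          then have "P \<tau> / 2 \<le> P (x N i)" using r(2)[of "x N i"] by simp
          then have "P \<tau> / 2 * \<Delta> N i \<le> \<Delta> N i * P (x N i)"
            using \<Delta>_nonneg[OF i] by (subst mult.commute) (rule mult_left_mono)
          moreover have "P \<tau> / 2 * (?cl (x N (Suc i)) - ?cl (x N i)) \<le> P \<tau> / 2 * \<Delta> N i"
            unfolding \<Delta>_def using t xi \<tau>(2) by (intro mult_left_mono clamp_increment_le) auto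
          ultimately show ?thesis by (rule order_trans[rotated])
        next
          \<comment> \<open>A cell that misses (t1, t2) has clamped increment 0.\<close>
          case False
          then have "max t1 (min t2 (x N (Suc i))) = max t1 (min t2 (x N i))"
          proof (cases "t2 \<le> x N i")
            case True
            then have "min t2 (x N i) = t2" "min t2 (x N (Suc i)) = t2" using xi(3) by (simp_all add: min_absorb1)
            then show ?thesis by simp
          next
            case F: False
            then have "x N (Suc i) \<le> t1" using False by auto
            then have "max t1 (min t2 (x N (Suc i))) = t1" "max t1 (min t2 (x N i)) = t1"
              using xi(3) by (auto simp: max_def min_def)
            then show ?thesis by simp
          qed
          then have "?cl (x N (Suc i)) = ?cl (x N i)" by simp
          then show ?thesis using \<Delta>_nonneg[OF i] P(2) by simp
        qed
      qed
      finally show ?case .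
    qed
  qed simp
  moreover have "0 < P \<tau> / 2 * (W t2 - W t1)" using t \<tau>(2) by simp
  ultimately show ?thesis by linarith
qed

lemma V_pos: "0 < V"
proof -
  obtain S where S: "S \<subseteq> points_of_increase W a b" "card S = M + 1"
    using increase by blast
  then have "S \<noteq> {}" by auto
  then obtain \<tau> where \<tau>: "\<tau> \<in> points_of_increase W a b"
    using S(1) by blast
  show ?thesis
    by (rule positive_on_increase[OF _ _ \<tau>, of "\<lambda>_. 1"]) (use lim_V in simp_all)
qed

text \<open>Evaluating at the integers, vanishing of the error would give
  \<open>\<integral> P (e\<^sup>-\<^sup>t) dW = 0\<close> for the square \<open>P\<close> of the polynomial whose roots are the numbers
  \<open>exp (- b \<phi> (u \<nu>))\<close>.\<close>

lemma err_nonzero: "\<exists>t\<ge>0. err t \<noteq> 0"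
proof (rule ccontr)
  assume "\<not> ?thesis"
  then have z: "err (real k) = 0" for k by (metis of_nat_0_le_iff)
  define l where "l \<nu> = b * \<phi> (u \<nu>)" for \<nu>
  have fk: "f (of_real (real k)) = of_real (\<Sum>\<nu>=1..M. c \<nu> * exp (- l \<nu>) ^ k)" for k
    using z[of k] by (simp add: err_def l_def exp_of_nat_mult[symmetric] mult_ac)
  define P where "P = (\<Prod>\<nu>=1..M. [:- exp (- l \<nu>), 1:] ^ 2)"
  have P: "poly P y = (\<Prod>\<nu>=1..M. (y - exp (- l \<nu>))\<^sup>2)" for y
    by (simp add: P_def poly_prod)
  obtain S where S: "S \<subseteq> points_of_increase W a b" "finite S" "card S = M + 1"
    using increase by blast
  \<comment> \<open>Pigeonhole: M + 1 points of increase cannot all be among the at most M zeros of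
    \<open>poly P (exp (- t))\<close>.\<close>
  have "card (l ` {1..M}) \<le> M" using card_image_le[of "{1..M}" l] by simp
  then have "\<not> S \<subseteq> l ` {1..M}" using S card_mono[of "l ` {1..M}" S] by auto
  then obtain \<tau> where \<tau>: "\<tau> \<in> points_of_increase W a b" "\<tau> \<notin> l ` {1..M}" using S by blast
  have lim: "(\<lambda>N. \<Sum>k\<le>degree P. coeff P k * (\<Sum>i<N. \<Delta> N i * exp (- real k * x N i)))
      \<longlonglongrightarrow> (\<Sum>k\<le>degree P. coeff P k * (\<Sum>\<nu>=1..M. c \<nu> * exp (- l \<nu>) ^ k))"
  proof (intro tendsto_sum tendsto_mult tendsto_const)
    fix k
    show "(\<lambda>N. \<Sum>i<N. \<Delta> N i * exp (- real k * x N i)) \<longlonglongrightarrow> (\<Sum>\<nu>=1..M. c \<nu> * exp (- l \<nu>) ^ k)"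
      using tendsto_Re[OF lim_f_real[of "real k"]] unfolding fk by (simp del: of_real_of_nat_eq)
  qed
  have "(\<Sum>k\<le>degree P. coeff P k * (\<Sum>\<nu>=1..M. c \<nu> * exp (- l \<nu>) ^ k))
      = (\<Sum>\<nu>=1..M. c \<nu> * poly P (exp (- l \<nu>)))"
    unfolding poly_altdef sum_distrib_left by (subst sum.swap) (simp add: mult_ac)
  also have "\<dots> = 0" by (rule sum.neutral) (auto simp: P)
  finally have R: "(\<Sum>k\<le>degree P. coeff P k * (\<Sum>\<nu>=1..M. c \<nu> * exp (- l \<nu>) ^ k)) = 0" .
  have "(\<Sum>k\<le>degree P. coeff P k * (\<Sum>i<N. \<Delta> N i * exp (- real k * x N i)))
      = (\<Sum>i<N. \<Delta> N i * poly P (exp (- x N i)))" for N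
    unfolding poly_altdef sum_distrib_left
    by (subst sum.swap) (simp add: mult_ac exp_of_nat_mult[symmetric])
  with lim R have L: "(\<lambda>N. \<Sum>i<N. \<Delta> N i * poly P (exp (- x N i))) \<longlonglongrightarrow> 0" by simp
  have "(0 :: real) < 0"
  proof (rule positive_on_increase[of "\<lambda>t. poly P (exp (- t))" \<tau>])
    show "0 \<le> poly P (exp (- t))" for t by (auto simp: P intro: prod_nonneg)
    show "0 < poly P (exp (- \<tau>))"
      unfolding P using \<tau>(2) by (intro prod_pos) (auto simp: image_iff)
  qed (use \<tau> L in \<open>auto intro!: continuous_intros\<close>)
  then show False by simp
qed

section \<open>Existence of the maximal error\<close>

lemma err_0: "err 0 = 0"
  using f_0 sum_c by (simp add: err_def)

lemma err_continuous: "continuous_on {0..} err"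
proof -
  have "continuous_on {0..} (\<lambda>t. f (of_real t))"
  proof (rule continuous_onI)
    fix t e :: real assume t: "t \<in> {0..}" and e: "0 < e"
    have bV: "0 < b * V" using b_pos V_pos by simp
    show "\<exists>d>0. \<forall>t'\<in>{0..}. dist t' t < d \<longrightarrow> dist (f (of_real t')) (f (of_real t)) \<le> e"
    proof (intro exI[of _ "e / (b * V)"] conjI ballI impI)
      fix t' assume t': "t' \<in> {0..}" "dist t' t < e / (b * V)"
      have "dist (f (of_real t')) (f (of_real t)) \<le> (b * V) * \<bar>t' - t\<bar>"
        using f_Lipschitz[of t' t] t t' by (simp add: dist_norm mult_ac)
      also have "\<dots> \<le> (b * V) * (e / (b * V))"
        using t'(2) bV by (intro mult_left_mono) (auto simp: dist_real_def)
      also have "\<dots> = e" using less_imp_neq[OF bV] by (metis nonzero_mult_div_cancel_left times_divide_eq_right)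
      finally show "dist (f (of_real t')) (f (of_real t)) \<le> e" .
    qed (use e bV in auto)
  qed
  then show ?thesis unfolding err_def[abs_def] by (intro continuous_intros)
qed

lemma err_tendsto_0: "(err \<longlongrightarrow> 0) at_top"
proof -
  have "((\<lambda>t. f (of_real t)) \<longlongrightarrow> 0) at_top"
  proof (rule Lim_null_comparison)
    show "\<forall>\<^sub>F t in at_top. norm (f (complex_of_real t)) \<le> exp (- t * a) * V"
      using eventually_ge_at_top[of 0] by eventually_elim (rule f_decay)
    show "((\<lambda>t. exp (- t * a) * V) \<longlongrightarrow> 0) at_top"
      using tendsto_mult_left_zero[OF exp_decay[OF a_pos], of V] by (simp add: mult.commute)
  qed
  moreover have "((\<lambda>t. \<Sum>\<nu>=1..M. c \<nu> * exp (- b * \<phi> (u \<nu>) * t)) \<longlongrightarrow> (\<Sum>\<nu>=1..M. c \<nu> * 0)) at_top"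
  proof (intro tendsto_sum tendsto_mult tendsto_const)
    fix \<nu> assume v: "\<nu> \<in> {1..M}"
    have "\<phi> (- 1) \<le> \<phi> (u \<nu>)"
      using strict_mono_on_leD[OF \<phi>_props(2), of "- 1" "u \<nu>"] u_range(1)[OF v] by auto
    moreover have "0 < \<phi> (- 1)" using a_pos b_pos by (simp add: \<phi>_props)
    ultimately have "0 < b * \<phi> (u \<nu>)" using b_pos by simp
    from exp_decay[OF this] have "((\<lambda>t. exp (- (b * \<phi> (u \<nu>)) * t)) \<longlongrightarrow> 0) at_top" .
    then show "((\<lambda>t. exp (- b * \<phi> (u \<nu>) * t)) \<longlongrightarrow> 0) at_top" by simp
  qed
  ultimately have "((\<lambda>t. cmod (f (of_real t) - of_real (\<Sum>\<nu>=1..M. c \<nu> * exp (- b * \<phi> (u \<nu>) * t))))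
      \<longlongrightarrow> cmod (0 - of_real (\<Sum>\<nu>=1..M. c \<nu> * 0))) at_top"
    by (intro tendsto_norm tendsto_diff tendsto_of_real)
  then show ?thesis by (simp add: err_def[abs_def])
qed

text \<open>The error is continuous, tends to 0 and is not identically 0. It vanishes at 0, so the
  maximum sits at a positive point, where the pointwise bounds apply.\<close>

lemma err_attains_max: "\<exists>t>0. (\<forall>t'\<ge>0. err t' \<le> err t) \<and> 0 < err t"
proof -
  obtain t1 where t1: "0 \<le> t1" "err t1 \<noteq> 0" using err_nonzero by blast
  then have p1: "0 < err t1" by (simp add: err_def)
  have "\<forall>\<^sub>F t in at_top. err t < err t1"
    using order_tendstoD(2)[OF err_tendsto_0 p1] .
  then obtain B where B: "\<And>t. B \<le> t \<Longrightarrow> err t < err t1"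
    by (auto simp: eventually_at_top_linorder)
  let ?B = "max B t1"
  have "\<exists>t\<in>{0..?B}. \<forall>t'\<in>{0..?B}. err t' \<le> err t"
    using t1 by (intro continuous_attains_sup continuous_on_subset[OF err_continuous]) auto
  then obtain t where t: "t \<in> {0..?B}" "\<And>t'. t' \<in> {0..?B} \<Longrightarrow> err t' \<le> err t" by blast
  have le: "err t1 \<le> err t" using t(2)[of t1] t1 by simp
  have "err t' \<le> err t" if "0 \<le> t'" for t'
    using t(2)[of t'] B[of t'] le that by (cases "t' \<le> ?B") (auto simp: not_le)
  moreover have "0 < err t" using le p1 by simp
  moreover have "t \<noteq> 0" using \<open>0 < err t\<close> err_0 by auto
  ultimately show ?thesis using t(1) by (intro exI[of _ t]) auto
qed

end

section \<open>Infima of the real part over ellipses\<close>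

text \<open>Periodicity replaces a growth condition: the minimum of Re G minus the linear function
  is attained on a compact rectangle of one period. If negative, it would be interior in Re
  \<sigma>, and the maximum modulus principle would spread it to the left edge.\<close>

lemma three_lines_periodic:
  fixes G :: "complex \<Rightarrow> complex"
  assumes hol: "G holomorphic_on {\<sigma>. \<alpha> < Re \<sigma> \<and> Re \<sigma> < \<beta>}"
    and per: "\<And>\<sigma>. G (\<sigma> + 2 * pi * \<i>) = G \<sigma>"
    and s: "\<alpha> < s1" "s1 < s2" "s2 < \<beta>"
    and left: "\<And>t. p + k * s1 \<le> Re (G (Complex s1 t))"
    and right: "\<And>t. p + k * s2 \<le> Re (G (Complex s2 t))"
    and st: "s1 \<le> s" "s \<le> s2" "\<bar>t\<bar> \<le> pi"
  shows "p + k * s \<le> Re (G (Complex s t))"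
proof -
  let ?S = "{\<sigma>. \<alpha> < Re \<sigma> \<and> Re \<sigma> < \<beta>}"
  define N where "N \<sigma> = Re (G \<sigma>) - (p + k * Re \<sigma>)" for \<sigma>
  have Ncont: "continuous_on ?S N"
    unfolding N_def by (intro continuous_intros holomorphic_on_imp_continuous_on[OF hol])
  have "cbox (Complex s1 (- pi)) (Complex s2 pi) \<subseteq> ?S"
    using s by (auto simp: in_cbox_complex_iff)
  moreover have "Complex s t \<in> cbox (Complex s1 (- pi)) (Complex s2 pi)"
    using st by (simp add: in_cbox_complex_iff abs_le_iff)
  then have "cbox (Complex s1 (- pi)) (Complex s2 pi) \<noteq> {}" by auto
  ultimately obtain \<xi> where \<xi>: "\<xi> \<in> cbox (Complex s1 (- pi)) (Complex s2 pi)"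
    "\<And>\<sigma>. \<sigma> \<in> cbox (Complex s1 (- pi)) (Complex s2 pi) \<Longrightarrow> N \<xi> \<le> N \<sigma>"
    using continuous_attains_inf[OF compact_cbox _ continuous_on_subset[OF Ncont]] by blast
  have \<xi>': "s1 \<le> Re \<xi>" "Re \<xi> \<le> s2" "- pi \<le> Im \<xi>" "Im \<xi> \<le> pi"
    using \<xi>(1) by (auto simp: in_cbox_complex_iff)
  have "0 \<le> N \<xi>"
  proof (rule ccontr)
    assume neg: "\<not> 0 \<le> N \<xi>"
    have "0 \<le> N (Complex s1 t)" "0 \<le> N (Complex s2 t)" for t
      using left[of t] right[of t] by (simp_all add: N_def)
    then have "Re \<xi> \<noteq> s1" "Re \<xi> \<noteq> s2"
      using neg complex_surj[of \<xi>] by metis+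
    then have inside: "s1 < Re \<xi>" "Re \<xi> < s2" using \<xi>' by auto
    \<comment> \<open>The minimum may sit on Im = pi or Im = -pi; the taller rectangle makes it
      interior, and periodicity keeps it a minimum.\<close>
    define U where "U = {\<sigma>. s1 < Re \<sigma> \<and> Re \<sigma> < s2} \<inter> {\<sigma>. - 2 * pi < Im \<sigma> \<and> Im \<sigma> < 2 * pi}"
    have U: "U = {\<sigma>. s1 < Re \<sigma>} \<inter> {\<sigma>. Re \<sigma> < s2} \<inter> ({\<sigma>. - 2 * pi < Im \<sigma>} \<inter> {\<sigma>. Im \<sigma> < 2 * pi})"
      by (auto simp: U_def)
    have opU: "open U" unfolding U
      by (intro open_Int open_halfspace_Re_gt open_halfspace_Re_lt open_halfspace_Im_gt open_halfspace_Im_lt)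
    have cvU: "convex U" unfolding U
      by (intro convex_Int convex_halfspace_Re_gt convex_halfspace_Re_lt convex_halfspace_Im_gt convex_halfspace_Im_lt)
    have US: "U \<subseteq> ?S" using s by (auto simp: U_def)
    have "- 2 * pi < Im \<xi>" "Im \<xi> < 2 * pi" using \<xi>' pi_gt_zero by linarith+
    then have \<xi>U: "\<xi> \<in> U" using inside by (simp add: U_def)
    have Nper: "N (\<sigma> + 2 * pi * \<i>) = N \<sigma>" for \<sigma>
      unfolding N_def by (simp only: per) simp
    have min: "N \<xi> \<le> N \<sigma>" if "\<sigma> \<in> U" for \<sigma>
    proof -
      consider "\<bar>Im \<sigma>\<bar> \<le> pi" | "Im \<sigma> < - pi" | "pi < Im \<sigma>" by linarith
      then show ?thesis
      proof cases
        case 1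
        then show ?thesis using that by (intro \<xi>(2)) (auto simp: U_def in_cbox_complex_iff)
      next
        case 2
        then have "N \<xi> \<le> N (\<sigma> + 2 * pi * \<i>)"
          using that by (intro \<xi>(2)) (auto simp: U_def in_cbox_complex_iff)
        then show ?thesis by (simp only: Nper)
      next
        case 3
        then have "N \<xi> \<le> N (\<sigma> - 2 * pi * \<i>)"
          using that by (intro \<xi>(2)) (auto simp: U_def in_cbox_complex_iff)
        also have "N (\<sigma> - 2 * pi * \<i>) = N \<sigma>" using Nper[of "\<sigma> - 2 * pi * \<i>"] by simp
        finally show ?thesis .
      qed
    qed
    \<comment> \<open>\<open>E\<close> itself need not be periodic, but its modulus exp (-N)
      is.\<close>
    define E where "E \<sigma> = exp (- (G \<sigma> - (of_real p + of_real k * \<sigma>)))" for \<sigma>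
    have normE: "cmod (E \<sigma>) = exp (- N \<sigma>)" for \<sigma> by (simp add: E_def N_def)
    have "E holomorphic_on U"
      unfolding E_def by (intro holomorphic_intros holomorphic_on_subset[OF hol US])
    then have "E constant_on U"
      using min \<xi>U by (intro maximum_modulus_principle[OF _ opU convex_connected[OF cvU] opU subset_refl \<xi>U])
        (auto simp: normE)
    then obtain e where "\<And>\<sigma>. \<sigma> \<in> U \<Longrightarrow> E \<sigma> = e" by (auto simp: constant_on_def)
    then have const: "N \<sigma> = N \<xi>" if "\<sigma> \<in> U" for \<sigma>
      using normE[of \<sigma>] normE[of \<xi>] that \<xi>U by (metis exp_inj_iff neg_equal_iff_equal)
    \<comment> \<open>N is constant on the open set \<open>U\<close> only; continuity carries its
      negative value to the edge Re = s1, where N is nonnegative.\<close>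
    have "continuous_on {s1..Re \<xi>} (\<lambda>s. N (Complex s (Im \<xi>)))"
    proof (rule continuous_on_compose2[OF Ncont])
      show "continuous_on {s1..Re \<xi>} (\<lambda>s. Complex s (Im \<xi>))"
        unfolding Complex_eq by (intro continuous_intros)
      show "(\<lambda>s. Complex s (Im \<xi>)) ` {s1..Re \<xi>} \<subseteq> ?S"
        using s inside by auto
    qed
    then have "((\<lambda>s. N (Complex s (Im \<xi>))) \<longlongrightarrow> N (Complex s1 (Im \<xi>))) (at s1 within {s1..Re \<xi>})"
      using inside by (auto simp: continuous_on_def)
    then have "((\<lambda>s. N (Complex s (Im \<xi>))) \<longlongrightarrow> N (Complex s1 (Im \<xi>))) (at_right s1)"
      using inside at_within_Icc_at_right[of s1 "Re \<xi>"] by simp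
    moreover have "\<forall>\<^sub>F s in at_right s1. N (Complex s (Im \<xi>)) = N \<xi>"
      using eventually_at_right_real[OF inside(1)]
    proof eventually_elim
      case (elim s)
      show ?case by (rule const) (use elim inside \<xi>U in \<open>auto simp: U_def\<close>)
    qed
    then have "((\<lambda>s. N (Complex s (Im \<xi>))) \<longlongrightarrow> N \<xi>) (at_right s1)"
      by (rule tendsto_eventually)
    ultimately have "N (Complex s1 (Im \<xi>)) = N \<xi>"
      by (intro tendsto_unique) auto
    then show False using neg left[of "Im \<xi>"] by (simp add: N_def)
  qed
  also have "N \<xi> \<le> N (Complex s t)"
    using st by (intro \<xi>(2)) (auto simp: in_cbox_complex_iff)
  finally show ?thesis by (simp add: N_def)
qed

locale continuation_setting =
  fixes r :: real and \<phi> :: "real \<Rightarrow> real"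
  assumes r_pos: "0 < r" and r_less_1: "r < 1" and F: "\<phi> \<in> F_class r" and R_gt_1: "1 < rho_A \<phi>"
begin

abbreviation "R \<equiv> rho_A \<phi>"
abbreviation "g \<equiv> continuation \<phi>"

lemma g_holomorphic: "g holomorphic_on bernstein_ellipse R"
  and g_of_real: "x \<in> {-1..1} \<Longrightarrow> g (of_real x) = of_real (\<phi> x)"
  using analytic_extension_continuation[OF R_gt_1] by (auto simp: analytic_extension_def)

lemma \<phi>_ends: "\<phi> (-1) = r" "\<phi> 1 = 1"
  using F by (auto simp: F_class_def)

lemma \<phi>_ge: "x \<in> {-1..1} \<Longrightarrow> r \<le> \<phi> x"
  using F strict_mono_on_leD[of "{-1..1}" \<phi> "-1" x] by (auto simp: F_class_def)

text \<open>Lower bounds of \<open>Re g\<close> are upper bounds of the modulus of exp (-g). The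
  maximum modulus principle and Liouville's theorem then give contradictions because \<phi> takes
  the distinct values r and 1 at the ends.\<close>

lemma exp_minus_g_not_constant:
  assumes "1 < \<rho>"
  shows "\<not> (\<lambda>z. exp (- g z)) constant_on bernstein_ellipse \<rho>"
proof
  assume "(\<lambda>z. exp (- g z)) constant_on bernstein_ellipse \<rho>"
  then obtain e where e: "\<And>z. z \<in> bernstein_ellipse \<rho> \<Longrightarrow> exp (- g z) = e"
    by (auto simp: constant_on_def)
  have in_E: "complex_of_real (-1) \<in> bernstein_ellipse \<rho>" "complex_of_real 1 \<in> bernstein_ellipse \<rho>"
    by (rule of_real_in_bernstein_ellipse[OF _ assms], simp)+
  have "exp (- g (of_real (-1))) = exp (- g (of_real 1))"
    using e in_E by metis
  then have "cmod (exp (- g (of_real (-1)))) = cmod (exp (- g (of_real 1)))" by simp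
  moreover have "g (of_real (-1)) = of_real r" "g (of_real 1) = of_real 1"
    using g_of_real[of "-1"] g_of_real[of 1] \<phi>_ends by simp_all
  ultimately show False using r_less_1 by simp
qed

text \<open>The minimum of \<open>Re g\<close> over the compact closure of the smaller ellipse is
  taken inside the larger one; if it equalled c, exp (-g) would attain its maximum modulus
  there.\<close>

lemma Re_g_strict_lower_bound:
  assumes \<rho>: "1 < \<rho>" "ereal \<rho> < \<rho>'" "\<rho>' \<le> R"
    and c: "\<And>z. z \<in> bernstein_ellipse \<rho>' \<Longrightarrow> c \<le> Re (g z)"
  shows "\<exists>d>c. \<forall>z\<in>bernstein_ellipse \<rho>. d \<le> Re (g z)"
proof -
  let ?K = "closure (bernstein_ellipse (ereal \<rho>))"
  have \<rho>': "1 < \<rho>'" using \<rho>(1,2) by (metis ereal_less(3) less_trans one_ereal_def less_ereal.simps(1))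
  have sub: "?K \<subseteq> bernstein_ellipse \<rho>'" by (rule closure_bernstein_ellipse_subset[OF \<rho>(1,2)])
  have hol: "g holomorphic_on bernstein_ellipse \<rho>'"
    using g_holomorphic bernstein_ellipse_mono[OF \<rho>' \<rho>(3)] by (rule holomorphic_on_subset)
  have "continuous_on ?K (\<lambda>z. Re (g z))"
    using continuous_on_subset[OF holomorphic_on_imp_continuous_on[OF hol] sub] by (intro continuous_intros)
  moreover have "?K \<noteq> {}"
    using of_real_in_bernstein_ellipse[of 0 "ereal \<rho>"] \<rho>(1) closure_subset by (auto simp: one_ereal_def)
  ultimately obtain z0 where z0: "z0 \<in> ?K" "\<And>z. z \<in> ?K \<Longrightarrow> Re (g z0) \<le> Re (g z)"
    using continuous_attains_inf[OF compact_closure_bernstein_ellipse[OF \<rho>(1)]] by blast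
  have "Re (g z0) \<noteq> c"
  proof
    assume eq: "Re (g z0) = c"
    have "(\<lambda>z. exp (- g z)) constant_on bernstein_ellipse \<rho>'"
    proof (rule maximum_modulus_principle[OF _ open_bernstein_ellipse _ open_bernstein_ellipse subset_refl])
      show "(\<lambda>z. exp (- g z)) holomorphic_on bernstein_ellipse \<rho>'" by (intro holomorphic_intros hol)
      show "connected (bernstein_ellipse \<rho>')" by (rule convex_connected[OF convex_bernstein_ellipse])
      show "z0 \<in> bernstein_ellipse \<rho>'" using z0(1) sub by blast
    qed (use c eq in auto)
    then show False using exp_minus_g_not_constant[OF \<rho>'] by blast
  qed
  moreover have "c \<le> Re (g z0)" using c sub z0(1) by blast
  ultimately have "c < Re (g z0)" by simp
  then show ?thesis using z0(2) closure_subset by blast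
qed

section \<open>The infimum as a function of the ellipse parameter\<close>

lemma inf_Re_le: "z \<in> bernstein_ellipse \<rho> \<Longrightarrow> inf_Re \<phi> \<rho> \<le> ereal (Re (g z))"
  unfolding inf_Re_def by (rule INF_lower)

lemma le_inf_Re_iff: "ereal c \<le> inf_Re \<phi> \<rho> \<longleftrightarrow> (\<forall>z\<in>bernstein_ellipse \<rho>. c \<le> Re (g z))"
  unfolding inf_Re_def by (simp add: le_INF_iff)

lemma inf_Re_antimono: "1 < \<rho> \<Longrightarrow> \<rho> \<le> \<rho>' \<Longrightarrow> inf_Re \<phi> \<rho>' \<le> inf_Re \<phi> \<rho>"
  unfolding inf_Re_def by (rule INF_superset_mono[OF bernstein_ellipse_mono]) auto

lemma inf_Re_le_r: "1 < \<rho> \<Longrightarrow> inf_Re \<phi> \<rho> \<le> ereal r"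
  using inf_Re_le[OF of_real_in_bernstein_ellipse[of "-1" \<rho>]] g_of_real[of "-1"] \<phi>_ends by simp

text \<open>\<open>real_of_ereal\<close> sends infinite values to 0, so its use on the infimum has
  to be justified by finiteness; from above this is the value r at -1.\<close>

lemma inf_Re_real:
  assumes "1 < \<rho>" "inf_Re \<phi> \<rho> \<noteq> -\<infinity>"
  shows "ereal (real_of_ereal (inf_Re \<phi> \<rho>)) = inf_Re \<phi> \<rho>"
  using assms(2) inf_Re_le_r[OF assms(1)] by (cases "inf_Re \<phi> \<rho>") auto

lemma inf_Re_finite:
  assumes "1 < \<rho>" "ereal \<rho> < R"
  shows "inf_Re \<phi> \<rho> \<noteq> -\<infinity>"
proof -
  let ?K = "closure (bernstein_ellipse (ereal \<rho>))"
  have sub: "?K \<subseteq> bernstein_ellipse R" by (rule closure_bernstein_ellipse_subset[OF assms])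
  have "continuous_on ?K (\<lambda>z. Re (g z))"
    using continuous_on_subset[OF holomorphic_on_imp_continuous_on[OF g_holomorphic] sub]
    by (intro continuous_intros)
  then have "bounded ((\<lambda>z. Re (g z)) ` ?K)"
    using compact_closure_bernstein_ellipse[OF assms(1)] compact_continuous_image compact_imp_bounded by blast
  then obtain B where "\<And>z. z \<in> ?K \<Longrightarrow> \<bar>Re (g z)\<bar> \<le> B"
    by (auto simp: bounded_iff)
  then have "ereal (- B) \<le> inf_Re \<phi> \<rho>"
    unfolding le_inf_Re_iff using closure_subset by (force simp: abs_le_iff)
  then show ?thesis by auto
qed

text \<open>With an infinite radius exp (-g) would be a bounded entire function.\<close>

lemma R_finite:
  assumes "inf_Re \<phi> R \<noteq> -\<infinity>"
  obtains \<rho> where "R = ereal \<rho>" "1 < \<rho>"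
proof -
  have "R \<noteq> \<infinity>"
  proof
    assume inf: "R = \<infinity>"
    define c where "c = real_of_ereal (inf_Re \<phi> R)"
    have "ereal c \<le> inf_Re \<phi> R"
      using inf_Re_real[OF R_gt_1 assms] by (simp add: c_def)
    then have c: "c \<le> Re (g z)" for z
      unfolding le_inf_Re_iff inf bernstein_ellipse_infinity by simp
    have "(\<lambda>z. exp (- g z)) holomorphic_on UNIV"
      using g_holomorphic unfolding inf bernstein_ellipse_infinity by (intro holomorphic_intros)
    moreover have "bounded (range (\<lambda>z. exp (- g z)))"
      unfolding bounded_iff by (rule exI[of _ "exp (- c)"]) (use c in auto)
    ultimately have "(\<lambda>z. exp (- g z)) constant_on UNIV"
      by (rule Liouville_theorem)
    then show False
      using exp_minus_g_not_constant[of \<infinity>] unfolding bernstein_ellipse_infinity by simp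
  qed
  then show ?thesis using that R_gt_1 by (cases R) (auto simp: one_ereal_def)
qed

lemma I_setD:
  assumes "\<rho> \<in> I_set \<phi>"
  shows "1 < \<rho>" "ereal \<rho> \<le> R" "ereal (real_of_ereal (inf_Re \<phi> \<rho>)) = inf_Re \<phi> \<rho>"
proof -
  show 1: "1 < \<rho>" "ereal \<rho> \<le> R" using assms by (auto simp: I_set_def split: if_splits)
  have "inf_Re \<phi> \<rho> \<noteq> -\<infinity>"
  proof (cases "ereal \<rho> < R")
    case True
    then show ?thesis using inf_Re_finite[OF 1(1)] by simp
  next
    case False
    then have "ereal \<rho> = R" using 1 by simp
    then show ?thesis using assms by (auto simp: I_set_def split: if_splits)
  qed
  then show "ereal (real_of_ereal (inf_Re \<phi> \<rho>)) = inf_Re \<phi> \<rho>"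
    using 1(1) by (intro inf_Re_real) (auto simp: one_ereal_def)
qed

lemma I_setI: "1 < \<rho> \<Longrightarrow> ereal \<rho> < R \<Longrightarrow> \<rho> \<in> I_set \<phi>"
  by (auto simp: I_set_def)

text \<open>The case \<rho> = 1 starts from the segment, where \<phi> is at least r > 0, and
  provides a first ellipse; the other case enlarges an ellipse on whose closure \<open>Re g\<close>
  is positive.\<close>

lemma ex_nonneg_ellipse:
  assumes "ereal \<rho> < R" "1 < \<rho> \<and> (\<forall>z\<in>closure (bernstein_ellipse (ereal \<rho>)). 0 < Re (g z)) \<or> \<rho> = 1"
  shows "\<exists>\<rho>'>\<rho>. ereal \<rho>' < R \<and> (\<forall>z\<in>bernstein_ellipse \<rho>'. 0 \<le> Re (g z))"
proof -
  define U where "U = bernstein_ellipse R \<inter> (\<lambda>z. Re (g z)) -` {0<..}"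
  have "open U"
    unfolding U_def
    by (intro continuous_open_preimage open_bernstein_ellipse open_greaterThan continuous_intros
        holomorphic_on_imp_continuous_on[OF g_holomorphic])
  moreover have "complex_of_real x \<in> U" if "x \<in> {-1..1}" for x
    using of_real_in_bernstein_ellipse[OF that R_gt_1] g_of_real[OF that] \<phi>_ge[OF that] r_pos
    by (simp add: U_def)
  moreover have "closure (bernstein_ellipse (ereal \<rho>)) \<subseteq> U" if "1 < \<rho>"
    using closure_bernstein_ellipse_subset[OF that assms(1)] assms(2) that by (auto simp: U_def)
  ultimately obtain \<rho>1 where \<rho>1: "\<rho> < \<rho>1" "bernstein_ellipse (ereal \<rho>1) \<subseteq> U"
    using bernstein_ellipse_subset_nbhd[of \<rho> U] bernstein_ellipse_subset_nbhd_segment[of U] assms(2)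
    by (metis image_subsetI)
  obtain \<rho>2 where \<rho>2: "ereal \<rho> < ereal \<rho>2" "ereal \<rho>2 < R" using ereal_dense2[OF assms(1)] by blast
  let ?m = "min \<rho>1 \<rho>2"
  have m: "\<rho> < ?m" "?m \<le> \<rho>1" "?m \<le> \<rho>2" using \<rho>1 \<rho>2 by auto
  have "1 < ?m" using m(1) assms(2) by auto
  then have "bernstein_ellipse (ereal ?m) \<subseteq> U"
    using bernstein_ellipse_mono[of "ereal ?m" "ereal \<rho>1"] m(2) \<rho>1(2) by (auto simp: one_ereal_def)
  moreover have "ereal ?m < R" using m(3) \<rho>2(2) by (meson ereal_less_eq(3) le_less_trans)
  ultimately show ?thesis using m(1) by (intro exI[of _ ?m]) (auto simp: U_def)
qed

text \<open>The zero is the supremum of the parameters with nonnegative \<open>Re g\<close>. At the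
  supremum the infimum is nonnegative by exhaustion, and were it positive the ellipse could be
  enlarged. Two zeros would contradict \<open>Re_g_strict_lower_bound\<close>.\<close>

lemma ex1_rho_0:
  assumes "inf_Re \<phi> R < 0"
  shows "\<exists>!\<rho>. 1 < \<rho> \<and> ereal \<rho> < R \<and> inf_Re \<phi> \<rho> = 0"
proof (rule ex_ex1I)
  obtain z where z: "z \<in> bernstein_ellipse R" "Re (g z) < 0"
    using assms unfolding inf_Re_def INF_less_iff by auto
  obtain \<rho>1 where \<rho>1: "1 < \<rho>1" "ereal \<rho>1 < R" "z \<in> bernstein_ellipse (ereal \<rho>1)"
    using bernstein_ellipse_exhaust[OF z(1) R_gt_1] by blast
  define A where "A = {\<rho>. 1 < \<rho> \<and> ereal \<rho> < R \<and> (\<forall>z\<in>bernstein_ellipse \<rho>. 0 \<le> Re (g z))}"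
  have le: "\<rho> \<le> \<rho>1" if "\<rho> \<in> A" for \<rho>
  proof (rule ccontr)
    assume "\<not> \<rho> \<le> \<rho>1"
    then have "z \<in> bernstein_ellipse \<rho>"
      using bernstein_ellipse_mono[of "ereal \<rho>1" "ereal \<rho>"] \<rho>1 by (auto simp: one_ereal_def)
    then show False using that z(2) by (auto simp: A_def)
  qed
  then have bdd: "bdd_above A" by (auto simp: bdd_above_def)
  have "ereal 1 < R" using R_gt_1 by (simp add: one_ereal_def)
  from ex_nonneg_ellipse[OF this] obtain \<rho>2 where \<rho>2: "\<rho>2 \<in> A" by (auto simp: A_def)
  define \<rho>0 where "\<rho>0 = Sup A"
  have \<rho>0: "1 < \<rho>0" "\<rho>0 \<le> \<rho>1"
  proof -
    have "\<rho>2 \<le> \<rho>0" unfolding \<rho>0_def by (rule cSup_upper[OF \<rho>2 bdd])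
    then show "1 < \<rho>0" using \<rho>2 by (auto simp: A_def)
    show "\<rho>0 \<le> \<rho>1" unfolding \<rho>0_def by (rule cSup_least) (use \<rho>2 le in auto)
  qed
  have \<rho>0R: "ereal \<rho>0 < R" using \<rho>0(2) \<rho>1(2) by (meson ereal_less_eq(3) le_less_trans)
  have nonneg: "0 \<le> Re (g z)" if z: "z \<in> bernstein_ellipse \<rho>0" for z
  proof -
    obtain \<rho> where \<rho>: "1 < \<rho>" "ereal \<rho> < ereal \<rho>0" "z \<in> bernstein_ellipse (ereal \<rho>)"
      by (rule bernstein_ellipse_exhaust[OF z]) (use \<rho>0(1) in \<open>auto simp: one_ereal_def\<close>)
    then obtain \<rho>' where "\<rho>' \<in> A" "\<rho> < \<rho>'"
      using less_cSup_iff[OF _ bdd] \<rho>2 unfolding \<rho>0_def by auto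
    then show ?thesis
      using bernstein_ellipse_mono[of "ereal \<rho>" "ereal \<rho>'"] \<rho> by (auto simp: A_def one_ereal_def)
  qed
  have "inf_Re \<phi> \<rho>0 \<le> 0"
  proof (rule ccontr)
    assume "\<not> ?thesis"
    then have "0 < inf_Re \<phi> \<rho>0" by simp
    \<comment> \<open>A positive lower bound passes to the closure; mere positivity would
      not.\<close>
    then obtain d where d: "0 < ereal d" "ereal d < inf_Re \<phi> \<rho>0" using ereal_dense2 by blast
    have dle: "bernstein_ellipse \<rho>0 \<subseteq> {z. d \<le> Re (g z)}"
      using less_imp_le[OF d(2)] unfolding le_inf_Re_iff by auto
    have cont: "continuous_on (closure (bernstein_ellipse \<rho>0)) (\<lambda>z. Re (g z))"
      using closure_bernstein_ellipse_subset[OF \<rho>0(1) \<rho>0R] holomorphic_on_imp_continuous_on[OF g_holomorphic]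
      by (intro continuous_intros) (rule continuous_on_subset)
    have "d \<le> Re (g z)" if "z \<in> closure (bernstein_ellipse \<rho>0)" for z
      by (rule continuous_ge_on_closure[OF cont that]) (use dle in auto)
    then have "0 < Re (g z)" if "z \<in> closure (bernstein_ellipse \<rho>0)" for z
      using that d(1) by fastforce
    then obtain \<rho>' where "\<rho>' > \<rho>0" "\<rho>' \<in> A"
      using ex_nonneg_ellipse[OF \<rho>0R] \<rho>0(1) by (auto simp: A_def)
    then show False using cSup_upper[OF _ bdd, of \<rho>'] by (simp add: \<rho>0_def)
  qed
  moreover have "0 \<le> inf_Re \<phi> \<rho>0"
    using le_inf_Re_iff[of 0 "ereal \<rho>0"] nonneg by (simp add: zero_ereal_def)
  ultimately show "\<exists>\<rho>. 1 < \<rho> \<and> ereal \<rho> < R \<and> inf_Re \<phi> \<rho> = 0"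
    using \<rho>0 \<rho>0R by (intro exI[of _ \<rho>0]) auto
next
  have False if \<rho>: "1 < \<rho>" "ereal \<rho> < ereal \<rho>'" "ereal \<rho>' < R" "inf_Re \<phi> \<rho> = 0" "inf_Re \<phi> \<rho>' = 0" for \<rho> \<rho>'
  proof -
    have "\<And>z. z \<in> bernstein_ellipse \<rho>' \<Longrightarrow> 0 \<le> Re (g z)"
      using le_inf_Re_iff[of 0 \<rho>'] that by (simp add: zero_ereal_def)
    then obtain d where "d > 0" "\<forall>z\<in>bernstein_ellipse \<rho>. d \<le> Re (g z)"
      using Re_g_strict_lower_bound[of \<rho> "ereal \<rho>'" 0] \<rho> less_imp_le[OF \<rho>(3)] by auto
    then have "ereal d \<le> inf_Re \<phi> \<rho>" by (simp add: le_inf_Re_iff)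
    then show False using that \<open>d > 0\<close> by simp
  qed
  note * = this
  show "\<rho> = \<rho>'" if "1 < \<rho> \<and> ereal \<rho> < R \<and> inf_Re \<phi> \<rho> = 0" "1 < \<rho>' \<and> ereal \<rho>' < R \<and> inf_Re \<phi> \<rho>' = 0" for \<rho> \<rho>'
    using *[of \<rho> \<rho>'] *[of \<rho>' \<rho>] that by (cases \<rho> \<rho>' rule: linorder_cases) auto
qed

lemma rho_0:
  assumes "inf_Re \<phi> R < 0"
  shows "1 < rho_0 \<phi>" "ereal (rho_0 \<phi>) < R" "inf_Re \<phi> (rho_0 \<phi>) = 0"
  using theI'[OF ex1_rho_0[OF assms]] unfolding rho_0_def by auto

lemma rho_hat: "rho_hat \<phi> \<in> I_set \<phi>" "0 \<le> inf_Re \<phi> (rho_hat \<phi>)"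
proof -
  have "rho_hat \<phi> \<in> I_set \<phi> \<and> 0 \<le> inf_Re \<phi> (rho_hat \<phi>)"
  proof (cases "0 \<le> inf_Re \<phi> R")
    case True
    then have "inf_Re \<phi> R \<noteq> -\<infinity>" by auto
    moreover from R_finite[OF this] obtain \<rho> where "R = ereal \<rho>" "1 < \<rho>" by blast
    ultimately show ?thesis using True by (simp add: rho_hat_def I_set_def)
  next
    case False
    then have neg: "inf_Re \<phi> R < 0" by simp
    show ?thesis
      using rho_0[OF neg] I_setI[of "rho_0 \<phi>"] False by (simp add: rho_hat_def)
  qed
  then show "rho_hat \<phi> \<in> I_set \<phi>" "0 \<le> inf_Re \<phi> (rho_hat \<phi>)" by auto
qed

text \<open>Compare with the chord p + k s through the values at s1 and s2. Between the two levels
  \<open>three_lines_periodic\<close> applies, and k <= 0 turns the chord at s into at least its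
  value at s0; below s1 the bound i1 already suffices.\<close>

lemma inf_Re_concave:
  assumes s: "0 < s1" "s1 < s0" "s0 < s2" "ereal (exp s2) < R"
    and i: "ereal i1 = inf_Re \<phi> (exp s1)" "ereal i0 = inf_Re \<phi> (exp s0)" "ereal i2 = inf_Re \<phi> (exp s2)"
  shows "(s2 - s0) * i1 + (s0 - s1) * i2 \<le> (s2 - s1) * i0"
proof -
  define k where "k = (i2 - i1) / (s2 - s1)"
  define p where "p = i1 - k * s1"
  have i21: "i2 \<le> i1"
  proof -
    have "ereal i2 \<le> ereal i1"
      unfolding i(1) i(3) using s by (intro inf_Re_antimono) (auto simp: one_ereal_def)
    then show ?thesis by simp
  qed
  have k: "k \<le> 0" using i21 s by (simp add: k_def divide_nonpos_pos)
  have l1: "p + k * s1 = i1" by (simp add: p_def)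
  have "k * (s2 - s1) = i2 - i1" using s by (simp add: k_def)
  then have l2: "p + k * s2 = i2" by (simp add: p_def algebra_simps)
  obtain r' where r': "ereal (exp s2) < ereal r'" "ereal r' < R"
    using ereal_dense2[OF s(4)] by blast
  define H where "H = ln r'"
  have H: "s2 < H" "ereal (exp H) < R"
  proof -
    have "0 < r'" using r'(1) exp_gt_zero[of s2] by (simp del: exp_gt_zero)
    then show "s2 < H" "ereal (exp H) < R" using r' by (simp_all add: H_def exp_less_cancel_iff[of s2, symmetric])
  qed
  define G where "G \<sigma> = g (cosh \<sigma>)" for \<sigma>
  have inE: "cosh \<sigma> \<in> bernstein_ellipse R" if "-H < Re \<sigma>" "Re \<sigma> < H" for \<sigma>
  proof -
    have "exp \<bar>Re \<sigma>\<bar> < exp H" using that by auto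
    then have "ereal (exp \<bar>Re \<sigma>\<bar>) < R" using H(2) by (meson less_ereal.simps(1) less_trans)
    then show ?thesis using cosh_in_bernstein_ellipse[of "Re \<sigma>" R "Im \<sigma>"] by simp
  qed
  have "(g \<circ> cosh) holomorphic_on {\<sigma>. -H < Re \<sigma> \<and> Re \<sigma> < H}"
    by (rule holomorphic_on_compose_gen[OF _ g_holomorphic]) (use inE in \<open>auto intro!: holomorphic_on_cosh_sinh\<close>)
  then have Ghol: "G holomorphic_on {\<sigma>. -H < Re \<sigma> \<and> Re \<sigma> < H}"
    by (simp add: G_def[abs_def] o_def)
  \<comment> \<open>The infimum runs over the open ellipse, which omits the curve Re \<sigma> = s;
    the bound there is a limit from smaller s.\<close>
  have boundary: "c \<le> Re (G (Complex s t))"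
    if "0 < s" "s < H" "ereal c = inf_Re \<phi> (exp s)" for s t c
  proof -
    have "continuous_on {0<..<H} (\<lambda>s. Re (G (Complex s t)))"
    proof (intro continuous_on_Re continuous_on_compose2[OF holomorphic_on_imp_continuous_on[OF Ghol]])
      show "continuous_on {0<..<H} (\<lambda>s. Complex s t)" unfolding Complex_eq by (intro continuous_intros)
    qed auto
    then have "isCont (\<lambda>s. Re (G (Complex s t))) s"
      using that by (simp add: continuous_on_eq_continuous_at)
    then have "((\<lambda>s. Re (G (Complex s t))) \<longlongrightarrow> Re (G (Complex s t))) (at_left s)"
      unfolding isCont_def by (rule filterlim_mono[OF _ order_refl at_le]) simp
    moreover have "\<forall>\<^sub>F s' in at_left s. c \<le> Re (G (Complex s' t))"
      using eventually_at_left_real[OF that(1)]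
    proof eventually_elim
      case (elim s')
      then have "cosh (Complex s' t) \<in> bernstein_ellipse (exp s)"
        by (intro cosh_in_bernstein_ellipse) simp
      then have "ereal c \<le> ereal (Re (g (cosh (Complex s' t))))"
        unfolding that(3) by (rule inf_Re_le)
      then show ?case by (simp add: G_def)
    qed
    ultimately show ?thesis by (intro tendsto_lowerbound) auto
  qed
  have "ereal (p + k * s0) \<le> inf_Re \<phi> (exp s0)"
    unfolding le_inf_Re_iff
  proof
    fix z assume z: "z \<in> bernstein_ellipse (exp s0)"
    obtain s t where st: "0 \<le> s" "ereal (exp s) < ereal (exp s0)" "\<bar>t\<bar> \<le> pi" "z = cosh (Complex s t)"
      by (rule in_bernstein_ellipseE[OF z]) (use s in \<open>auto simp: one_ereal_def\<close>)
    then have ss0: "s < s0" by simp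
    show "p + k * s0 \<le> Re (g z)"
    proof (cases "s < s1")
      case True
      then have "z \<in> bernstein_ellipse (exp s1)"
        unfolding st(4) using st(1) by (intro cosh_in_bernstein_ellipse) simp
      then have "i1 \<le> Re (g z)" using inf_Re_le[of z "exp s1"] i(1)[symmetric] by simp
      moreover have "k * s0 \<le> k * s1" using k s by (intro mult_left_mono_neg) auto
      ultimately show ?thesis using l1 by linarith
    next
      case False
      have "p + k * s \<le> Re (G (Complex s t))"
      proof (rule three_lines_periodic[OF Ghol])
        show "G (\<sigma> + 2 * pi * \<i>) = G \<sigma>" for \<sigma> by (simp only: G_def cosh_sinh_periodic)
        show "p + k * s1 \<le> Re (G (Complex s1 t))" for t
          unfolding l1 using s H i by (intro boundary) auto
        show "p + k * s2 \<le> Re (G (Complex s2 t))" for t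
          unfolding l2 using s H i by (intro boundary) auto
      qed (use s H False ss0 st in auto)
      moreover have "k * s0 \<le> k * s" using k ss0 by (intro mult_left_mono_neg) auto
      ultimately show ?thesis by (simp add: G_def st(4))
    qed
  qed
  then have "p + k * s0 \<le> i0" unfolding i(2)[symmetric] by simp
  then have "(s2 - s1) * (p + k * s0) \<le> (s2 - s1) * i0" using s by (intro mult_left_mono) auto
  moreover have "(s2 - s0) * (p + k * s1) + (s0 - s1) * (p + k * s2) = (s2 - s1) * (p + k * s0)"
    by (simp add: algebra_simps)
  ultimately show ?thesis unfolding l1 l2 by simp
qed

text \<open>By concavity the function \<open>s \<mapsto> inf_Re \<phi> (exp s)\<close> has a supporting line at its zero; its slope
  \<open>-\<alpha>\<close> determines the point \<open>x = 2 M / (b \<alpha>)\<close> at which the supremum below is attained.\<close>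

lemma supporting_line:
  assumes neg: "inf_Re \<phi> R < 0"
  obtains \<alpha> where "0 < \<alpha>"
    "\<And>\<rho>. \<rho> \<in> I_set \<phi> \<Longrightarrow> real_of_ereal (inf_Re \<phi> \<rho>) \<le> \<alpha> * (ln (rho_0 \<phi>) - ln \<rho>)"
proof -
  define \<rho>0 where "\<rho>0 = rho_0 \<phi>"
  note \<rho>0 = rho_0[OF neg, folded \<rho>0_def]
  define s0 where "s0 = ln \<rho>0"
  define i where "i \<rho> = real_of_ereal (inf_Re \<phi> (ereal \<rho>))" for \<rho>
  have s0: "0 < s0" "exp s0 = \<rho>0" using \<rho>0(1) by (auto simp: s0_def)
  have i: "ereal (i \<rho>) = inf_Re \<phi> \<rho>" if "1 < \<rho>" "ereal \<rho> < R" for \<rho>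
    using that I_setD(3)[OF I_setI[OF that]] by (simp add: i_def)
  have i_pos: "0 < i \<rho>" if \<rho>: "1 < \<rho>" "\<rho> < \<rho>0" for \<rho>
  proof -
    have "\<And>z. z \<in> bernstein_ellipse \<rho>0 \<Longrightarrow> 0 \<le> Re (g z)"
      using le_inf_Re_iff[of 0 \<rho>0] \<rho>0 by (simp add: zero_ereal_def)
    then obtain d where d: "d > 0" "\<forall>z\<in>bernstein_ellipse \<rho>. d \<le> Re (g z)"
      using Re_g_strict_lower_bound[of \<rho> "ereal \<rho>0" 0] \<rho> \<rho>0 less_imp_le[OF \<rho>0(2)] by auto
    then have "ereal d \<le> inf_Re \<phi> \<rho>" by (simp add: le_inf_Re_iff)
    moreover have "ereal \<rho> < R" using that \<rho>0(2) by (meson less_ereal.simps(1) less_trans)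
    ultimately show ?thesis using i[OF that(1)] d(1) by (metis ereal_less_eq(3) less_le_trans)
  qed
  \<comment> \<open>Concavity with the value 0 at \<rho>0: slopes on the left are at least those on
    the right, both written with reversed sign.\<close>
  have slope: "i \<rho>1 / (s0 - ln \<rho>1) \<le> - i \<rho>2 / (ln \<rho>2 - s0)"
    if \<rho>: "1 < \<rho>1" "\<rho>1 < \<rho>0" "\<rho>0 < \<rho>2" "ereal \<rho>2 < R" for \<rho>1 \<rho>2
  proof -
    have s: "0 < ln \<rho>1" "ln \<rho>1 < s0" "s0 < ln \<rho>2" and e: "exp (ln \<rho>1) = \<rho>1" "exp (ln \<rho>2) = \<rho>2"
      using \<rho> by (auto simp: s0_def)
    have "ereal \<rho>1 < R" using \<rho> \<rho>0(2) by (meson less_ereal.simps(1) less_trans)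
    then have "(ln \<rho>2 - s0) * i \<rho>1 + (s0 - ln \<rho>1) * i \<rho>2 \<le> (ln \<rho>2 - ln \<rho>1) * 0"
      using \<rho> \<rho>0 s i by (intro inf_Re_concave) (auto simp: e s0 zero_ereal_def[symmetric])
    then have "i \<rho>1 * (ln \<rho>2 - s0) \<le> - i \<rho>2 * (s0 - ln \<rho>1)" by (simp add: algebra_simps)
    then have "i \<rho>1 \<le> (- i \<rho>2 * (s0 - ln \<rho>1)) / (ln \<rho>2 - s0)"
      using s by (subst pos_le_divide_eq) auto
    also have "\<dots> = - i \<rho>2 / (ln \<rho>2 - s0) * (s0 - ln \<rho>1)" by simp
    finally show ?thesis using s by (subst pos_divide_le_eq) auto
  qed
  define A where "A = (\<lambda>\<rho>. i \<rho> / (s0 - ln \<rho>)) ` {1<..<\<rho>0}"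
  obtain \<rho>2 where \<rho>2: "ereal \<rho>0 < ereal \<rho>2" "ereal \<rho>2 < R" using ereal_dense2[OF \<rho>0(2)] by blast
  have bdd: "bdd_above A"
    unfolding A_def by (rule bdd_aboveI2[of _ _ "- i \<rho>2 / (ln \<rho>2 - s0)"])
      (use slope[OF _ _ _ \<rho>2(2)] \<rho>2(1) in auto)
  \<comment> \<open>By concavity this is minus the left derivative at s0.\<close>
  define \<alpha> where "\<alpha> = Sup A"
  have mid: "(1 + \<rho>0) / 2 \<in> {1<..<\<rho>0}" using \<rho>0(1) by auto
  have ub: "i \<rho> / (s0 - ln \<rho>) \<le> \<alpha>" if "\<rho> \<in> {1<..<\<rho>0}" for \<rho>
    unfolding \<alpha>_def by (rule cSup_upper[OF _ bdd]) (use that in \<open>auto simp: A_def\<close>)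
  have ln_less: "ln \<rho> < s0" if "\<rho> \<in> {1<..<\<rho>0}" for \<rho> using that by (simp add: s0_def)
  have \<alpha>: "0 < \<alpha>"
  proof -
    have "0 < i ((1 + \<rho>0) / 2) / (s0 - ln ((1 + \<rho>0) / 2))"
      using i_pos[of "(1 + \<rho>0) / 2"] ln_less[OF mid] mid by (intro divide_pos_pos) auto
    then show ?thesis using ub[OF mid] by linarith
  qed
  have above: "i \<rho> \<le> \<alpha> * (s0 - ln \<rho>)" if "\<rho>0 < \<rho>" "ereal \<rho> < R" for \<rho>
  proof -
    have "\<alpha> \<le> - i \<rho> / (ln \<rho> - s0)"
      unfolding \<alpha>_def
    proof (rule cSup_least)
      show "A \<noteq> {}" using mid by (auto simp: A_def)
      show "y \<le> - i \<rho> / (ln \<rho> - s0)" if "y \<in> A" for y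
        using that slope \<open>\<rho>0 < \<rho>\<close> \<open>ereal \<rho> < R\<close> unfolding A_def by auto
    qed
    moreover have "s0 < ln \<rho>" using that \<rho>0(1) by (simp add: s0_def)
    ultimately have "\<alpha> * (ln \<rho> - s0) \<le> - i \<rho>" by (metis diff_gt_0_iff_gt pos_le_divide_eq)
    then show ?thesis by (simp add: algebra_simps)
  qed
  show ?thesis
  proof (rule that[OF \<alpha>])
    fix \<rho> assume \<rho>: "\<rho> \<in> I_set \<phi>"
    have "i \<rho> \<le> \<alpha> * (s0 - ln \<rho>)"
    proof (cases \<rho> \<rho>0 rule: linorder_cases)
      case less
      then have in_A: "\<rho> \<in> {1<..<\<rho>0}" using I_setD(1)[OF \<rho>] by simp
      show ?thesis using ub[OF in_A] ln_less[OF in_A] by (simp add: pos_divide_le_eq)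
    next
      case equal
      then show ?thesis using \<rho>0(3) by (simp add: i_def s0_def)
    next
      case greater
      have le: "i \<rho> \<le> \<alpha> * (s0 - ln \<rho>')" if "\<rho>' \<in> {\<rho>0<..<\<rho>}" for \<rho>'
      proof -
        have less: "ereal \<rho>' < R"
          using that I_setD(2)[OF \<rho>] by (meson greaterThanLessThan_iff less_ereal.simps(1) less_le_trans)
        have "inf_Re \<phi> \<rho> \<le> inf_Re \<phi> \<rho>'"
          using that \<rho>0(1) by (intro inf_Re_antimono) (auto simp: one_ereal_def)
        then have "ereal (i \<rho>) \<le> ereal (i \<rho>')"
          using I_setD(3)[OF \<rho>] i[of \<rho>'] less that \<rho>0(1) by (simp add: i_def)
        then show ?thesis using above[of \<rho>'] less that by simp
      qed
      have "((\<lambda>\<rho>'. \<alpha> * (s0 - ln \<rho>')) \<longlongrightarrow> \<alpha> * (s0 - ln \<rho>)) (at_left \<rho>)"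
        using I_setD(1)[OF \<rho>] by (intro tendsto_intros) auto
      moreover have "\<forall>\<^sub>F \<rho>' in at_left \<rho>. i \<rho> \<le> \<alpha> * (s0 - ln \<rho>')"
        using eventually_at_left_real[OF greater] by eventually_elim (rule le)
      ultimately show ?thesis by (intro tendsto_lowerbound) auto
    qed
    then show "real_of_ereal (inf_Re \<phi> \<rho>) \<le> \<alpha> * (ln (rho_0 \<phi>) - ln \<rho>)"
      by (simp add: i_def s0_def \<rho>0_def)
  qed
qed

lemma SUP_INF_pointwise_bounds:
  assumes b: "0 < b" and M: "1 \<le> (M :: nat)"
  shows "(SUP x\<in>{0<..}. INF \<rho>\<in>I_set \<phi>.
      ereal (\<rho> powi (- 2 * int M) * exp (- b * x * real_of_ereal (inf_Re \<phi> \<rho>))))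
    = ereal (rho_hat \<phi> powi (- 2 * int M))" (is "?S = _")
proof (rule antisym)
  let ?v = "\<lambda>x (\<rho> :: real). (\<rho> powi (- 2 * int M) :: real) * exp (- b * x * real_of_ereal (inf_Re \<phi> \<rho>))"
  have powi: "\<rho> powi (- 2 * int M) = exp (- 2 * real M * ln \<rho>)" if "0 < \<rho>" for \<rho> :: real
  proof -
    have "exp (real (2 * M) * ln \<rho>) = \<rho> ^ (2 * M)"
      unfolding exp_of_nat_mult using that by simp
    moreover have "\<rho> powi (- 2 * int M) = inverse (\<rho> ^ (2 * M))"
      by (simp add: power_int_def nat_mult_distrib power_inverse)
    ultimately show ?thesis by (simp add: exp_minus)
  qed
  show "?S \<le> ereal (rho_hat \<phi> powi (- 2 * int M))"
  proof (rule SUP_least)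
    fix x :: real assume x: "x \<in> {0<..}"
    have "0 \<le> real_of_ereal (inf_Re \<phi> (rho_hat \<phi>))"
      using rho_hat(2) by (rule real_of_ereal_pos)
    then have "?v x (rho_hat \<phi>) \<le> rho_hat \<phi> powi (- 2 * int M) * 1"
      using b x I_setD(1)[OF rho_hat(1)] by (intro mult_left_mono) auto
    then show "(INF \<rho>\<in>I_set \<phi>. ereal (?v x \<rho>)) \<le> ereal (rho_hat \<phi> powi (- 2 * int M))"
      by (intro INF_lower2[OF rho_hat(1)]) simp
  qed
  show "ereal (rho_hat \<phi> powi (- 2 * int M)) \<le> ?S"
  proof (cases "0 \<le> inf_Re \<phi> R")
    case True
    then have "inf_Re \<phi> R \<noteq> -\<infinity>" by auto
    then obtain \<rho>h where \<rho>h: "R = ereal \<rho>h" "1 < \<rho>h" by (rule R_finite)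
    then have hat: "rho_hat \<phi> = \<rho>h" using True by (simp add: rho_hat_def)
    let ?k = "\<rho>h powi (- 2 * int M)"
    \<comment> \<open>Here \<open>rho_hat\<close> is the largest parameter, so its power is the
      smallest, and all infima are at most r; the loss exp (-b x r) vanishes as x tends to
      0.\<close>
    have le: "ereal (?k * exp (- b * x * r)) \<le> ?S" if x: "0 < x" for x
    proof (rule SUP_upper2[of x])
      show "ereal (?k * exp (- b * x * r)) \<le> (INF \<rho>\<in>I_set \<phi>. ereal (?v x \<rho>))"
      proof (rule INF_greatest)
        fix \<rho> assume \<rho>: "\<rho> \<in> I_set \<phi>"
        have 1: "1 < \<rho>" "\<rho> \<le> \<rho>h" using I_setD[OF \<rho>] \<rho>h by auto
        have "ereal (real_of_ereal (inf_Re \<phi> \<rho>)) \<le> ereal r"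
          unfolding I_setD(3)[OF \<rho>] using 1 by (intro inf_Re_le_r) (auto simp: one_ereal_def)
        then have "exp (- b * x * r) \<le> exp (- b * x * real_of_ereal (inf_Re \<phi> \<rho>))"
          using b x by simp
        moreover have "?k \<le> \<rho> powi (- 2 * int M)"
        proof -
          have "real M * ln \<rho> \<le> real M * ln \<rho>h" using 1 by (intro mult_left_mono) auto
          then show ?thesis using powi[of \<rho>] powi[of \<rho>h] 1 by simp
        qed
        ultimately have "?k * exp (- b * x * r) \<le> ?v x \<rho>"
          using 1 by (intro mult_mono) auto
        then show "ereal (?k * exp (- b * x * r)) \<le> ereal (?v x \<rho>)" by simp
      qed
    qed (use x in auto)
    have "((\<lambda>x. ?k * exp (- b * x * r)) \<longlongrightarrow> ?k * exp (- b * 0 * r)) (at_right 0)"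
      by (intro tendsto_intros)
    then have "((\<lambda>x. ereal (?k * exp (- b * x * r))) \<longlongrightarrow> ereal ?k) (at_right 0)"
      by simp
    moreover have "\<forall>\<^sub>F x in at_right 0. ereal (?k * exp (- b * x * r)) \<le> ?S"
      using eventually_at_right_less[of "0 :: real"] by eventually_elim (rule le)
    ultimately show ?thesis
      unfolding hat by (intro tendsto_upperbound) auto
  next
    case False
    then have neg: "inf_Re \<phi> R < 0" by simp
    have hat: "rho_hat \<phi> = rho_0 \<phi>" using False by (simp add: rho_hat_def)
    obtain \<alpha> where \<alpha>: "0 < \<alpha>"
      "\<And>\<rho>. \<rho> \<in> I_set \<phi> \<Longrightarrow> real_of_ereal (inf_Re \<phi> \<rho>) \<le> \<alpha> * (ln (rho_0 \<phi>) - ln \<rho>)"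
      using supporting_line[OF neg] by blast
    define x where "x = 2 * real M / (b * \<alpha>)"
    have x: "0 < x" using b M \<alpha> by (simp add: x_def)
    have bx: "b * x * \<alpha> = 2 * real M" using b \<alpha> by (simp add: x_def)
    show ?thesis
      unfolding hat
    proof (rule SUP_upper2[of x])
      show "ereal (rho_0 \<phi> powi (- 2 * int M)) \<le> (INF \<rho>\<in>I_set \<phi>. ereal (?v x \<rho>))"
      proof (rule INF_greatest)
        fix \<rho> assume \<rho>: "\<rho> \<in> I_set \<phi>"
        \<comment> \<open>Since b x \<alpha> = 2 M, along the supporting line the exponential and
          the power balance exactly, so no \<rho> gives less than \<open>rho_0\<close>.\<close>
        have "(b * x) * real_of_ereal (inf_Re \<phi> \<rho>) \<le> (b * x) * (\<alpha> * (ln (rho_0 \<phi>) - ln \<rho>))"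
          using \<alpha>(2)[OF \<rho>] b x by (intro mult_left_mono) auto
        also have "\<dots> = 2 * real M * (ln (rho_0 \<phi>) - ln \<rho>)"
          by (simp only: mult.assoc[symmetric] bx)
        finally have "- 2 * real M * ln (rho_0 \<phi>) \<le> - 2 * real M * ln \<rho> + - b * x * real_of_ereal (inf_Re \<phi> \<rho>)"
          by (simp add: algebra_simps)
        then have "rho_0 \<phi> powi (- 2 * int M) \<le> ?v x \<rho>"
          using I_setD(1)[OF \<rho>] rho_0(1)[OF neg] by (simp only: powi less_trans[OF zero_less_one] exp_add[symmetric] exp_le_cancel_iff)
        then show "ereal (rho_0 \<phi> powi (- 2 * int M)) \<le> ereal (?v x \<rho>)" by simp
      qed
    qed (use x in auto)
  qed
qed

text \<open>\<open>E\<close> lies strictly below the bound and serves all y at once; this keeps the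
  inequality strict after the passage to integrals, where only <= survives.\<close>

lemma exp_continuation_approximation:
  fixes n :: nat
  assumes \<rho>: "\<rho> \<in> I_set \<phi>" and t: "0 \<le> t" and n: "1 \<le> n"
  defines "K \<equiv> exp (- t * real_of_ereal (inf_Re \<phi> \<rho>))"
  shows "\<exists>p E. degree p \<le> n - 1 \<and> (\<forall>y\<in>{-1..1}. \<bar>exp (- t * \<phi> y) - poly p y\<bar> \<le> E)
    \<and> E < 8 / pi * inverse \<rho> ^ n * K"
proof -
  define q where "q = inverse \<rho> ^ n"
  have \<rho>1: "1 < \<rho>" by (rule I_setD(1)[OF \<rho>])
  have q: "0 < q" using \<rho>1 by (simp add: q_def)
  have K: "0 < K" by (simp add: K_def)
  \<comment> \<open>Equivalent to 5 / 2 < 8 / pi; the case q > 1 / 2 needs only 1 < 4 / pi.\<close>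
  have pi: "pi < 16 / 5" by (rule le_less_trans[OF pi_approx(2)]) simp
  have sub: "bernstein_ellipse \<rho> \<subseteq> bernstein_ellipse R"
    using \<rho>1 I_setD(2)[OF \<rho>] by (intro bernstein_ellipse_mono) (auto simp: one_ereal_def)
  have lower: "real_of_ereal (inf_Re \<phi> \<rho>) \<le> Re (g z)" if "z \<in> bernstein_ellipse \<rho>" for z
  proof -
    have "ereal (real_of_ereal (inf_Re \<phi> \<rho>)) \<le> ereal (Re (g z))"
      by (subst I_setD(3)[OF \<rho>]) (rule inf_Re_le[OF that])
    then show ?thesis by simp
  qed
  define h where "h z = exp (- (of_real t * g z))" for z
  have h_real: "h (of_real y) = of_real (exp (- t * \<phi> y))" if "y \<in> {-1..1}" for y
    using g_of_real[OF that] by (simp add: h_def flip: exp_of_real)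
  have h_bound: "cmod (h z) \<le> K" if "z \<in> bernstein_ellipse (ereal \<rho>)" for z
    using mult_left_mono[OF lower[OF that] t] by (simp add: h_def K_def)
  show ?thesis
  proof (cases "q \<le> 1 / 2")
    case True
    have "2 * q + q\<^sup>2 \<le> 5 / 2 * q"
      using mult_right_mono[OF True, of q] q by (simp add: power2_eq_square)
    also have "5 / 2 < 8 / pi" using pi by (simp add: less_divide_eq)
    then have "5 / 2 * q < 8 / pi * q" using q by (rule mult_strict_right_mono)
    finally have "K * (2 * q + q\<^sup>2) < K * (8 / pi * q)" using K by (rule mult_strict_left_mono)
    from dense[OF this] obtain E where E: "K * (2 * q + q\<^sup>2) < E" "E < K * (8 / pi * q)" by blast
    have "\<exists>p :: real poly. degree p \<le> n - 1 \<and> (\<forall>y\<in>{-1..1}. \<bar>Re (h (of_real y)) - poly p y\<bar> \<le> E)"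
    proof (rule ellipse_polynomial_approximation[OF \<rho>1 _ h_bound _ n E(1)[unfolded q_def]])
      show "h holomorphic_on bernstein_ellipse (ereal \<rho>)"
        unfolding h_def by (intro holomorphic_intros holomorphic_on_subset[OF g_holomorphic sub])
      show "Im (h (of_real y)) = 0" if "y \<in> {-1..1}" for y by (simp only: h_real[OF that] Im_complex_of_real)
    qed
    then obtain p :: "real poly" where p: "degree p \<le> n - 1" "\<forall>y\<in>{-1..1}. \<bar>Re (h (of_real y)) - poly p y\<bar> \<le> E"
      by blast
    have "\<forall>y\<in>{-1..1}. \<bar>exp (- t * \<phi> y) - poly p y\<bar> \<le> E"
      using p(2) h_real by (metis Re_complex_of_real)
    moreover have "E < 8 / pi * inverse \<rho> ^ n * K" using E(2) by (simp add: q_def mult_ac)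
    ultimately show ?thesis using p(1) by blast
  next
    case False
    have "\<bar>exp (- t * \<phi> y) - poly 0 y\<bar> \<le> K" if "y \<in> {-1..1}" for y
      using h_bound[OF of_real_in_bernstein_ellipse[OF that]] \<rho>1 h_real[OF that]
      by (simp add: one_ereal_def)
    moreover have "1 < 8 / pi * q"
    proof -
      have "1 < 8 / pi * (1 / 2)" using pi by (simp add: less_divide_eq)
      also have "\<dots> \<le> 8 / pi * q" using False by (intro mult_left_mono) auto
      finally show ?thesis .
    qed
    from mult_strict_right_mono[OF this K] have "K < 8 / pi * inverse \<rho> ^ n * K"
      by (simp only: mult_1 q_def)
    ultimately show ?thesis by (intro exI[of _ 0] exI[of _ K]) simp
  qed
qed

end

section \<open>The error bound\<close>

theorem theorem2p14:
  fixes a b :: real and M :: nat and W \<phi> :: "real \<Rightarrow> real"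
    and f :: "complex \<Rightarrow> complex" and u c :: "nat \<Rightarrow> real" and err :: "real \<Rightarrow> real"
  assumes "0 < a" and "a < b" and "M \<ge> 1"
    and "bounded (W ` {a..b})" and "mono_on {a..b} W"
    and "\<exists>S \<subseteq> points_of_increase W a b. finite S \<and> card S = M + 1"
    and "\<And>z. has_RS_integral (\<lambda>t. exp (- z * of_real t)) W a b (f z)"
    and "\<phi> \<in> F_class (a / b)" and "rho_A \<phi> > 1"
    and "gauss_quadrature M (\<lambda>s. W (b * \<phi> s)) u c"
  defines "err \<equiv> \<lambda>x. cmod (f (of_real x) - of_real (\<Sum>\<nu>=1..M. c \<nu> * exp (- b * \<phi> (u \<nu>) * x)))"
  shows "(\<exists>x\<^sub>0\<ge>0. (\<forall>x\<ge>0. err x \<le> err x\<^sub>0) \<and> 0 < err x\<^sub>0 \<and>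
            err x\<^sub>0 < 16 / pi * rho_hat \<phi> powi (- 2 * int M) * Re (f 0))
       \<and> (\<forall>\<rho>\<in>I_set \<phi>. \<forall>x>0.
            err x < 16 / pi * \<rho> powi (- 2 * int M) *
              exp (- b * x * real_of_ereal (inf_Re \<phi> \<rho>)) * Re (f 0))
       \<and> (SUP x\<in>{0<..}. INF \<rho>\<in>I_set \<phi>.
            ereal (\<rho> powi (- 2 * int M) * exp (- b * x * real_of_ereal (inf_Re \<phi> \<rho>))))
          = ereal (rho_hat \<phi> powi (- 2 * int M))"
proof -
  interpret q: quadrature_setting a b W \<phi> f M u c
    by unfold_locales fact+
  have b: "0 < b" by (rule q.b_pos)
  interpret continuation_setting "a / b" \<phi>
    using assms(1,2,8,9) b by unfold_locales (auto simp: divide_less_eq)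
  have err: "err x = q.err x" for x
    by (simp add: err_def q.err_def)
  have f0: "Re (f 0) = q.V" by (simp add: q.f_0)
  have pointwise: "err x < 16 / pi * \<rho> powi (- 2 * int M) *
      exp (- b * x * real_of_ereal (inf_Re \<phi> \<rho>)) * Re (f 0)"
    if \<rho>: "\<rho> \<in> I_set \<phi>" and x: "0 < x" for \<rho> x
  proof -
    have "0 \<le> b * x" "1 \<le> 2 * M" using b x assms(3) by auto
    from exp_continuation_approximation[OF \<rho> this]
    obtain p E where p: "degree p \<le> 2 * M - 1"
      "\<And>y. y \<in> {-1..1} \<Longrightarrow> \<bar>exp (- (b * x) * \<phi> y) - poly p y\<bar> \<le> E"
      and E: "E < 8 / pi * inverse \<rho> ^ (2 * M) * exp (- (b * x) * real_of_ereal (inf_Re \<phi> \<rho>))"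
      by blast
    have "err x \<le> 2 * E * q.V"
      unfolding err by (rule q.err_le[OF p(1)]) (use p(2) in simp)
    also have "\<dots> < 2 * (8 / pi * inverse \<rho> ^ (2 * M) * exp (- (b * x) * real_of_ereal (inf_Re \<phi> \<rho>))) * q.V"
      using E q.V_pos by (intro mult_strict_right_mono mult_strict_left_mono) simp_all
    also have "inverse \<rho> ^ (2 * M) = \<rho> powi (- 2 * int M)"
      by (simp add: power_int_def nat_mult_distrib)
    finally show ?thesis by (simp add: f0)
  qed
  have max: "\<exists>x\<^sub>0\<ge>0. (\<forall>x\<ge>0. err x \<le> err x\<^sub>0) \<and> 0 < err x\<^sub>0 \<and>
      err x\<^sub>0 < 16 / pi * rho_hat \<phi> powi (- 2 * int M) * Re (f 0)"
  proof -
    \<comment> \<open>The maximum is attained at a positive x, so the pointwise bound with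
      \<open>rho_hat\<close> applies; its exponential factor is at most 1 because the infimum is
      nonnegative there.\<close>
    obtain x where x: "0 < x" "\<forall>x'\<ge>0. err x' \<le> err x" "0 < err x"
      using q.err_attains_max by (auto simp: err)
    let ?k = "16 / pi * rho_hat \<phi> powi (- 2 * int M)"
    have k: "0 \<le> ?k" using I_setD(1)[OF rho_hat(1)] by simp
    have "0 \<le> real_of_ereal (inf_Re \<phi> (rho_hat \<phi>))"
      using rho_hat(2) by (rule real_of_ereal_pos)
    then have "exp (- b * x * real_of_ereal (inf_Re \<phi> (rho_hat \<phi>))) \<le> 1"
      using b x(1) by simp
    then have "?k * exp (- b * x * real_of_ereal (inf_Re \<phi> (rho_hat \<phi>))) * Re (f 0) \<le> ?k * 1 * Re (f 0)"
      using k q.V_nonneg by (intro mult_right_mono mult_left_mono) (auto simp: f0)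
    then have "err x < ?k * Re (f 0)"
      using pointwise[OF rho_hat(1) x(1)] by simp
    then show ?thesis using x by (intro exI[of _ x]) auto
  qed
  show ?thesis
    using max pointwise SUP_INF_pointwise_bounds[OF b assms(3)] by blast
qed

end
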